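(* Let $\mathfrak g$ be the 6-dimensional nilpotent Lie algebra $(0,0,0,e^{15},0,e^{13})$ with symplectic form $\omega=e^{12}+e^{34}+e^{56}$, and consider the Type IIA flow $\partial_t\varphi=\mathrm d\Lambda_\omega\mathrm d\,\mathcal F(\varphi)$ for $\varphi(t)\in\bigwedge^3\mathfrak g^*$ with an arbitrary initial 3-form $\varphi(0)\in\bigwedge^3\mathfrak g^*$ (not necessarily closed, primitive or positive). Write the coefficients of $\varphi$ as $$\begin{aligned}\varphi=&\,Ae^{135}+Be^{136}+Ce^{145}+De^{146}+Ee^{235}+Fe^{236}+Ge^{245}+He^{246}\\&+(Ie^1+Je^2)(e^{34}-e^{56})+(Ke^3+Le^4)(e^{12}-e^{56})+(Me^5+Ne^6)(e^{12}-e^{34})\\&+(Oe^1+Pe^2)(e^{34}+e^{56})+(Qe^3+Re^4)(e^{12}+e^{56})+(Se^5+Te^6)(e^{12}+e^{34}),\end{aligned}$$ and set $$\begin{aligned}\mathcal R=&\,4H(BG+CF+DE-2IJ-2KL-2MN+2OP+2QR+2ST)\\&+8\big[D(J^2-P^2)+F(L^2-R^2)+G(N^2-T^2)-DFG-2JLN-2PLT+2JRT+2PRN\big].\end{aligned}$$ Then: (i) Along the flow all the coefficients $B,C,\dots,S,T$ (hence also $\mathcal R$) are constant in $t$, and $A$ satisfies $\partial_tA=-4AH^2+\mathcal R$. Hence the flow exists for all $t\ge 0$, with $$A(t)=e^{-4H^2t}\left[\frac{\mathcal R\,(e^{4H^2t}-1)}{4H^2}+A(0)\right]\quad (H\neq0),\qquad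 A(t)=A(0)+\mathcal R\,t\quad(H=0).$$ (ii) $\varphi(t)$ converges as $t\to\infty$ if and only if $H\ne0$ or $H=\mathcal R=0$. (iii) If $H=0$ and $\mathcal R\neq0$, then $\displaystyle\lim_{t\to\infty}\frac{\varphi(t)}{\mathcal R\,t}=e^{135}=:\varphi_\infty$. The kernel $\ker\varphi_\infty=\{v\in\mathfrak g:\iota_v\varphi_\infty=0\}=\mathrm{Span}\{e_2,e_4,e_6\}$ is a Lagrangian subspace and an ideal of $\mathfrak g$, and on any nilmanifold obtained as the quotient of the simply connected Lie group of $\mathfrak g$ by a cocompact discrete subgroup it defines a Lagrangian foliation which gives rise to a Lagrangian fibration. (iv) If $H\neq0$, then $\displaystyle\lim_{t\to\infty}A(t)=\frac{\mathcal R}{4H^2}$, and $\varphi(t)$ converges to a 3-form in $\bigwedge^3\mathfrak g^*$ that is a stationary point of the Type IIA flow.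
   Context: Notation: $e^{ij}=e^i\wedge e^j$, $e^{ijk}=e^i\wedge e^j\wedge e^k$, and products of forms are wedge products. The symbol $(0,0,0,e^{15},0,e^{13})$ means that $\mathfrak g$ has a basis $e_1,\dots,e_6$ with dual basis $e^1,\dots,e^6$ of $\mathfrak g^*$ such that $\mathrm de^1=\mathrm de^2=\mathrm de^3=\mathrm de^5=0$, $\mathrm de^4=e^{15}$, $\mathrm de^6=e^{13}$. Here $\mathrm d$ is the Chevalley–Eilenberg differential, $\mathrm de^k=-\tfrac12c^k_{ij}e^i\wedge e^j$ with $[e_i,e_j]=c_{ij}^ke_k$. Elements of $\bigwedge^*\mathfrak g^*$ are identified with left-invariant forms on the corresponding Lie group (and with the induced forms on quotients by discrete subgroups). $\Lambda_\omega$ is the Lefschetz operator of contraction with $\omega$ (e.g. $\Lambda_\omega(e^{12}\wedge e^{56})=e^{12}+e^{56}$ and $\Lambda_\omega(e^{12}\wedge e^{35})=e^{35}$). For a 3-form $\varphi$ on a 6-dimensional symplectic vector space $(V,\omega)$ with basis $e_i$ and dual basis $e^i$, define $\mathcal K(\varphi)\in\mathrm{End}(V)$ by $$\mathcal K(\varphi)(v)\cdot\frac{\omega^3}{3!}=-\sum_{i=1}^6e_i\otimes\big(e^i\wedge\iota_v\varphi\wedge\varphi\big)$$ (identifying $\bigwedge^6V^*$ with $\mathbb R$ via $\omega^3/3!$), and define the 3-form $\mathcal F(\varphi)$ by $\mathcal F(\varphi)(v_1,v_2,v_3)=-2\varphi(\mathcal K(\varphi)(v_1),v_2,v_3)$,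 which is cubic in $\varphi$. A stationary point of the flow is a 3-form $\varphi$ with $\mathrm d\Lambda_\omega\mathrm d\,\mathcal F(\varphi)=0$. *)

theory Defs
  imports
    "HOL-Analysis.Analysis"
    "HOL-Algebra.Coset"
    "HOL-Library.Function_Algebras"
    "HOL-Library.Disjoint_Sets"
begin

section \<open>The Lie algebra and its exterior algebra\<close>

text \<open>
  The Lie algebra is realised on \<^typ>\<open>real^6\<close>, the basis vector \<open>e\<^sub>i\<close> being
  \<open>axis i 1\<close>.  The index type \<open>6\<close> is the type of integers modulo 6, so its elements are
  \<open>1, 2, 3, 4, 5\<close> and \<open>6 = 0\<close>.
\<close>

type_synonym V = "real^6"

lemma exhaust_6:
  fixes i :: 6
  shows "i = 1 \<or> i = 2 \<or> i = 3 \<or> i = 4 \<or> i = 5 \<or> i = 6"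
proof (induct i)
  case (of_int z)
  then have "z = 0 \<or> z = 1 \<or> z = 2 \<or> z = 3 \<or> z = 4 \<or> z = 5" by auto
  then show ?case by auto
qed

lemma UNIV_6: "(UNIV :: 6 set) = {1, 2, 3, 4, 5, 6}"
  using exhaust_6 by auto

lemma sum_6: "sum f (UNIV :: 6 set) = f 1 + f 2 + f 3 + f 4 + f 5 + f 6"
  unfolding UNIV_6 by (simp add: add.assoc)

lemma forall_6: "(\<forall>i::6. P i) \<longleftrightarrow> P 1 \<and> P 2 \<and> P 3 \<and> P 4 \<and> P 5 \<and> P 6"
  by (metis exhaust_6)

text \<open>
  Since \<open>de\<^sup>k(u,v) = - e\<^sup>k([u,v])\<close>, the equations \<open>de\<^sup>4 = e\<^sup>1\<^sup>5\<close> and \<open>de\<^sup>6 = e\<^sup>1\<^sup>3\<close>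
  amount to \<open>[e\<^sub>1,e\<^sub>5] = - e\<^sub>4\<close> and \<open>[e\<^sub>1,e\<^sub>3] = - e\<^sub>6\<close>; see \<open>ce_d_coframe\<close> below.
\<close>

definition lie_bracket :: "V \<Rightarrow> V \<Rightarrow> V" where
  "lie_bracket u v =
     - (u$1 * v$5 - u$5 * v$1) *\<^sub>R axis 4 1 - (u$1 * v$3 - u$3 * v$1) *\<^sub>R axis 6 1"

lemma lie_bracket_nth:
  "lie_bracket u v $ 1 = 0" "lie_bracket u v $ 2 = 0" "lie_bracket u v $ 3 = 0"
  "lie_bracket u v $ 4 = - (u$1 * v$5 - u$5 * v$1)" "lie_bracket u v $ 5 = 0"
  "lie_bracket u v $ 6 = - (u$1 * v$3 - u$3 * v$1)" "lie_bracket u v $ 0 = - (u$1 * v$3 - u$3 * v$1)"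
  by (simp_all add: lie_bracket_def axis_def)

lemma lie_bracket_self: "lie_bracket u u = 0"
  by (simp add: lie_bracket_def)

lemma lie_bracket_two_step: "lie_bracket u (lie_bracket v w) = 0"
  by (simp add: vec_eq_iff forall_6 lie_bracket_nth)

lemma lie_bracket_bilinear: "bilinear lie_bracket"
  unfolding bilinear_def
  by (auto intro!: linearI simp: vec_eq_iff forall_6 lie_bracket_nth algebra_simps)

definition lie_ideal :: "V set \<Rightarrow> bool" where
  "lie_ideal L \<longleftrightarrow> subspace L \<and> (\<forall>x. \<forall>y\<in>L. lie_bracket x y \<in> L)"

text \<open>
  An element of the exterior algebra of the dual space is encoded by its values on all finite
  lists of vectors, the degree \<open>k\<close> component being read off on lists of length \<open>k\<close>.
\<close>

type_synonym form = "V list \<Rightarrow> real"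

definition kforms :: "nat \<Rightarrow> form set" where
  "kforms k = {\<alpha>. (\<forall>vs. length vs \<noteq> k \<longrightarrow> \<alpha> vs = 0) \<and>
     (\<forall>xs ys. length xs + 1 + length ys = k \<longrightarrow> linear (\<lambda>v. \<alpha> (xs @ v # ys))) \<and>
     (\<forall>vs i j. i < j \<and> j < length vs \<and> vs ! i = vs ! j \<longrightarrow> \<alpha> vs = 0)}"

definition scale_form :: "real \<Rightarrow> form \<Rightarrow> form" (infixr "*\<^sub>f" 70) where
  "c *\<^sub>f \<alpha> = (\<lambda>vs. c * \<alpha> vs)"

text \<open>
  The wedge product, as a sum over shuffles: \<open>I\<close> is the set of positions fed to the first
  factor, and the sign is that of the shuffle.  In particular
  \<open>(e\<^sup>i \<and> e\<^sup>j)(u,v) = e\<^sup>i(u) e\<^sup>j(v) - e\<^sup>j(u) e\<^sup>i(v)\<close>.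
\<close>

definition wedge :: "form \<Rightarrow> form \<Rightarrow> form" (infixr "\<and>\<^sub>f" 75) where
  "\<alpha> \<and>\<^sub>f \<beta> = (\<lambda>vs. \<Sum>I\<in>Pow {..<length vs}.
     (-1) ^ card {(i, j). i \<in> I \<and> j \<in> {..<length vs} - I \<and> j < i} *
     \<alpha> (nths vs I) * \<beta> (nths vs (- I)))"

definition contract :: "V \<Rightarrow> form \<Rightarrow> form" where
  "contract v \<alpha> = (\<lambda>vs. \<alpha> (v # vs))"

text \<open>The Chevalley--Eilenberg differential.\<close>

definition ce_d :: "form \<Rightarrow> form" where
  "ce_d \<alpha> = (\<lambda>vs. \<Sum>j<length vs. \<Sum>i<j.
     (-1) ^ (i + j) * \<alpha> (lie_bracket (vs ! i) (vs ! j) # nths vs (- {i, j})))"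

definition coframe :: "6 \<Rightarrow> form" where
  "coframe i = (\<lambda>vs. case vs of [v] \<Rightarrow> v $ i | _ \<Rightarrow> 0)"

abbreviation e2 :: "6 \<Rightarrow> 6 \<Rightarrow> form" where
  "e2 i j \<equiv> coframe i \<and>\<^sub>f coframe j"

abbreviation e3 :: "6 \<Rightarrow> 6 \<Rightarrow> 6 \<Rightarrow> form" where
  "e3 i j k \<equiv> coframe i \<and>\<^sub>f coframe j \<and>\<^sub>f coframe k"

definition omega :: form where
  "omega = e2 1 2 + e2 3 4 + e2 5 6"

definition vol :: form where
  "vol = (1 / fact 3) *\<^sub>f (omega \<and>\<^sub>f omega \<and>\<^sub>f omega)"

text \<open>
  Contraction with \<open>\<omega>\<close>.  As \<open>e\<^sub>1,\<dots>,e\<^sub>6\<close> is a Darboux basis, the sum is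
  \<open>\<alpha>(e\<^sub>1,e\<^sub>2,\<dots>) + \<alpha>(e\<^sub>3,e\<^sub>4,\<dots>) + \<alpha>(e\<^sub>5,e\<^sub>6,\<dots>)\<close>.
\<close>

definition Lefschetz :: "form \<Rightarrow> form" where
  "Lefschetz \<alpha> = (\<lambda>vs. (1/2) * (\<Sum>i\<in>UNIV. \<Sum>j\<in>UNIV.
     omega [axis i 1, axis j 1] * \<alpha> (axis i 1 # axis j 1 # vs)))"

text \<open>The identification of top degree forms with real numbers given by \<open>\<omega>\<^sup>3/3!\<close>.\<close>

definition top_coeff :: "form \<Rightarrow> real" where
  "top_coeff \<alpha> =
     (let E = [axis 1 1, axis 2 1, axis 3 1, axis 4 1, axis 5 1, axis 6 1] in \<alpha> E / vol E)"

definition Kmap :: "form \<Rightarrow> V \<Rightarrow> V" where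
  "Kmap \<phi> v =
     - (\<Sum>i\<in>UNIV. top_coeff (coframe i \<and>\<^sub>f contract v \<phi> \<and>\<^sub>f \<phi>) *\<^sub>R axis i 1)"

definition Fform :: "form \<Rightarrow> form" where
  "Fform \<phi> = (\<lambda>vs. case vs of [v1, v2, v3] \<Rightarrow> - 2 * \<phi> [Kmap \<phi> v1, v2, v3] | _ \<Rightarrow> 0)"

definition flow_rhs :: "form \<Rightarrow> form" where
  "flow_rhs \<phi> = ce_d (Lefschetz (ce_d (Fform \<phi>)))"

definition stationary :: "form \<Rightarrow> bool" where
  "stationary \<phi> \<longleftrightarrow> flow_rhs \<phi> = 0"

text \<open>
  Derivatives are taken valuewise; on the finite-dimensional space of 3-forms this is the usual
  derivative.  Likewise \<open>tendsto\<close> for forms refers to the product topology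
  (pointwise convergence) on \<^typ>\<open>form\<close>, which induces the usual topology on 3-forms.
\<close>

definition flow_solution :: "real set \<Rightarrow> (real \<Rightarrow> form) \<Rightarrow> bool" where
  "flow_solution J \<phi> \<longleftrightarrow> (\<forall>t\<in>J. \<phi> t \<in> kforms 3 \<and>
     (\<forall>vs. ((\<lambda>s. \<phi> s vs) has_real_derivative flow_rhs (\<phi> t) vs) (at t within J)))"

datatype coeffs = Coeffs
  (coA: real) (coB: real) (coC: real) (coD: real) (coE: real) (coF: real) (coG: real)
  (coH: real) (coI: real) (coJ: real) (coK: real) (coL: real) (coM: real) (coN: real)
  (coO: real) (coP: real) (coQ: real) (coR: real) (coS: real) (coT: real)

primrec of_coeffs :: "coeffs \<Rightarrow> form" where
  "of_coeffs (Coeffs A B C D E F G H I J K L M N O' P Q R S T) =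
     A *\<^sub>f e3 1 3 5 + B *\<^sub>f e3 1 3 6 + C *\<^sub>f e3 1 4 5 + D *\<^sub>f e3 1 4 6
   + E *\<^sub>f e3 2 3 5 + F *\<^sub>f e3 2 3 6 + G *\<^sub>f e3 2 4 5 + H *\<^sub>f e3 2 4 6
   + (I *\<^sub>f coframe 1 + J *\<^sub>f coframe 2) \<and>\<^sub>f (e2 3 4 - e2 5 6)
   + (K *\<^sub>f coframe 3 + L *\<^sub>f coframe 4) \<and>\<^sub>f (e2 1 2 - e2 5 6)
   + (M *\<^sub>f coframe 5 + N *\<^sub>f coframe 6) \<and>\<^sub>f (e2 1 2 - e2 3 4)
   + (O' *\<^sub>f coframe 1 + P *\<^sub>f coframe 2) \<and>\<^sub>f (e2 3 4 + e2 5 6)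
   + (Q *\<^sub>f coframe 3 + R *\<^sub>f coframe 4) \<and>\<^sub>f (e2 1 2 + e2 5 6)
   + (S *\<^sub>f coframe 5 + T *\<^sub>f coframe 6) \<and>\<^sub>f (e2 1 2 + e2 3 4)"

definition coeffs_of :: "form \<Rightarrow> coeffs" where
  "coeffs_of \<phi> = (THE c. \<phi> = of_coeffs c)"

primrec calR :: "coeffs \<Rightarrow> real" where
  "calR (Coeffs A B C D E F G H I J K L M N O' P Q R S T) =
     4 * H * (B*G + C*F + D*E - 2*I*J - 2*K*L - 2*M*N + 2*O'*P + 2*Q*R + 2*S*T)
   + 8 * (D*(J\<^sup>2 - P\<^sup>2) + F*(L\<^sup>2 - R\<^sup>2) + G*(N\<^sup>2 - T\<^sup>2)
          - D*F*G - 2*J*L*N - 2*P*L*T + 2*J*R*T + 2*P*R*N)"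

definition form_kernel :: "form \<Rightarrow> V set" where
  "form_kernel \<phi> = {v. contract v \<phi> = 0}"

definition lagrangian_subspace :: "('a::real_vector \<Rightarrow> 'a \<Rightarrow> real) \<Rightarrow> 'a set \<Rightarrow> bool" where
  "lagrangian_subspace w L \<longleftrightarrow> subspace L \<and> L = {v. \<forall>u\<in>L. w u v = 0}"


section \<open>Smooth manifolds, fibre bundles and foliations\<close>

text \<open>\<open>C_on k S f\<close> is meant for open \<open>S\<close>.\<close>

primrec C_on :: "nat \<Rightarrow> 'a::euclidean_space set \<Rightarrow> ('a \<Rightarrow> 'b::euclidean_space) \<Rightarrow> bool" where
  "C_on 0 S f \<longleftrightarrow> continuous_on S f"
| "C_on (Suc k) S f \<longleftrightarrow>
     f differentiable_on S \<and> (\<forall>v. C_on k S (\<lambda>x. frechet_derivative f (at x) v))"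

definition smooth_on :: "'a::euclidean_space set \<Rightarrow> ('a \<Rightarrow> 'b::euclidean_space) \<Rightarrow> bool" where
  "smooth_on S f \<longleftrightarrow> (\<forall>k. C_on k S f)"

text \<open>A chart \<open>(U, x)\<close> maps the open set \<open>U\<close> to the model space \<^typ>\<open>'e\<close>.\<close>

type_synonym ('p, 'e) chart = "'p set \<times> ('p \<Rightarrow> 'e)"

record ('p, 'e) mfld =
  mtop :: "'p topology"
  atlas :: "('p, 'e) chart set"

definition smooth_manifold :: "('p, 'e::euclidean_space) mfld \<Rightarrow> bool" where
  "smooth_manifold M \<longleftrightarrow>
     Hausdorff_space (mtop M) \<and> second_countable (mtop M) \<and>
     (\<Union>(U, x)\<in>atlas M. U) = topspace (mtop M) \<and>
     (\<forall>(U, x)\<in>atlas M. openin (mtop M) U \<and> open (x ` U) \<and>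
        homeomorphic_map (subtopology (mtop M) U) (top_of_set (x ` U)) x) \<and>
     (\<forall>(U, x)\<in>atlas M. \<forall>(V, y)\<in>atlas M. smooth_on (x ` (U \<inter> V)) (y \<circ> inv_into U x))"

definition smooth_map ::
    "('p, 'e::euclidean_space) mfld \<Rightarrow> ('q, 'f::euclidean_space) mfld \<Rightarrow> ('p \<Rightarrow> 'q) \<Rightarrow> bool" where
  "smooth_map M N f \<longleftrightarrow> continuous_map (mtop M) (mtop N) f \<and>
     (\<forall>(U, x)\<in>atlas M. \<forall>(V, y)\<in>atlas N.
        smooth_on (x ` (U \<inter> f -` V)) (y \<circ> f \<circ> inv_into U x))"

definition diffeomorphism ::
    "('p, 'e::euclidean_space) mfld \<Rightarrow> ('q, 'f::euclidean_space) mfld \<Rightarrow> ('p \<Rightarrow> 'q) \<Rightarrow> bool" where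
  "diffeomorphism M N f \<longleftrightarrow>
     (\<exists>g. homeomorphic_maps (mtop M) (mtop N) f g \<and> smooth_map M N f \<and> smooth_map N M g)"

definition open_part :: "('p, 'e) mfld \<Rightarrow> 'p set \<Rightarrow> ('p, 'e) mfld" where
  "open_part M W = \<lparr>mtop = subtopology (mtop M) W, atlas = (\<lambda>(U, x). (U \<inter> W, x)) ` atlas M\<rparr>"

definition prod_mfld :: "('p, 'e) mfld \<Rightarrow> ('q, 'f) mfld \<Rightarrow> ('p \<times> 'q, 'e \<times> 'f) mfld" where
  "prod_mfld M N = \<lparr>mtop = prod_topology (mtop M) (mtop N),
     atlas = {(U \<times> V, map_prod x y) | U x V y. (U, x) \<in> atlas M \<and> (V, y) \<in> atlas N}\<rparr>"

definition euclidean_mfld :: "'e::euclidean_space set \<Rightarrow> ('e, 'e) mfld" where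
  "euclidean_mfld S = \<lparr>mtop = top_of_set S, atlas = {(S, id)}\<rparr>"

text \<open>
  Smooth locally trivial fibre bundles.  The points of the typical fibre \<open>F\<close> have the same type
  as those of the total space, which is no restriction since \<open>F\<close> is diffeomorphic to the fibres.
\<close>

definition fibre_bundle ::
    "('p, 'e::euclidean_space) mfld \<Rightarrow> ('q, 'f::euclidean_space) mfld \<Rightarrow>
     ('p, 'g::euclidean_space) mfld \<Rightarrow> ('p \<Rightarrow> 'q) \<Rightarrow> bool" where
  "fibre_bundle M B F \<pi> \<longleftrightarrow>
     smooth_manifold M \<and> smooth_manifold B \<and> smooth_manifold F \<and>
     smooth_map M B \<pi> \<and> \<pi> ` topspace (mtop M) = topspace (mtop B) \<and>
     (\<forall>b\<in>topspace (mtop B). \<exists>W h. openin (mtop B) W \<and> b \<in> W \<and>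
        diffeomorphism (open_part M {p \<in> topspace (mtop M). \<pi> p \<in> W})
          (prod_mfld (open_part B W) F) h \<and>
        (\<forall>p\<in>topspace (mtop M). \<pi> p \<in> W \<longrightarrow> fst (h p) = \<pi> p))"

text \<open>
  2-forms and tangent distributions on a manifold are given by their coordinate expressions:
  \<open>w (U, x) p\<close> is the bilinear form, and \<open>D (U, x) p\<close> the subspace, of the model space that
  represents the object at \<open>p\<close> in the chart \<open>(U, x)\<close>.
\<close>

type_synonym ('p, 'e) two_form = "('p, 'e) chart \<Rightarrow> 'p \<Rightarrow> 'e \<Rightarrow> 'e \<Rightarrow> real"
type_synonym ('p, 'e) distrib = "('p, 'e) chart \<Rightarrow> 'p \<Rightarrow> 'e set"

definition lagrangian_distrib ::
    "('p, 'e::euclidean_space) mfld \<Rightarrow> ('p, 'e) two_form \<Rightarrow> ('p, 'e) distrib \<Rightarrow> bool" where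
  "lagrangian_distrib M w D \<longleftrightarrow>
     (\<forall>c\<in>atlas M. \<forall>p\<in>fst c. lagrangian_subspace (w c p) (D c p))"

text \<open>
  Foliated charts: \<open>(U, y)\<close> is a smooth chart with convex image in which the connected components
  of the intersections with the leaves (the plaques) are the slices by the translates of a fixed
  \<open>k\<close>-dimensional subspace \<open>P\<close>.
\<close>

definition foliated_chart ::
    "nat \<Rightarrow> ('p, 'e::euclidean_space) mfld \<Rightarrow> 'p set set \<Rightarrow> 'p set \<Rightarrow> ('p \<Rightarrow> 'e) \<Rightarrow> 'e set \<Rightarrow> bool"
where
  "foliated_chart k M \<L> U y P \<longleftrightarrow>
     openin (mtop M) U \<and> open (y ` U) \<and> convex (y ` U) \<and>
     diffeomorphism (open_part M U) (euclidean_mfld (y ` U)) y \<and>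
     subspace P \<and> dim P = k \<and>
     (\<forall>L\<in>\<L>. \<forall>C\<in>connected_components_of (subtopology (mtop M) (U \<inter> L)).
        \<exists>a. C = {q \<in> U. y q - a \<in> P})"

text \<open>
  \<open>\<L>\<close> is the set of leaves of a smooth \<open>k\<close>-dimensional foliation whose tangent distribution is
  \<open>D\<close>.
\<close>

definition foliation ::
    "nat \<Rightarrow> ('p, 'e::euclidean_space) mfld \<Rightarrow> 'p set set \<Rightarrow> ('p, 'e) distrib \<Rightarrow> bool" where
  "foliation k M \<L> D \<longleftrightarrow>
     smooth_manifold M \<and> partition_on (topspace (mtop M)) \<L> \<and>
     (\<forall>L\<in>\<L>. connectedin (mtop M) L) \<and>
     (\<forall>p\<in>topspace (mtop M). \<exists>U y P. p \<in> U \<and> foliated_chart k M \<L> U y P \<and>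
        (\<forall>(V, x)\<in>atlas M. \<forall>q\<in>U \<inter> V.
           D (V, x) q = {v. frechet_derivative (y \<circ> inv_into V x) (at (x q)) v \<in> P}))"

definition lagrangian_foliation ::
    "('p, 'e::euclidean_space) mfld \<Rightarrow> ('p, 'e) two_form \<Rightarrow> 'p set set \<Rightarrow> ('p, 'e) distrib \<Rightarrow> bool"
where
  "lagrangian_foliation M w \<L> D \<longleftrightarrow>
     foliation (DIM('e) div 2) M \<L> D \<and> lagrangian_distrib M w D"

definition lagrangian_fibration ::
    "('p, 'e::euclidean_space) mfld \<Rightarrow> ('p, 'e) two_form \<Rightarrow> ('q, 'f::euclidean_space) mfld \<Rightarrow>
     ('p, 'g::euclidean_space) mfld \<Rightarrow> ('p \<Rightarrow> 'q) \<Rightarrow> bool" where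
  "lagrangian_fibration M w B F \<pi> \<longleftrightarrow> fibre_bundle M B F \<pi> \<and>
     (\<forall>(U, x)\<in>atlas M. \<forall>(V, y)\<in>atlas B. \<forall>p\<in>U. \<pi> p \<in> V \<longrightarrow>
        lagrangian_subspace (w (U, x) p)
          {v. frechet_derivative (y \<circ> \<pi> \<circ> inv_into U x) (at (x p)) v = 0})"


section \<open>The simply connected Lie group and its nilmanifolds\<close>

text \<open>
  The simply connected Lie group, in exponential coordinates: as the Lie algebra is 2-step
  nilpotent, the Baker--Campbell--Hausdorff series is \<open>x + y + [x,y]/2\<close>.
\<close>

definition G :: "V monoid" where
  "G = \<lparr>carrier = UNIV, mult = (\<lambda>x y. x + y + (1/2) *\<^sub>R lie_bracket x y), one = 0\<rparr>"

text \<open>The left-invariant form on \<open>G\<close> defined by \<open>\<alpha>\<close>, at the point \<open>x\<close>.\<close>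

definition left_form :: "form \<Rightarrow> V \<Rightarrow> form" where
  "left_form \<alpha> x = (\<lambda>vs. \<alpha> (map (frechet_derivative (\<lambda>y. inv\<^bsub>G\<^esub> x \<otimes>\<^bsub>G\<^esub> y) (at x)) vs))"

definition left_field :: "V \<Rightarrow> V \<Rightarrow> V" where
  "left_field u x = frechet_derivative (\<lambda>y. x \<otimes>\<^bsub>G\<^esub> y) (at \<one>\<^bsub>G\<^esub>) u"

text \<open>The quotient of \<open>G\<close> by the left action of \<open>\<Gamma>\<close>; its points are the right cosets.\<close>

definition nil_topology :: "V set \<Rightarrow> V set topology" where
  "nil_topology \<Gamma> =
     topology (\<lambda>W. W \<subseteq> rcosets\<^bsub>G\<^esub> \<Gamma> \<and> open {x. \<Gamma> #>\<^bsub>G\<^esub> x \<in> W})"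

text \<open>The charts are the local inverses of the projection from \<open>G\<close>.\<close>

definition nilmanifold :: "V set \<Rightarrow> (V set, V) mfld" where
  "nilmanifold \<Gamma> = \<lparr>mtop = nil_topology \<Gamma>,
     atlas = {((\<lambda>x. \<Gamma> #>\<^bsub>G\<^esub> x) ` U, inv_into U (\<lambda>x. \<Gamma> #>\<^bsub>G\<^esub> x)) | U.
               open U \<and> inj_on (\<lambda>x. \<Gamma> #>\<^bsub>G\<^esub> x) U}\<rparr>"

definition cocompact_discrete_subgroup :: "V set \<Rightarrow> bool" where
  "cocompact_discrete_subgroup \<Gamma> \<longleftrightarrow>
     subgroup \<Gamma> G \<and> discrete \<Gamma> \<and> compact_space (nil_topology \<Gamma>)"

text \<open>
  Since the charts take values in \<open>G\<close> and differ by left translations, left-invariant objects on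
  \<open>G\<close> are themselves the coordinate expressions of the objects they induce on the quotient.
\<close>

definition induced_two_form :: "form \<Rightarrow> (V set, V) two_form" where
  "induced_two_form \<alpha> = (\<lambda>(U, x) p u v. left_form \<alpha> (x p) [u, v])"

definition induced_distrib :: "V set \<Rightarrow> (V set, V) distrib" where
  "induced_distrib L = (\<lambda>(U, x) p. (\<lambda>u. left_field u (x p)) ` L)"


section \<open>Consistency of the definitions\<close>

lemma bounded_linear_lie_bracket: "bounded_linear (lie_bracket x)"
  using lie_bracket_bilinear by (simp add: bilinear_def linear_conv_bounded_linear)

lemma group_G: "group G"
proof (rule groupI)
  fix x y z
  assume "x \<in> carrier G" "y \<in> carrier G" "z \<in> carrier G"
  show "x \<otimes>\<^bsub>G\<^esub> y \<otimes>\<^bsub>G\<^esub> z = x \<otimes>\<^bsub>G\<^esub> (y \<otimes>\<^bsub>G\<^esub> z)"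
    by (simp add: G_def vec_eq_iff forall_6 lie_bracket_nth field_simps)
next
  fix x :: V
  have "(- x) \<otimes>\<^bsub>G\<^esub> x = \<one>\<^bsub>G\<^esub>"
    by (simp add: G_def vec_eq_iff forall_6 lie_bracket_nth)
  then show "\<exists>y\<in>carrier G. y \<otimes>\<^bsub>G\<^esub> x = \<one>\<^bsub>G\<^esub>"
    by (intro bexI[of _ "- x"]) (auto simp: G_def)
qed (auto simp: G_def lie_bracket_def)

lemma inv_G: "inv\<^bsub>G\<^esub> x = - x"
proof (rule group.inv_equality[OF group_G])
  show "(- x) \<otimes>\<^bsub>G\<^esub> x = \<one>\<^bsub>G\<^esub>"
    by (simp add: G_def vec_eq_iff forall_6 lie_bracket_nth)
qed (auto simp: G_def)

lemma translation_derivative: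
  "frechet_derivative (\<lambda>y. x \<otimes>\<^bsub>G\<^esub> y) (at z) = (\<lambda>u. u + (1/2) *\<^sub>R lie_bracket x u)"
proof -
  have "((\<lambda>y. x \<otimes>\<^bsub>G\<^esub> y) has_derivative (\<lambda>u. u + (1/2) *\<^sub>R lie_bracket x u)) (at z)"
    unfolding G_def
    by (auto intro!: derivative_eq_intros
        bounded_linear.has_derivative[OF bounded_linear_lie_bracket])
  then show ?thesis
    by (metis frechet_derivative_at)
qed

text \<open>\<open>G\<close> has the given Lie algebra: the bracket of left-invariant vector fields is \<^const>\<open>lie_bracket\<close>.\<close>

lemma left_field_eq: "left_field u x = u + (1/2) *\<^sub>R lie_bracket x u"
  by (simp add: left_field_def translation_derivative)

lemma left_field_bracket:
  "frechet_derivative (left_field v) (at x) (left_field u x)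
   - frechet_derivative (left_field u) (at x) (left_field v x)
   = left_field (lie_bracket u v) x"
proof -
  have bl: "bounded_linear (\<lambda>x. lie_bracket x w)" for w
    using lie_bracket_bilinear by (simp add: bilinear_def linear_conv_bounded_linear)
  have "(left_field w has_derivative (\<lambda>h. (1/2) *\<^sub>R lie_bracket h w)) (at x)" for w
    unfolding left_field_eq[abs_def]
    by (auto intro!: derivative_eq_intros bounded_linear.has_derivative[OF bl])
  then have "frechet_derivative (left_field w) (at x) = (\<lambda>h. (1/2) *\<^sub>R lie_bracket h w)" for w
    by (metis frechet_derivative_at)
  then show ?thesis
    by (simp add: left_field_eq vec_eq_iff forall_6 lie_bracket_nth algebra_simps)
qed

lemma left_form_invariant:
  "left_form \<alpha> (g \<otimes>\<^bsub>G\<^esub> x) (map (frechet_derivative (\<lambda>y. g \<otimes>\<^bsub>G\<^esub> y) (at x)) vs)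
   = left_form \<alpha> x vs"
proof -
  have "lie_bracket (- (g \<otimes>\<^bsub>G\<^esub> x)) (u + (1/2) *\<^sub>R lie_bracket g u) + lie_bracket g u
        = lie_bracket (- x) u" for u
    by (simp add: G_def vec_eq_iff forall_6 lie_bracket_nth algebra_simps)
  then have eq: "u + (1/2) *\<^sub>R lie_bracket g u
      + (1/2) *\<^sub>R lie_bracket (- (g \<otimes>\<^bsub>G\<^esub> x)) (u + (1/2) *\<^sub>R lie_bracket g u)
      = u + (1/2) *\<^sub>R lie_bracket (- x) u" for u
    by (metis (no_types, lifting) add.assoc add.commute scaleR_right_distrib)
  show ?thesis
    unfolding left_form_def inv_G translation_derivative map_map comp_def
    by (simp only: eq)
qed

lemma istopology_nil:
  "istopology (\<lambda>W. W \<subseteq> rcosets\<^bsub>G\<^esub> \<Gamma> \<and> open {x. \<Gamma> #>\<^bsub>G\<^esub> x \<in> W})"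
proof -
  have "{x. \<Gamma> #>\<^bsub>G\<^esub> x \<in> \<Union>K} = (\<Union>W\<in>K. {x. \<Gamma> #>\<^bsub>G\<^esub> x \<in> W})" for K :: "V set set set"
    by auto
  then show ?thesis
    by (auto simp: istopology_def open_Int Collect_conj_eq)
qed

text \<open>Contraction is an antiderivation of the wedge product; this also computes \<^const>\<open>wedge\<close>.\<close>

lemma wedge_Nil: "(\<alpha> \<and>\<^sub>f \<beta>) [] = \<alpha> [] * \<beta> []"
  by (simp add: wedge_def)

lemma nths_Cons_Suc: "nths (v # vs) (Suc ` I) = nths vs I"
  by (simp add: nths_Cons inj_image_mem_iff)

lemma nths_Cons_0_Suc: "nths (v # vs) (insert 0 (Suc ` I)) = v # nths vs I"
  by (simp add: nths_Cons inj_image_mem_iff)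

lemma wedge_Cons:
  assumes "\<And>vs. length vs \<noteq> k \<Longrightarrow> \<alpha> vs = 0"
  shows "(\<alpha> \<and>\<^sub>f \<beta>) (v # vs)
    = (contract v \<alpha> \<and>\<^sub>f \<beta>) vs + (-1) ^ k * (\<alpha> \<and>\<^sub>f contract v \<beta>) vs"
proof -
  let ?n = "length vs"
  let ?P = "Pow {..<?n}"
  define invs where "invs n I = {(i, j). i \<in> I \<and> j \<in> {..<n} - I \<and> j < i}" for n :: nat and I
  define s where "s xs I = (-1) ^ card (invs (length xs) I) * \<alpha> (nths xs I) * \<beta> (nths xs (- I))"
    for xs I
  have fin: "finite (invs n I)" if "finite I" for n I
    by (rule finite_subset[of _ "I \<times> {..<n}"]) (auto simp: invs_def that)
  have P: "Pow {..<length (v # vs)}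
      = (\<lambda>I. insert 0 (Suc ` I)) ` ?P \<union> (\<lambda>I. Suc ` I) ` ?P"
    (is "?L = ?R")
  proof
    show "?L \<subseteq> ?R"
    proof
      fix I assume I: "I \<in> ?L"
      define I' where "I' = {i. Suc i \<in> I}"
      have I': "I' \<in> ?P" using I by (auto simp: I'_def)
      have "m \<in> I \<longleftrightarrow> m \<in> (if 0 \<in> I then insert 0 (Suc ` I') else Suc ` I')" for m
        by (cases m) (auto simp: I'_def)
      then have "I = (if 0 \<in> I then insert 0 (Suc ` I') else Suc ` I')" by blast
      then have "I = insert 0 (Suc ` I') \<or> I = Suc ` I'" by presburger
      then show "I \<in> ?R" using I' by blast
    qed
    show "?R \<subseteq> ?L" by auto
  qed
  have inj1: "inj_on (\<lambda>I. insert 0 (Suc ` I)) ?P"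
  proof (rule inj_onI)
    fix I I' assume *: "insert 0 (Suc ` I) = insert 0 (Suc ` I')"
    have "Suc m \<in> insert 0 (Suc ` I) \<longleftrightarrow> m \<in> I" for m I by auto
    then show "I = I'" using * by (metis subsetI subset_antisym)
  qed
  have inj2: "inj_on (\<lambda>I. Suc ` I) ?P"
    by (rule inj_onI) (simp add: inj_image_eq_iff)
  have mem: "m \<in> insert 0 (Suc ` I) \<longleftrightarrow> (case m of 0 \<Rightarrow> True | Suc m \<Rightarrow> m \<in> I)"
    "m \<in> Suc ` I \<longleftrightarrow> (case m of 0 \<Rightarrow> False | Suc m \<Rightarrow> m \<in> I)" for m I
    by (cases m; auto)+
  have c1: "- insert 0 (Suc ` I) = Suc ` (- I)" for I
    unfolding set_eq_iff Compl_iff mem by (simp split: nat.split)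
  have c2: "- (Suc ` I) = insert 0 (Suc ` (- I))" for I
    unfolding set_eq_iff Compl_iff mem by (simp split: nat.split)
  have cardS: "card (map_prod Suc Suc ` X) = card X" for X
    by (rule card_image) (auto simp: inj_on_def)
  have s1: "s (v # vs) (insert 0 (Suc ` I))
      = (-1) ^ card (invs ?n I) * contract v \<alpha> (nths vs I) * \<beta> (nths vs (- I))"
    if "I \<in> ?P" for I
  proof -
    have "invs (Suc ?n) (insert 0 (Suc ` I)) = map_prod Suc Suc ` invs ?n I"
    proof (rule Set.set_eqI, clarify)
      fix i j
      show "(i, j) \<in> invs (Suc ?n) (insert 0 (Suc ` I)) \<longleftrightarrow> (i, j) \<in> map_prod Suc Suc ` invs ?n I"
        by (cases i; cases j) (auto simp: invs_def image_iff)
    qed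
    then have "card (invs (Suc ?n) (insert 0 (Suc ` I))) = card (invs ?n I)"
      by (simp add: cardS)
    then show ?thesis
      by (simp add: s_def c1 nths_Cons_Suc nths_Cons_0_Suc contract_def)
  qed
  have s2: "s (v # vs) (Suc ` I)
      = (-1) ^ k * ((-1) ^ card (invs ?n I) * \<alpha> (nths vs I) * contract v \<beta> (nths vs (- I)))"
    if "I \<in> ?P" for I
  proof (cases "length (nths vs I) = k")
    case True
    have fI: "finite I" using that by (auto intro: finite_subset)
    have "{i. i < ?n \<and> i \<in> I} = I" using that by auto
    then have k: "card I = k" using True by (simp add: length_nths)
    have "invs (Suc ?n) (Suc ` I) = map_prod Suc Suc ` invs ?n I \<union> (\<lambda>i. (Suc i, 0)) ` I"
    proof (rule Set.set_eqI, clarify)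
      fix i j
      show "(i, j) \<in> invs (Suc ?n) (Suc ` I)
        \<longleftrightarrow> (i, j) \<in> map_prod Suc Suc ` invs ?n I \<union> (\<lambda>i. (Suc i, 0)) ` I"
        by (cases i; cases j) (auto simp: invs_def image_iff)
    qed
    moreover have "card (map_prod Suc Suc ` invs ?n I \<union> (\<lambda>i. (Suc i, 0)) ` I)
        = card (map_prod Suc Suc ` invs ?n I) + card ((\<lambda>i. (Suc i, 0::nat)) ` I)"
      by (rule card_Un_disjoint) (auto simp: fI fin)
    ultimately have "card (invs (Suc ?n) (Suc ` I)) = card (invs ?n I) + k"
      by (simp add: cardS card_image inj_on_def k)
    then show ?thesis
      by (simp add: s_def c2 nths_Cons_Suc nths_Cons_0_Suc contract_def power_add)
  next
    case False
    then show ?thesis by (simp add: s_def nths_Cons_Suc assms)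
  qed
  have "(\<alpha> \<and>\<^sub>f \<beta>) (v # vs) = (\<Sum>I\<in>Pow {..<length (v # vs)}. s (v # vs) I)"
    by (simp add: wedge_def s_def invs_def)
  also have "\<dots> = (\<Sum>I\<in>(\<lambda>I. insert 0 (Suc ` I)) ` ?P. s (v # vs) I)
      + (\<Sum>I\<in>(\<lambda>I. Suc ` I) ` ?P. s (v # vs) I)"
    unfolding P by (rule sum.union_disjoint) auto
  also have "\<dots> = (contract v \<alpha> \<and>\<^sub>f \<beta>) vs + (-1) ^ k * (\<alpha> \<and>\<^sub>f contract v \<beta>) vs"
    by (simp only: sum.reindex[OF inj1] sum.reindex[OF inj2] comp_def)
      (simp add: s1 s2 wedge_def invs_def sum_distrib_left)
  finally show ?thesis .
qed

lemma coframe_simps: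
  "coframe i [] = 0" "coframe i [v] = v $ i" "coframe i (v # w # vs) = 0"
  by (simp_all add: coframe_def)

lemma coframe_degree: "length vs \<noteq> 1 \<Longrightarrow> coframe i vs = 0"
  by (auto simp: coframe_def split: list.split)

lemma wedge_coframe_left:
  "(coframe i \<and>\<^sub>f \<beta>) [] = 0"
  "(coframe i \<and>\<^sub>f \<beta>) (v # vs) = v $ i * \<beta> vs - (coframe i \<and>\<^sub>f contract v \<beta>) vs"
proof -
  have c: "contract v (coframe i) us = (if us = [] then v $ i else 0)" for us
    by (cases us) (simp_all add: contract_def coframe_simps)
  have "(contract v (coframe i) \<and>\<^sub>f \<beta>) vs = (\<Sum>I\<in>Pow {..<length vs}.
      if I = {} then v $ i * \<beta> vs else 0)"
    unfolding wedge_def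
  proof (rule sum.cong[OF refl])
    fix I assume "I \<in> Pow {..<length vs}"
    then have "nths vs I = [] \<longleftrightarrow> I = {}"
      by (auto simp flip: length_0_conv simp: length_nths subset_iff)
    then show "(-1) ^ card {(i, j). i \<in> I \<and> j \<in> {..<length vs} - I \<and> j < i}
        * contract v (coframe i) (nths vs I) * \<beta> (nths vs (- I))
        = (if I = {} then v $ i * \<beta> vs else 0)"
      by (auto simp: c nths_all)
  qed
  then show "(coframe i \<and>\<^sub>f \<beta>) (v # vs) = v $ i * \<beta> vs - (coframe i \<and>\<^sub>f contract v \<beta>) vs"
    using wedge_Cons[of 1 "coframe i" \<beta> v vs] by (simp add: coframe_degree)
qed (simp add: wedge_Nil coframe_simps)

lemma e2_apply: "e2 i j [u, v] = u $ i * v $ j - u $ j * v $ i"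
  by (simp add: wedge_coframe_left contract_def coframe_simps)

lemma wedge_degree:
  assumes "\<And>vs. length vs \<noteq> k \<Longrightarrow> \<alpha> vs = 0" "\<And>vs. length vs \<noteq> l \<Longrightarrow> \<beta> vs = 0"
    and "length vs \<noteq> k + l"
  shows "(\<alpha> \<and>\<^sub>f \<beta>) vs = 0"
  unfolding wedge_def
proof (rule sum.neutral, rule ballI)
  fix I assume "I \<in> Pow {..<length vs}"
  have "length (nths vs I) + length (nths vs (- I))
      = card ({i. i < length vs \<and> i \<in> I} \<union> {i. i < length vs \<and> i \<in> - I})"
    unfolding length_nths by (rule card_Un_disjoint[symmetric]) auto
  also have "{i. i < length vs \<and> i \<in> I} \<union> {i. i < length vs \<and> i \<in> - I} = {..<length vs}"
    by auto
  finally have "length (nths vs I) \<noteq> k \<or> length (nths vs (- I)) \<noteq> l"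
    using assms(3) by auto
  then show "(-1) ^ card {(i, j). i \<in> I \<and> j \<in> {..<length vs} - I \<and> j < i}
      * \<alpha> (nths vs I) * \<beta> (nths vs (- I)) = 0"
    using assms(1,2) by auto
qed

lemma e2_degree: "length vs \<noteq> 2 \<Longrightarrow> e2 i j vs = 0"
  by (rule wedge_degree[of 1 _ 1]) (simp_all add: coframe_degree)

lemma list_cases_2:
  fixes vs :: "'a list"
  obtains "length vs \<noteq> 2" | u v where "vs = [u, v]"
  by (cases vs; cases "tl vs"; cases "tl (tl vs)") auto

lemma ce_d_degree:
  assumes "\<And>vs. length vs \<noteq> k \<Longrightarrow> \<alpha> vs = 0" and "length vs \<noteq> Suc k"
  shows "ce_d \<alpha> vs = 0"
  unfolding ce_d_def
proof (intro sum.neutral ballI)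
  fix j i assume ij: "j \<in> {..<length vs}" "i \<in> {..<j}"
  have "{m. m < length vs \<and> m \<in> - {i, j}} = {..<length vs} - {i, j}" by auto
  moreover have "card ({..<length vs} - {i, j}) = length vs - 2"
    using ij by (subst card_Diff_subset) auto
  ultimately have "length (nths vs (- {i, j})) = length vs - 2"
    by (simp add: length_nths)
  then have "length (lie_bracket (vs ! i) (vs ! j) # nths vs (- {i, j})) \<noteq> k"
    using ij assms(2) by simp
  then show "(-1) ^ (i + j) * \<alpha> (lie_bracket (vs ! i) (vs ! j) # nths vs (- {i, j})) = 0"
    by (simp add: assms(1))
qed

lemma ce_d_1: "ce_d \<alpha> [u, v] = - \<alpha> [lie_bracket u v]"
  by (simp add: ce_d_def lessThan_Suc nths_Cons)

lemma ce_d_2: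
  "ce_d \<alpha> [u, v, w]
   = - \<alpha> [lie_bracket u v, w] + \<alpha> [lie_bracket u w, v] - \<alpha> [lie_bracket v w, u]"
  by (simp add: ce_d_def lessThan_Suc nths_Cons numeral_2_eq_2)

lemma ce_d_coframe:
  "ce_d (coframe 1) = 0" "ce_d (coframe 2) = 0" "ce_d (coframe 3) = 0"
  "ce_d (coframe 4) = e2 1 5" "ce_d (coframe 5) = 0" "ce_d (coframe 6) = e2 1 3"
proof -
  have d: "ce_d (coframe i) vs = 0" if "length vs \<noteq> 2" for i vs
    by (rule ce_d_degree[of 1]) (use that in \<open>auto simp: coframe_degree\<close>)
  have *: "ce_d (coframe i) = \<beta>"
    if "\<And>u v. - (lie_bracket u v $ i) = \<beta> [u, v]" "\<And>vs. length vs \<noteq> 2 \<Longrightarrow> \<beta> vs = 0" for i \<beta>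
  proof
    fix vs show "ce_d (coframe i) vs = \<beta> vs"
      by (cases vs rule: list_cases_2) (simp_all add: d that ce_d_1 coframe_simps)
  qed
  show "ce_d (coframe 1) = 0" "ce_d (coframe 2) = 0" "ce_d (coframe 3) = 0"
    "ce_d (coframe 4) = e2 1 5" "ce_d (coframe 5) = 0" "ce_d (coframe 6) = e2 1 3"
    by (rule *; simp add: lie_bracket_nth e2_apply e2_degree)+
qed

lemma omega_apply:
  "omega [u, v] = u$1 * v$2 - u$2 * v$1 + u$3 * v$4 - u$4 * v$3 + u$5 * v$6 - u$6 * v$5"
  by (simp add: omega_def e2_apply)

lemma omega_closed: "ce_d omega = 0"
proof
  fix vs
  have "ce_d omega vs = 0" if "length vs \<noteq> 3"
    by (rule ce_d_degree[of 2]) (use that in \<open>auto simp: omega_def e2_degree\<close>)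
  moreover have "ce_d omega [u, v, w] = 0" for u v w
    by (simp add: ce_d_2 omega_apply lie_bracket_nth algebra_simps)
  ultimately show "ce_d omega vs = 0 vs"
    by (cases vs; cases "tl vs"; cases "tl (tl vs)"; cases "tl (tl (tl vs))") auto
qed

lemma omega_nondegenerate: "(\<forall>v. omega [u, v] = 0) \<longleftrightarrow> u = 0"
proof
  assume *: "\<forall>v. omega [u, v] = 0"
  show "u = 0"
    using *[rule_format, of "axis 1 1"] *[rule_format, of "axis 2 1"]
      *[rule_format, of "axis 3 1"] *[rule_format, of "axis 4 1"]
      *[rule_format, of "axis 5 1"] *[rule_format, of "axis 6 1"]
    by (simp add: omega_apply axis_def vec_eq_iff forall_6)
qed (simp add: omega_apply)

lemma Lefschetz_apply:
  "Lefschetz \<alpha> vs = (1/2) *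
     (\<alpha> (axis 1 1 # axis 2 1 # vs) - \<alpha> (axis 2 1 # axis 1 1 # vs)
    + \<alpha> (axis 3 1 # axis 4 1 # vs) - \<alpha> (axis 4 1 # axis 3 1 # vs)
    + \<alpha> (axis 5 1 # axis 6 1 # vs) - \<alpha> (axis 6 1 # axis 5 1 # vs))"
  unfolding Lefschetz_def sum_6 by (simp add: omega_apply axis_def)

lemma e2_wedge:
  "(e2 i j \<and>\<^sub>f \<beta>) [] = 0"
  "(e2 i j \<and>\<^sub>f \<beta>) (u # vs) = u $ i * (coframe j \<and>\<^sub>f \<beta>) vs - u $ j * (coframe i \<and>\<^sub>f \<beta>) vs
     + (e2 i j \<and>\<^sub>f contract u \<beta>) vs"
proof -
  define \<gamma> where "\<gamma> = contract u (e2 i j)"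
  have "\<gamma> us = u $ i * coframe j us - u $ j * coframe i us" for us
    unfolding \<gamma>_def by (cases us; cases "tl us") (simp_all add: contract_def e2_apply e2_degree coframe_simps)
  then have "(\<gamma> \<and>\<^sub>f \<beta>) vs
      = u $ i * (coframe j \<and>\<^sub>f \<beta>) vs - u $ j * (coframe i \<and>\<^sub>f \<beta>) vs"
    by (simp add: wedge_def left_diff_distrib right_diff_distrib sum_subtractf sum_distrib_left
        mult_ac)
  then show "(e2 i j \<and>\<^sub>f \<beta>) (u # vs) = u $ i * (coframe j \<and>\<^sub>f \<beta>) vs
      - u $ j * (coframe i \<and>\<^sub>f \<beta>) vs + (e2 i j \<and>\<^sub>f contract u \<beta>) vs"
    using wedge_Cons[of 2 "e2 i j" \<beta> u vs] by (simp add: e2_degree \<gamma>_def)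
qed (simp add: wedge_Nil coframe_simps)

lemma Lefschetz_examples:
  "Lefschetz (e2 1 2 \<and>\<^sub>f e2 5 6) = e2 1 2 + e2 5 6"
  "Lefschetz (e2 1 2 \<and>\<^sub>f e2 3 5) = e2 3 5"
proof -
  have *: "Lefschetz (e2 i j \<and>\<^sub>f e2 k l) = \<beta>"
    if "\<And>u v. Lefschetz (e2 i j \<and>\<^sub>f e2 k l) [u, v] = \<beta> [u, v]"
      "\<And>vs. length vs \<noteq> 2 \<Longrightarrow> \<beta> vs = 0" for i j k l \<beta>
  proof
    fix vs
    have "Lefschetz (e2 i j \<and>\<^sub>f e2 k l) vs = 0" if "length vs \<noteq> 2"
    proof -
      have "(e2 i j \<and>\<^sub>f e2 k l) (u # v # vs) = 0" for u v
        by (rule wedge_degree[of 2 _ 2]) (use that in \<open>auto simp: e2_degree\<close>)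
      then show ?thesis by (simp add: Lefschetz_apply)
    qed
    then show "Lefschetz (e2 i j \<and>\<^sub>f e2 k l) vs = \<beta> vs"
      by (cases vs rule: list_cases_2) (simp_all add: that)
  qed
  show "Lefschetz (e2 1 2 \<and>\<^sub>f e2 5 6) = e2 1 2 + e2 5 6"
    by (rule *) (simp_all add: e2_degree Lefschetz_apply e2_wedge wedge_coframe_left contract_def
        coframe_simps axis_def algebra_simps)
  show "Lefschetz (e2 1 2 \<and>\<^sub>f e2 3 5) = e2 3 5"
    by (rule *) (simp_all add: e2_degree Lefschetz_apply e2_wedge wedge_coframe_left contract_def
        coframe_simps axis_def algebra_simps)
qed

end

theory Submission
  imports Defs
begin

text \<open>
  In \<open>d\<Lambda>d\<F>(\<phi>)\<close> only the values of \<open>\<F>(\<phi>)\<close> on the central vectors \<open>e\<^sub>2, e\<^sub>4, e\<^sub>6\<close> survive, so the right-hand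
  side is a multiple of \<open>e\<^sup>1\<^sup>3\<^sup>5\<close> and the flow is a scalar linear equation for \<open>A\<close>.

  The kernel of \<open>e\<^sup>1\<^sup>3\<^sup>5\<close> is the centre.  The projection of a cocompact discrete subgroup \<open>\<Gamma>\<close> to the
  coordinates \<open>x\<^sub>1, x\<^sub>3, x\<^sub>5\<close> spans, because the quotient is compact, and is discrete, because an element
  of \<open>\<Gamma>\<close> with small projection has small, hence trivial, commutators with finitely many elements of \<open>\<Gamma>\<close>
  whose projections span.  The projection therefore induces a fibre bundle over a torus.  Translations
  of the group are affine, so all maps involved are affine in suitable local coordinates, which makes
  their smoothness immediate.
\<close>

section \<open>Left-invariant 3-forms\<close>

text \<open>All brackets lie in Span(e_4, e_6), which is central. In d(Lambda d beta)(u, v, w) the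
  outer d puts a central vector [u,v] into Lambda d beta, and Lambda inserts the pairs e_1,e_2,
  e_3,e_4 and e_5,e_6, whose second members are central too. So the inner d leaves only terms
  beta([e_i,w], e_(i+1), [u,v]) with i = 1, 3, 5, and for beta = F(phi) these are all multiples of
  one number, F(phi)(e_4, e_2, e_6). It is affine in A with slope -2 H^2, and nothing but A moves
  under the flow, so a cubic equation in twenty unknowns is linear along each trajectory.

  On the geometric side, points of the quotients are cosets, and maps between them are defined by
  choosing representatives. Two choices differ by a lattice translation, which is constant only
  locally. Smoothness is therefore not tested chart by chart: each manifold is parametrised by an
  open subset of a Euclidean space, each map has local affine lifts to these parameter spaces, and
  the lifts give continuity and smoothness in all charts.\<close>

lemma plus_form: "(\<alpha> + \<beta>) vs = \<alpha> vs + \<beta> vs" for \<alpha> \<beta> :: form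
  by simp

lemma scale_form_apply: "(c *\<^sub>f \<alpha>) vs = c * \<alpha> vs"
  by (simp add: scale_form_def)

lemma wedge_add_left: "(\<alpha> + \<beta>) \<and>\<^sub>f \<gamma> = \<alpha> \<and>\<^sub>f \<gamma> + \<beta> \<and>\<^sub>f \<gamma>"
  by (rule ext) (simp add: wedge_def algebra_simps sum.distrib)

lemma wedge_add_right: "\<alpha> \<and>\<^sub>f (\<beta> + \<gamma>) = \<alpha> \<and>\<^sub>f \<beta> + \<alpha> \<and>\<^sub>f \<gamma>"
  by (rule ext) (simp add: wedge_def algebra_simps sum.distrib)

lemma wedge_diff_right: "\<alpha> \<and>\<^sub>f (\<beta> - \<gamma>) = \<alpha> \<and>\<^sub>f \<beta> - \<alpha> \<and>\<^sub>f \<gamma>"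
  by (rule ext) (simp add: wedge_def algebra_simps sum_subtractf)

lemma wedge_scale_left: "(c *\<^sub>f \<alpha>) \<and>\<^sub>f \<beta> = c *\<^sub>f (\<alpha> \<and>\<^sub>f \<beta>)"
  by (rule ext) (simp add: wedge_def scale_form_def sum_distrib_left mult_ac)

lemma e3_apply:
  "e3 i j k [u, v, w] = u$i * (v$j * w$k - v$k * w$j) - u$j * (v$i * w$k - v$k * w$i)
     + u$k * (v$i * w$j - v$j * w$i)"
  by (simp add: wedge_coframe_left contract_def coframe_simps algebra_simps)

lemma e3_degree: "length vs \<noteq> 3 \<Longrightarrow> e3 i j k vs = 0"
  by (rule wedge_degree[of 1 _ 2]) (simp_all add: coframe_degree e2_degree)

text \<open>The indices of each \<open>e3\<close> stand in the order in which distributivity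
  produces them (\<open>e3 3 1 2\<close>, not \<open>e3 1 2 3\<close>): a \<open>coframe\<close>
  wedged with an \<open>e2\<close> is already an \<open>e3\<close>, so graded commutativity does not
  enter.\<close>

lemma of_coeffs_e3:
  fixes A B C D E F G H I J K L M N O' P Q R S T :: real
  shows "of_coeffs (Coeffs A B C D E F G H I J K L M N O' P Q R S T) =
     A *\<^sub>f e3 1 3 5 + B *\<^sub>f e3 1 3 6 + C *\<^sub>f e3 1 4 5 + D *\<^sub>f e3 1 4 6
   + E *\<^sub>f e3 2 3 5 + F *\<^sub>f e3 2 3 6 + G *\<^sub>f e3 2 4 5 + H *\<^sub>f e3 2 4 6
   + (I + O') *\<^sub>f e3 1 3 4 + (O' - I) *\<^sub>f e3 1 5 6 + (J + P) *\<^sub>f e3 2 3 4 + (P - J) *\<^sub>f e3 2 5 6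
   + (K + Q) *\<^sub>f e3 3 1 2 + (Q - K) *\<^sub>f e3 3 5 6 + (L + R) *\<^sub>f e3 4 1 2 + (R - L) *\<^sub>f e3 4 5 6
   + (M + S) *\<^sub>f e3 5 1 2 + (S - M) *\<^sub>f e3 5 3 4 + (N + T) *\<^sub>f e3 6 1 2 + (T - N) *\<^sub>f e3 6 3 4"
  by (simp only: of_coeffs.simps wedge_add_left wedge_add_right wedge_diff_right wedge_scale_left)
    (rule ext, simp add: scale_form_apply algebra_simps)

lemma list_cases_3:
  fixes vs :: "'a list"
  obtains "length vs \<noteq> 3" | u v w where "vs = [u, v, w]"
  by (cases vs; cases "tl vs"; cases "tl (tl vs)"; cases "tl (tl (tl vs))") auto

lemma kforms_3I:
  assumes deg: "\<And>vs. length vs \<noteq> 3 \<Longrightarrow> \<alpha> vs = 0"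
    and lin: "\<And>v w. linear (\<lambda>u. \<alpha> [u, v, w])" "\<And>u w. linear (\<lambda>v. \<alpha> [u, v, w])"
      "\<And>u v. linear (\<lambda>w. \<alpha> [u, v, w])"
    and alt: "\<And>u v. \<alpha> [u, u, v] = 0" "\<And>u v. \<alpha> [u, v, u] = 0" "\<And>u v. \<alpha> [u, v, v] = 0"
  shows "\<alpha> \<in> kforms 3"
proof -
  have "linear (\<lambda>v. \<alpha> (xs @ v # ys))" if len: "length xs + 1 + length ys = 3" for xs ys
  proof -
    consider "xs = []" "length ys = 2" | a where "xs = [a]" "length ys = 1"
      | a b where "xs = [a, b]" "ys = []"
      using len by (cases xs; cases "tl xs"; cases "tl (tl xs)") auto
    then show ?thesis
      by cases (auto simp: lin length_Suc_conv numeral_2_eq_2)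
  qed
  moreover have "\<alpha> vs = 0" if "i < j" "j < length vs" "vs ! i = vs ! j" for vs i j
    by (cases vs rule: list_cases_3)
      (use that deg alt in \<open>auto simp: less_Suc_eq numeral_2_eq_2\<close>)
  ultimately show ?thesis
    unfolding kforms_def using deg by blast
qed

lemma kforms_3D:
  assumes "\<alpha> \<in> kforms 3"
  shows kforms_3_degree: "length vs \<noteq> 3 \<Longrightarrow> \<alpha> vs = 0"
    and kforms_3_linear: "linear (\<lambda>u. \<alpha> [u, v, w])" "linear (\<lambda>v. \<alpha> [u, v, w])"
      "linear (\<lambda>w. \<alpha> [u, v, w])"
    and kforms_3_alt: "\<alpha> [u, u, v] = 0" "\<alpha> [u, v, u] = 0" "\<alpha> [u, v, v] = 0"
proof -
  have lin: "linear (\<lambda>v. \<alpha> (xs @ v # ys))" if "length xs + 1 + length ys = 3" for xs ys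
    using assms that by (auto simp: kforms_def)
  show "linear (\<lambda>u. \<alpha> [u, v, w])" "linear (\<lambda>v. \<alpha> [u, v, w])" "linear (\<lambda>w. \<alpha> [u, v, w])"
    using lin[of "[]" "[v, w]"] lin[of "[u]" "[w]"] lin[of "[u, v]" "[]"] by simp_all
  have alt: "\<alpha> vs = 0" if "i < j" "j < length vs" "vs ! i = vs ! j" for vs i j
    using assms that unfolding kforms_def by blast
  show "\<alpha> [u, u, v] = 0" "\<alpha> [u, v, u] = 0" "\<alpha> [u, v, v] = 0"
    using alt[of 0 1 "[u, u, v]"] alt[of 0 2 "[u, v, u]"] alt[of 1 2 "[u, v, v]"] by simp_all
  show "length vs \<noteq> 3 \<Longrightarrow> \<alpha> vs = 0"
    using assms by (simp add: kforms_def)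
qed

text \<open>Polarisation: \<open>kforms\<close> states alternation as vanishing on repeated vectors,
  and expanding a repeated sum of two vectors turns this into a sign rule.\<close>

lemma kforms_3_swap:
  assumes "\<alpha> \<in> kforms 3"
  shows "\<alpha> [v, u, w] = - \<alpha> [u, v, w]" "\<alpha> [u, w, v] = - \<alpha> [u, v, w]"
proof -
  note add = kforms_3_linear[OF assms, THEN linear_add]
  have "\<alpha> [u + v, u + v, w] = 0" "\<alpha> [u, v + w, v + w] = 0"
    by (simp_all add: kforms_3_alt[OF assms])
  then show "\<alpha> [v, u, w] = - \<alpha> [u, v, w]" "\<alpha> [u, w, v] = - \<alpha> [u, v, w]"
    unfolding add by (simp_all add: kforms_3_alt[OF assms])
qed

lemma linear_times_left: "linear f \<Longrightarrow> linear (\<lambda>x. c * f x)" for f :: "'a::real_vector \<Rightarrow> real"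
  using linear_compose_scale_right[of f c] by simp

lemma kforms_3_add: "\<alpha> \<in> kforms 3 \<Longrightarrow> \<beta> \<in> kforms 3 \<Longrightarrow> \<alpha> + \<beta> \<in> kforms 3"
  and kforms_3_diff: "\<alpha> \<in> kforms 3 \<Longrightarrow> \<beta> \<in> kforms 3 \<Longrightarrow> \<alpha> - \<beta> \<in> kforms 3"
  and kforms_3_scale: "\<alpha> \<in> kforms 3 \<Longrightarrow> c *\<^sub>f \<alpha> \<in> kforms 3"
  by (rule kforms_3I; simp add: kforms_3D scale_form_apply linear_compose_add linear_compose_sub
      linear_times_left)+

lemma kforms_3_e3: "e3 i j k \<in> kforms 3"
  by (rule kforms_3I) (auto simp: e3_degree e3_apply algebra_simps intro!: linearI)

lemma of_coeffs_kforms: "of_coeffs c \<in> kforms 3"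
  by (cases c) (simp only: of_coeffs_e3, intro kforms_3_add kforms_3_scale kforms_3_e3)

section \<open>Coordinates: a 3-form is determined by its twenty values on basis triples\<close>

lemma linear_zero_on_axes:
  fixes f :: "real^'n \<Rightarrow> real"
  assumes "linear f" "\<And>i. f (axis i 1) = 0"
  shows "f v = 0"
proof -
  have "f v = f (\<Sum>i\<in>UNIV. v $ i *\<^sub>R axis i 1)"
    using basis_expansion[of v] by (simp add: scalar_mult_eq_scaleR)
  also have "\<dots> = 0"
    using assms by (simp add: linear_sum linear_cmul)
  finally show ?thesis .
qed

lemma kforms_3_zero:
  assumes k: "\<alpha> \<in> kforms 3"
    and z: "\<And>i j k. \<alpha> [axis i 1, axis j 1, axis k 1] = 0"
  shows "\<alpha> = 0"
proof
  fix vs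
  have 1: "\<alpha> [u, axis j 1, axis k 1] = 0" for u j k
    by (rule linear_zero_on_axes[OF kforms_3_linear(1)[OF k]]) (rule z)
  have 2: "\<alpha> [u, v, axis k 1] = 0" for u v k
    by (rule linear_zero_on_axes[OF kforms_3_linear(2)[OF k]]) (rule 1)
  have "\<alpha> [u, v, w] = 0" for u v w
    by (rule linear_zero_on_axes[OF kforms_3_linear(3)[OF k]]) (rule 2)
  then show "\<alpha> vs = 0 vs"
    by (cases vs rule: list_cases_3) (simp_all add: kforms_3_degree[OF k])
qed

text \<open>An explicit inverse of \<open>of_coeffs\<close>, to replace the description operator in
  \<open>coeffs_of\<close>. The halves come from the pairs (I, O), ..., (N, T), which enter the
  values through sums and differences: on e_1,e_3,e_4 and e_1,e_5,e_6 the form takes the values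
  \<open>I + O'\<close> and \<open>O' - I\<close>.\<close>

definition basis_coeffs :: "form \<Rightarrow> coeffs" where
  "basis_coeffs \<alpha> = (let a = (\<lambda>i j k. \<alpha> [axis i 1, axis j 1, axis k 1]) in
     Coeffs (a 1 3 5) (a 1 3 6) (a 1 4 5) (a 1 4 6) (a 2 3 5) (a 2 3 6) (a 2 4 5) (a 2 4 6)
       ((a 1 3 4 - a 1 5 6) / 2) ((a 2 3 4 - a 2 5 6) / 2)
       ((a 1 2 3 - a 3 5 6) / 2) ((a 1 2 4 - a 4 5 6) / 2)
       ((a 1 2 5 - a 3 4 5) / 2) ((a 1 2 6 - a 3 4 6) / 2)
       ((a 1 3 4 + a 1 5 6) / 2) ((a 2 3 4 + a 2 5 6) / 2)
       ((a 1 2 3 + a 3 5 6) / 2) ((a 1 2 4 + a 4 5 6) / 2)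
       ((a 1 2 5 + a 3 4 5) / 2) ((a 1 2 6 + a 3 4 6) / 2))"

lemma axis_one_nth: "axis i (1::real) $ j = (if j = i then 1 else 0)"
  by (simp add: axis_def)

lemma of_coeffs_basis:
  fixes A B C D E F G H I J K L M N O' P Q R S T :: real
  defines "a \<equiv> (\<lambda>i j k.
      of_coeffs (Coeffs A B C D E F G H I J K L M N O' P Q R S T) [axis i 1, axis j 1, axis k 1])"
  shows "a 1 3 5 = A" "a 1 3 6 = B" "a 1 4 5 = C" "a 1 4 6 = D"
    "a 2 3 5 = E" "a 2 3 6 = F" "a 2 4 5 = G" "a 2 4 6 = H"
    "a 1 3 4 = I + O'" "a 1 5 6 = O' - I" "a 2 3 4 = J + P" "a 2 5 6 = P - J"
    "a 1 2 3 = K + Q" "a 3 5 6 = Q - K" "a 1 2 4 = L + R" "a 4 5 6 = R - L"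
    "a 1 2 5 = M + S" "a 3 4 5 = S - M" "a 1 2 6 = N + T" "a 3 4 6 = T - N"
  unfolding a_def of_coeffs_e3 plus_form scale_form_apply e3_apply
  by (simp_all add: axis_one_nth)

lemma basis_coeffs_of_coeffs: "basis_coeffs (of_coeffs c) = c"
  by (cases c) (simp only: basis_coeffs_def Let_def of_coeffs_basis, simp add: field_simps)

text \<open>Stated for an abstract array so that all 216 goals can be closed by \<open>rule\<close>:
  \<open>alt\<close> covers the repeated indices, and the other 120 triples are the six orderings of
  the twenty in \<open>z\<close>.\<close>

lemma basis_triples:
  fixes a :: "6 \<Rightarrow> 6 \<Rightarrow> 6 \<Rightarrow> real"
  assumes alt: "\<And>i j. a i i j = 0" "\<And>i j. a i j i = 0" "\<And>i j. a i j j = 0"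
    and swap: "\<And>i j k. a j i k = - a i j k" "\<And>i j k. a i k j = - a i j k"
    and z: "a 1 3 5 = 0" "a 1 3 6 = 0" "a 1 4 5 = 0" "a 1 4 6 = 0"
    "a 2 3 5 = 0" "a 2 3 6 = 0" "a 2 4 5 = 0" "a 2 4 6 = 0"
    "a 1 3 4 = 0" "a 1 5 6 = 0" "a 2 3 4 = 0" "a 2 5 6 = 0"
    "a 1 2 3 = 0" "a 3 5 6 = 0" "a 1 2 4 = 0" "a 4 5 6 = 0"
    "a 1 2 5 = 0" "a 3 4 5 = 0" "a 1 2 6 = 0" "a 3 4 6 = 0"
  shows "a i j k = 0"
proof -
  have perm: "a j i k = 0" "a i k j = 0" "a k j i = 0" "a j k i = 0" "a k i j = 0"
    if "a i j k = 0" for i j k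
    using swap(1)[of i j k] swap(2)[of i j k] swap(1)[of j k i] swap(2)[of j i k] swap(1)[of i k j]
      swap(2)[of k i j] that by linarith+
  note p = z z[THEN perm(1)] z[THEN perm(2)] z[THEN perm(3)] z[THEN perm(4)] z[THEN perm(5)]
  have "\<forall>i j k. a i j k = 0"
    unfolding forall_6 by (intro conjI) (rule alt p)+
  then show ?thesis by blast
qed

lemma of_coeffs_basis_coeffs:
  assumes k: "\<psi> \<in> kforms 3"
  shows "of_coeffs (basis_coeffs \<psi>) = \<psi>"
proof -
  have d: "\<psi> - of_coeffs (basis_coeffs \<psi>) \<in> kforms 3" (is "?d \<in> _")
    by (intro kforms_3_diff k of_coeffs_kforms)
  define a where "a = (\<lambda>i j k. ?d [axis i 1, axis j 1, axis k 1])"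
  have "a i j k = 0" for i j k
    by (rule basis_triples) (unfold a_def,
      (rule kforms_3_alt[OF d] kforms_3_swap[OF d])+,
      unfold fun_diff_def basis_coeffs_def Let_def of_coeffs_basis, simp_all add: field_simps)
  then have "?d = 0"
    by (intro kforms_3_zero d) (simp add: a_def)
  then show ?thesis by simp
qed

lemma ex1_of_coeffs: "\<psi> \<in> kforms 3 \<Longrightarrow> \<exists>!c. \<psi> = of_coeffs c"
  by (metis basis_coeffs_of_coeffs of_coeffs_basis_coeffs)

lemma coeffs_of_of_coeffs: "coeffs_of (of_coeffs c) = c"
  unfolding coeffs_of_def by (metis (mono_tags, lifting) basis_coeffs_of_coeffs the_equality)

lemma coeffs_of_kforms: "\<psi> \<in> kforms 3 \<Longrightarrow> coeffs_of \<psi> = basis_coeffs \<psi>"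
  by (metis basis_coeffs_of_coeffs coeffs_of_of_coeffs of_coeffs_basis_coeffs)

section \<open>The flow\<close>

lemma wedge_degree_0:
  assumes "\<And>vs. vs \<noteq> [] \<Longrightarrow> \<alpha> vs = 0"
  shows "(\<alpha> \<and>\<^sub>f \<beta>) vs = \<alpha> [] * \<beta> vs"
proof (induction vs arbitrary: \<beta>)
  case (Cons v vs)
  have "contract v \<alpha> \<and>\<^sub>f \<beta> = 0"
    by (rule ext) (simp add: wedge_def contract_def assms)
  then show ?case
    using Cons wedge_Cons[of 0 \<alpha> \<beta> v vs] assms by (simp add: contract_def)
qed (simp add: wedge_Nil)

lemma contract_apply: "contract v \<alpha> vs = \<alpha> (v # vs)"
  by (simp add: contract_def)

lemma wedge_degree_1_Cons:
  assumes "\<And>vs. length vs \<noteq> 1 \<Longrightarrow> \<alpha> vs = 0"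
  shows "(\<alpha> \<and>\<^sub>f \<beta>) (v # vs) = \<alpha> [v] * \<beta> vs - (\<alpha> \<and>\<^sub>f contract v \<beta>) vs"
  using wedge_Cons[of 1 \<alpha> \<beta> v vs] wedge_degree_0[of "contract v \<alpha>" \<beta> vs] assms
  by (simp add: contract_apply)

text \<open>A 2-form on the left is used up in two steps: contracted once it is a 1-form, contracted
  twice a scalar. Together the rules evaluate such products by rewriting.\<close>

lemma
  assumes \<alpha>: "\<And>vs. length vs \<noteq> 2 \<Longrightarrow> \<alpha> vs = 0"
  shows wedge_degree_2_Cons:
      "(\<alpha> \<and>\<^sub>f \<gamma>) (v # vs) = (contract v \<alpha> \<and>\<^sub>f \<gamma>) vs + (\<alpha> \<and>\<^sub>f contract v \<gamma>) vs"
    and wedge_contract_Cons: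
      "(contract v \<alpha> \<and>\<^sub>f \<gamma>) (w # vs) = \<alpha> [v, w] * \<gamma> vs - (contract v \<alpha> \<and>\<^sub>f contract w \<gamma>) vs"
  using wedge_Cons[of 2 \<alpha> \<gamma> v vs] wedge_degree_1_Cons[of "contract v \<alpha>" \<gamma> w vs] \<alpha>
  by (simp_all add: contract_apply)

lemma wedge_2_3:
  assumes \<alpha>: "\<And>vs. length vs \<noteq> 2 \<Longrightarrow> \<alpha> vs = 0" and \<beta>: "\<And>vs. length vs \<noteq> 3 \<Longrightarrow> \<beta> vs = 0"
  shows "(\<alpha> \<and>\<^sub>f \<beta>) [a, b, c, d, e] =
     \<alpha> [a, b] * \<beta> [c, d, e] - \<alpha> [a, c] * \<beta> [b, d, e] + \<alpha> [a, d] * \<beta> [b, c, e]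
   - \<alpha> [a, e] * \<beta> [b, c, d] + \<alpha> [b, c] * \<beta> [a, d, e] - \<alpha> [b, d] * \<beta> [a, c, e]
   + \<alpha> [b, e] * \<beta> [a, c, d] + \<alpha> [c, d] * \<beta> [a, b, e] - \<alpha> [c, e] * \<beta> [a, b, d]
   + \<alpha> [d, e] * \<beta> [a, b, c]"
  by (simp add: wedge_degree_2_Cons wedge_contract_Cons wedge_Nil contract_apply \<alpha> \<beta>)

text \<open>omega^3 is 6 times the standard volume form, so \<open>vol\<close> has value 1 on the
  basis and the division in \<open>top_coeff\<close> disappears.\<close>

lemma top_coeff_eq:
  "top_coeff \<alpha> = \<alpha> [axis 1 1, axis 2 1, axis 3 1, axis 4 1, axis 5 1, axis 6 1]"
proof -
  have deg: "omega vs = 0" if "length vs \<noteq> 2" for vs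
    using that by (simp add: omega_def e2_degree)
  have om: "omega [axis i 1, axis j 1] = (if (i, j) \<in> {(1, 2), (3, 4), (5, 6)} then 1
      else if (i, j) \<in> {(2, 1), (4, 3), (6, 5)} then -1 else 0)" for i j
    by (auto simp: omega_apply axis_one_nth)
  have "contract (axis 1 1) omega = coframe 2"
  proof
    show "contract (axis 1 1) omega vs = coframe 2 vs" for vs
      by (cases vs; cases "tl vs") (simp_all add: contract_apply deg coframe_simps omega_apply axis_one_nth)
  qed
  then have "(omega \<and>\<^sub>f omega \<and>\<^sub>f omega) [axis 1 1, axis 2 1, axis 3 1, axis 4 1, axis 5 1, axis 6 1] = 6"
    by (simp add: wedge_degree_2_Cons[OF deg] wedge_contract_Cons[OF deg] om wedge_Nil contract_apply deg
        wedge_coframe_left coframe_simps axis_one_nth)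
  then have "vol [axis 1 1, axis 2 1, axis 3 1, axis 4 1, axis 5 1, axis 6 1] = 1"
    by (simp add: vol_def scale_form_apply fact_numeral)
  then show ?thesis
    by (simp add: top_coeff_def)
qed

lemma Kmap_nth:
  "Kmap \<phi> v $ i = - (coframe i \<and>\<^sub>f contract v \<phi> \<and>\<^sub>f \<phi>)
     [axis 1 1, axis 2 1, axis 3 1, axis 4 1, axis 5 1, axis 6 1]"
  unfolding Kmap_def top_coeff_eq
  by (simp add: axis_def if_distrib cong: if_cong)

text \<open>On the standard basis, a product with \<open>coframe i\<close> on the left deletes e_i
  with sign (-1)^(i-1); together with the minus sign in \<open>Kmap\<close> the signs alternate,
  starting with a minus.\<close>

lemma Kmap_nths:
  fixes \<phi> v
  defines "W \<equiv> contract v \<phi> \<and>\<^sub>f \<phi>"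
  shows "Kmap \<phi> v $ 1 = - W [axis 2 1, axis 3 1, axis 4 1, axis 5 1, axis 6 1]"
    "Kmap \<phi> v $ 2 = W [axis 1 1, axis 3 1, axis 4 1, axis 5 1, axis 6 1]"
    "Kmap \<phi> v $ 3 = - W [axis 1 1, axis 2 1, axis 4 1, axis 5 1, axis 6 1]"
    "Kmap \<phi> v $ 4 = W [axis 1 1, axis 2 1, axis 3 1, axis 5 1, axis 6 1]"
    "Kmap \<phi> v $ 5 = - W [axis 1 1, axis 2 1, axis 3 1, axis 4 1, axis 6 1]"
    "Kmap \<phi> v $ 6 = W [axis 1 1, axis 2 1, axis 3 1, axis 4 1, axis 5 1]"
  unfolding Kmap_nth W_def[symmetric]
  by (simp_all add: wedge_coframe_left contract_apply axis_one_nth)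

lemma ce_d_3:
  "ce_d \<alpha> [a, b, c, d] =
     - \<alpha> [lie_bracket a b, c, d] + \<alpha> [lie_bracket a c, b, d] - \<alpha> [lie_bracket a d, b, c]
     - \<alpha> [lie_bracket b c, a, d] + \<alpha> [lie_bracket b d, a, c] - \<alpha> [lie_bracket c d, a, b]"
  by (simp add: ce_d_def lessThan_Suc nths_Cons numeral_2_eq_2 numeral_3_eq_3)

text \<open>Brackets end up only in slots 1 and 3 of \<open>\<beta>\<close>, while slot 2 always
  holds e_2, e_4 or e_6 itself; hence linearity is asked for in those two slots, and the eight
  values listed are all that occur. For an alternating \<open>\<beta>\<close> the zeros and the sign
  would be automatic, but \<open>Fform\<close> has not been shown to be alternating, so its values
  are checked one by one.\<close>

lemma ce_d_Lefschetz_ce_d: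
  assumes deg: "\<And>vs. length vs \<noteq> 3 \<Longrightarrow> \<beta> vs = 0"
    and lin: "\<And>v w. linear (\<lambda>u. \<beta> [u, v, w])" "\<And>u v. linear (\<lambda>w. \<beta> [u, v, w])"
    and val: "\<beta> [axis 4 1, axis 2 1, axis 6 1] = f" "\<beta> [axis 6 1, axis 2 1, axis 4 1] = - f"
      "\<beta> [axis 4 1, axis 2 1, axis 4 1] = 0" "\<beta> [axis 6 1, axis 2 1, axis 6 1] = 0"
      "\<beta> [axis 6 1, axis 4 1, axis 4 1] = 0" "\<beta> [axis 6 1, axis 4 1, axis 6 1] = 0"
      "\<beta> [axis 4 1, axis 6 1, axis 4 1] = 0" "\<beta> [axis 4 1, axis 6 1, axis 6 1] = 0"
  shows "ce_d (Lefschetz (ce_d \<beta>)) = (2 * f) *\<^sub>f e3 1 3 5"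
proof
  fix vs :: "V list"
  note add = lin[THEN linear_add] and diff = lin[THEN linear_diff] and neg = lin[THEN linear_neg]
    and cmul = lin[THEN linear_cmul]
  have zero: "\<beta> [0, v, w] = 0" for v w
    using lin(1)[THEN linear_0] .
  have central: "lie_bracket (axis i 1) y = 0" "lie_bracket y (axis i 1) = 0"
    if "i = 2 \<or> i = 4 \<or> i = 6" for y and i :: 6
    using that by (auto simp: vec_eq_iff forall_6 lie_bracket_nth axis_one_nth)
  have e: "lie_bracket (axis 1 1) y = - (y$5) *\<^sub>R axis 4 1 - (y$3) *\<^sub>R axis 6 1"
    "lie_bracket (axis 3 1) y = (y$1) *\<^sub>R axis 6 1"
    "lie_bracket (axis 5 1) y = (y$1) *\<^sub>R axis 4 1" for y
    by (simp_all add: lie_bracket_def axis_one_nth)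
  have L: "Lefschetz (ce_d \<beta>) [lie_bracket u v, y]
      = f * (- (u$1 * v$3 - u$3 * v$1) * y$5 + (u$1 * v$5 - u$5 * v$1) * y$3)" for u v y
  proof -
    \<comment> \<open>So of the six brackets in \<open>ce_d_3\<close> only that of e_1, e_3 or e_5
      with \<open>y\<close> remains. The two orders of each Darboux pair contribute equally, which
      cancels the factor 1/2 in \<open>Lefschetz\<close>.\<close>
    have "lie_bracket z (lie_bracket u v) = 0" "lie_bracket (lie_bracket u v) z = 0" for z
      by (simp_all add: vec_eq_iff forall_6 lie_bracket_nth)
    then have "Lefschetz (ce_d \<beta>) [lie_bracket u v, y]
        = - \<beta> [lie_bracket (axis 1 1) y, axis 2 1, lie_bracket u v]
          - \<beta> [lie_bracket (axis 3 1) y, axis 4 1, lie_bracket u v]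
          - \<beta> [lie_bracket (axis 5 1) y, axis 6 1, lie_bracket u v]"
      by (simp add: Lefschetz_apply ce_d_3 zero central)
    also have "\<dots> = f * (- (u$1 * v$3 - u$3 * v$1) * y$5 + (u$1 * v$5 - u$5 * v$1) * y$3)"
      unfolding e lie_bracket_def[of u v] diff add cmul neg val real_scaleR_def by (simp add: algebra_simps)
    finally show ?thesis .
  qed
  show "ce_d (Lefschetz (ce_d \<beta>)) vs = ((2 * f) *\<^sub>f e3 1 3 5) vs"
  proof (cases vs rule: list_cases_3)
    case 1
    have "Lefschetz (ce_d \<beta>) us = 0" if "length us \<noteq> 2" for us
      using that by (simp add: Lefschetz_apply ce_d_degree[of 3, OF deg])
    then have "ce_d (Lefschetz (ce_d \<beta>)) vs = 0"
      by (rule ce_d_degree[of 2]) (use 1 in simp_all)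
    then show ?thesis
      using 1 by (simp add: scale_form_apply e3_degree)
  next
    case (2 u v w)
    \<comment> \<open>After the cyclic sum in \<open>ce_d_2\<close>, each of the two products in
      \<open>L\<close> gives one copy of the determinant e^135(u,v,w); hence the factor 2.\<close>
    then show ?thesis
      by (simp add: ce_d_2 L scale_form_apply e3_apply algebra_simps)
  qed
qed

lemma wedge_contract_self:
  assumes "\<phi> \<in> kforms 3"
  shows "(contract v \<phi> \<and>\<^sub>f \<phi>) [a, b, c, d, e] =
     \<phi> [v, a, b] * \<phi> [c, d, e] - \<phi> [v, a, c] * \<phi> [b, d, e] + \<phi> [v, a, d] * \<phi> [b, c, e]
   - \<phi> [v, a, e] * \<phi> [b, c, d] + \<phi> [v, b, c] * \<phi> [a, d, e] - \<phi> [v, b, d] * \<phi> [a, c, e]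
   + \<phi> [v, b, e] * \<phi> [a, c, d] + \<phi> [v, c, d] * \<phi> [a, b, e] - \<phi> [v, c, e] * \<phi> [a, b, d]
   + \<phi> [v, d, e] * \<phi> [a, b, c]"
  by (subst wedge_2_3) (simp_all add: contract_apply kforms_3_degree[OF assms])

lemma linear_Kmap:
  assumes "\<phi> \<in> kforms 3"
  shows "linear (Kmap \<phi>)"
proof -
  note lin = kforms_3_linear(1)[OF assms]
  note W = wedge_contract_self[OF assms]
  have "linear (\<lambda>v. (contract v \<phi> \<and>\<^sub>f \<phi>) [a, b, c, d, e])" for a b c d e
    by (rule linearI) (simp_all add: W lin[THEN linear_add] lin[THEN linear_cmul] algebra_simps)
  note W = this[THEN linear_add] this[THEN linear_cmul]
  show ?thesis
    by (rule linearI) (simp_all add: vec_eq_iff forall_6 Kmap_nths W)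
qed

lemma Fform_apply: "Fform \<phi> [u, v, w] = - 2 * \<phi> [Kmap \<phi> u, v, w]"
  by (simp add: Fform_def)

lemma Fform_degree: "length vs \<noteq> 3 \<Longrightarrow> Fform \<phi> vs = 0"
  by (cases vs rule: list_cases_3) (auto simp: Fform_def split: list.split)

lemma Fform_expand:
  assumes "\<phi> \<in> kforms 3"
  shows "Fform \<phi> [u, v, w] = - 2 * (\<Sum>i\<in>UNIV. Kmap \<phi> u $ i * \<phi> [axis i 1, v, w])"
proof -
  note lin = kforms_3_linear(1)[OF assms]
  have "\<phi> [Kmap \<phi> u, v, w] = \<phi> [\<Sum>i\<in>UNIV. Kmap \<phi> u $ i *\<^sub>R axis i 1, v, w]"
    using basis_expansion[of "Kmap \<phi> u"] by (simp add: scalar_mult_eq_scaleR)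
  also have "\<dots> = (\<Sum>i\<in>UNIV. Kmap \<phi> u $ i * \<phi> [axis i 1, v, w])"
    by (simp add: linear_sum[OF lin] lin[THEN linear_cmul])
  finally show ?thesis
    by (simp add: Fform_apply)
qed

text \<open>Only e_4 and e_6 occur in the first slot of the relevant values of \<open>Fform\<close>,
  so K(e_4) and K(e_6) suffice, and the claim becomes a few polynomial identities in the twenty
  coefficients.\<close>

lemma flow_rhs_of_coeffs:
  "flow_rhs (of_coeffs c) = (- 4 * coA c * (coH c)\<^sup>2 + calR c) *\<^sub>f e3 1 3 5"
proof -
  obtain A B C D E F G' H I J K L M N O' P Q R S T
    where c: "c = Coeffs A B C D E F G' H I J K L M N O' P Q R S T"
    by (cases c)
  define \<phi> where "\<phi> = of_coeffs (Coeffs A B C D E F G' H I J K L M N O' P Q R S T)"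
  have k: "\<phi> \<in> kforms 3"
    unfolding \<phi>_def by (rule of_coeffs_kforms)
  note lin = kforms_3_linear[OF k]
  have perm: "\<phi> [v, u, w] = - x" "\<phi> [u, w, v] = - x" "\<phi> [w, v, u] = - x"
      "\<phi> [v, w, u] = x" "\<phi> [w, u, v] = x"
    if "\<phi> [u, v, w] = x" for u v w x
    using kforms_3_swap[OF k] that by (metis minus_minus)+
  note b = of_coeffs_basis[of A B C D E F G' H I J K L M N O' P Q R S T, folded \<phi>_def]
  \<comment> \<open>A rewriting table for \<open>\<phi>\<close> on all basis triples: the twenty
    values, their reorderings, and zero on repeated vectors.\<close>
  note ev = b b[THEN perm(1)] b[THEN perm(2)] b[THEN perm(3)] b[THEN perm(4)] b[THEN perm(5)]
    kforms_3_alt[OF k]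
  note W = wedge_contract_self[OF k]
  note Kn = Kmap_nths[of \<phi> "axis 4 1", unfolded W ev] Kmap_nths[of \<phi> "axis 6 1", unfolded W ev]
  define f where "f = (- 4 * A * H\<^sup>2 + calR c) / 2"
  have "ce_d (Lefschetz (ce_d (Fform \<phi>))) = (2 * f) *\<^sub>f e3 1 3 5"
  proof (rule ce_d_Lefschetz_ce_d)
    show "linear (\<lambda>u. Fform \<phi> [u, v, w])" for v w
      by (rule linearI) (simp_all add: Fform_apply linear_Kmap[OF k, THEN linear_add] lin[THEN linear_add]
          linear_Kmap[OF k, THEN linear_cmul] lin[THEN linear_cmul])
    show "linear (\<lambda>w. Fform \<phi> [u, v, w])" for u v
      by (rule linearI) (simp_all add: Fform_apply lin[THEN linear_add] lin[THEN linear_cmul])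
    show "Fform \<phi> [axis 4 1, axis 2 1, axis 6 1] = f"
      unfolding Fform_expand[OF k] sum_6 Kn ev f_def c calR.simps by (simp add: field_simps power2_eq_square)
    show "Fform \<phi> [axis 6 1, axis 2 1, axis 4 1] = - f"
      unfolding Fform_expand[OF k] sum_6 Kn ev f_def c calR.simps by (simp add: field_simps power2_eq_square)
    \<comment> \<open>One of the two equal vectors passes through K here, so these four zeros are
      genuine cancellations of cubic polynomials; in the two that follow, \<open>\<phi>\<close>
      itself receives a repeated vector.\<close>
    show "Fform \<phi> [axis 4 1, axis 2 1, axis 4 1] = 0" "Fform \<phi> [axis 6 1, axis 2 1, axis 6 1] = 0"
      "Fform \<phi> [axis 6 1, axis 4 1, axis 6 1] = 0" "Fform \<phi> [axis 4 1, axis 6 1, axis 4 1] = 0"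
      unfolding Fform_expand[OF k] sum_6 Kn ev by (simp_all add: algebra_simps)
    show "Fform \<phi> [axis 6 1, axis 4 1, axis 4 1] = 0" "Fform \<phi> [axis 4 1, axis 6 1, axis 6 1] = 0"
      by (simp_all add: Fform_apply kforms_3_alt[OF k])
  qed (rule Fform_degree)
  moreover have "2 * f = - 4 * coA c * (coH c)\<^sup>2 + calR c"
    by (simp add: f_def c del: calR.simps)
  ultimately show ?thesis
    by (simp only: flow_rhs_def \<phi>_def c)
qed

lemma of_coeffs_shift:
  "of_coeffs c + x *\<^sub>f e3 1 3 5 = of_coeffs (Coeffs (coA c + x) (coB c) (coC c) (coD c) (coE c)
     (coF c) (coG c) (coH c) (coI c) (coJ c) (coK c) (coL c) (coM c) (coN c) (coO c) (coP c)
     (coQ c) (coR c) (coS c) (coT c))"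
  by (cases c) (simp add: fun_eq_iff scale_form_apply distrib_right)

text \<open>A does not occur in \<open>calR\<close>, and e^135 carries only the coefficient A. This
  is why H and R are conserved along the direction of the flow.\<close>

lemma coeffs_of_shift:
  fixes c :: coeffs and x :: real
  defines "c' \<equiv> coeffs_of (of_coeffs c + x *\<^sub>f e3 1 3 5)"
  shows "coA c' = coA c + x"
    "f \<in> {coB, coC, coD, coE, coF, coG, coH, coI, coJ, coK, coL, coM, coN,
       coO, coP, coQ, coR, coS, coT} \<Longrightarrow> f c' = f c"
    "calR c' = calR c"
  unfolding c'_def of_coeffs_shift coeffs_of_of_coeffs by (cases c; auto)+

lemma of_coeffs_coeffs_of: "\<psi> \<in> kforms 3 \<Longrightarrow> of_coeffs (coeffs_of \<psi>) = \<psi>"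
  by (simp add: coeffs_of_kforms of_coeffs_basis_coeffs)

lemma flow_rhs_kforms_3:
  "\<psi> \<in> kforms 3 \<Longrightarrow> flow_rhs \<psi> =
     (- 4 * coA (coeffs_of \<psi>) * (coH (coeffs_of \<psi>))\<^sup>2 + calR (coeffs_of \<psi>)) *\<^sub>f e3 1 3 5"
  using flow_rhs_of_coeffs[of "coeffs_of \<psi>"] by (simp add: of_coeffs_coeffs_of)

lemma coA_coeffs_of: "\<psi> \<in> kforms 3 \<Longrightarrow> coA (coeffs_of \<psi>) = \<psi> [axis 1 1, axis 3 1, axis 5 1]"
  by (simp add: coeffs_of_kforms basis_coeffs_def Let_def)

lemma e3_135: "e3 1 3 5 [axis 1 1, axis 3 1, axis 5 1] = 1"
  by (simp add: e3_apply axis_one_nth)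

section \<open>The scalar linear equation for A, and uniqueness for the flow\<close>

definition linear_ode_sol :: "real \<Rightarrow> real \<Rightarrow> real \<Rightarrow> real \<Rightarrow> real" where
  "linear_ode_sol k r a t =
     (if k = 0 then a + r * t else exp (- k * t) * (r * (exp (k * t) - 1) / k + a))"

text \<open>Fixed point plus exponential deviation: the form in which derivative and limit are
  immediate.\<close>

lemma linear_ode_sol_alt: "k \<noteq> 0 \<Longrightarrow> linear_ode_sol k r a t = r / k + (a - r / k) * exp (- (k * t))"
  by (simp add: linear_ode_sol_def field_simps exp_minus)

lemma linear_ode_sol_0: "linear_ode_sol k r a 0 = a"
  by (simp add: linear_ode_sol_def)

lemma linear_ode_sol_deriv:
  "(linear_ode_sol k r a has_real_derivative - k * linear_ode_sol k r a t + r) (at t within J)"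
proof (cases "k = 0")
  case True
  then show ?thesis
    unfolding linear_ode_sol_def[abs_def] by (auto intro!: derivative_eq_intros)
next
  case False
  then show ?thesis
    unfolding linear_ode_sol_alt[OF False, abs_def]
    by (auto intro!: derivative_eq_intros simp: field_simps)
qed

text \<open>Integrating factor: exp(k t) times the difference from the explicit solution has
  derivative zero within \<open>J\<close>, and an interval is convex.\<close>

lemma linear_ode_unique:
  fixes k r :: real
  assumes J: "is_interval J" "0 \<in> J" "t \<in> J"
    and a: "\<And>t. t \<in> J \<Longrightarrow> (a has_real_derivative - k * a t + r) (at t within J)"
  shows "a t = linear_ode_sol k r (a 0) t"
proof -
  define b where "b = linear_ode_sol k r (a 0)"
  have b: "(b has_real_derivative - k * b t + r) (at t within J)" for t
    unfolding b_def by (rule linear_ode_sol_deriv)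
  have "((\<lambda>t. exp (k * t) * (a t - b t)) has_real_derivative 0) (at t within J)" if "t \<in> J" for t
    by (rule derivative_eq_intros a[OF that] b refl | simp add: algebra_simps)+
  then obtain c where "\<forall>t\<in>J. exp (k * t) * (a t - b t) = c"
    using has_field_derivative_zero_constant[OF is_interval_convex[OF J(1)]] by blast
  then have "exp (k * t) * (a t - b t) = exp (k * 0) * (a 0 - b 0)"
    using J by metis
  then show ?thesis
    by (simp add: b_def linear_ode_sol_0)
qed

text \<open>The candidate solution. \<open>of_coeffs c\<close> already contains the initial value of
  A, so only the increment of A is added.\<close>

definition flow_path :: "coeffs \<Rightarrow> real \<Rightarrow> form" where
  "flow_path c t =
     of_coeffs c + (linear_ode_sol (4 * (coH c)\<^sup>2) (calR c) (coA c) t - coA c) *\<^sub>f e3 1 3 5"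

lemma flow_path_kforms: "flow_path c t \<in> kforms 3"
  unfolding flow_path_def by (intro kforms_3_add of_coeffs_kforms kforms_3_scale kforms_3_e3)

lemma flow_path_coeffs:
  "coA (coeffs_of (flow_path c t)) = linear_ode_sol (4 * (coH c)\<^sup>2) (calR c) (coA c) t"
  "f \<in> {coB, coC, coD, coE, coF, coG, coH, coI, coJ, coK, coL, coM, coN,
       coO, coP, coQ, coR, coS, coT} \<Longrightarrow> f (coeffs_of (flow_path c t)) = f c"
  "calR (coeffs_of (flow_path c t)) = calR c"
  unfolding flow_path_def using coeffs_of_shift by simp_all

lemma flow_path_solution: "flow_solution J (flow_path c)"
proof -
  have "((\<lambda>s. flow_path c s vs) has_real_derivative flow_rhs (flow_path c t) vs) (at t within J)" for t vs
    unfolding flow_rhs_kforms_3[OF flow_path_kforms] flow_path_coeffs(1,3) flow_path_coeffs(2)[of coH, simplified]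
    unfolding flow_path_def plus_form scale_form_apply
    by (auto intro!: derivative_eq_intros linear_ode_sol_deriv simp: algebra_simps)
  then show ?thesis
    by (simp add: flow_solution_def flow_path_kforms)
qed

text \<open>The velocity is always a multiple of e^135. Subtracting a(t) e^135, with a(t) the value
  on e_1, e_3, e_5, therefore leaves a form that is constant on \<open>J\<close>, and the solution
  stays on a line parallel to e^135. Only then are H and R known to be constant, so that the
  equation for a(t) is linear with constant coefficients.\<close>

lemma flow_solution_eq_path:
  assumes J: "is_interval J" "0 \<in> J" and sol: "flow_solution J \<phi>" and t: "t \<in> J"
  shows "\<phi> t = flow_path (coeffs_of (\<phi> 0)) t"
proof -
  define c where "c = coeffs_of (\<phi> 0)"
  define a where "a t = \<phi> t [axis 1 1, axis 3 1, axis 5 1]" for t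
  define r where "r t = - 4 * coA (coeffs_of (\<phi> t)) * (coH (coeffs_of (\<phi> t)))\<^sup>2 + calR (coeffs_of (\<phi> t))" for t
  have k: "\<phi> t \<in> kforms 3" if "t \<in> J" for t
    using sol that by (simp add: flow_solution_def)
  have d: "((\<lambda>s. \<phi> s vs) has_real_derivative r t * e3 1 3 5 vs) (at t within J)" if "t \<in> J" for t vs
    using sol that by (auto simp: flow_solution_def flow_rhs_kforms_3 scale_form_apply r_def)
  have da: "(a has_real_derivative r t) (at t within J)" if "t \<in> J" for t
    using d[OF that, of "[axis 1 1, axis 3 1, axis 5 1]"] by (simp add: a_def[abs_def] e3_135)
  have c: "of_coeffs c = \<phi> 0"
    using of_coeffs_coeffs_of k J(2) by (simp add: c_def)
  have path: "\<phi> t = of_coeffs c + (a t - a 0) *\<^sub>f e3 1 3 5" if "t \<in> J" for t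
  proof
    fix vs
    have "((\<lambda>s. \<phi> s vs - a s * e3 1 3 5 vs) has_real_derivative 0) (at s within J)" if "s \<in> J" for s
      by (rule derivative_eq_intros d[OF that] da[OF that] refl | simp)+
    then have "\<exists>x. \<forall>s\<in>J. \<phi> s vs - a s * e3 1 3 5 vs = x"
      by (rule has_field_derivative_zero_constant[OF is_interval_convex[OF J(1)]])
    then have "\<phi> t vs - a t * e3 1 3 5 vs = \<phi> 0 vs - a 0 * e3 1 3 5 vs"
      using J(2) that by metis
    then show "\<phi> t vs = (of_coeffs c + (a t - a 0) *\<^sub>f e3 1 3 5) vs"
      by (simp add: c scale_form_apply algebra_simps)
  qed
  have a: "a t = coA (coeffs_of (\<phi> t))" if "t \<in> J" for t
    by (simp add: a_def coA_coeffs_of k that)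
  have "r t = - (4 * (coH c)\<^sup>2) * a t + calR c" if "t \<in> J" for t
    unfolding r_def a[OF that, symmetric] unfolding path[OF that]
    using coeffs_of_shift(2)[of coH c] coeffs_of_shift(3)[of c] by simp
  then have "a t = linear_ode_sol (4 * (coH c)\<^sup>2) (calR c) (a 0) t"
    using linear_ode_unique[OF J t, of a] da by simp
  then show ?thesis
    using path[OF t] by (simp add: flow_path_def a J(2) c_def)
qed

section \<open>Limits as t tends to infinity\<close>

lemma tendsto_form_iff:
  fixes \<phi> :: "'a \<Rightarrow> form"
  shows "(\<phi> \<longlongrightarrow> \<psi>) F \<longleftrightarrow> (\<forall>vs. ((\<lambda>t. \<phi> t vs) \<longlongrightarrow> \<psi> vs) F)"
  using limitin_componentwise[of "\<lambda>_. euclidean" UNIV \<phi> \<psi> F]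
  by (simp add: euclidean_product_topology)

lemma tendsto_linear_ode_sol:
  assumes "k > 0"
  shows "(linear_ode_sol k r a \<longlongrightarrow> r / k) at_top"
proof -
  have "((\<lambda>t. r / k + (a - r / k) * exp (- (k * t))) \<longlongrightarrow> r / k + (a - r / k) * 0) at_top"
    by (intro tendsto_intros filterlim_compose[OF exp_at_bot] filterlim_compose[OF filterlim_uminus_at_bot_at_top]
        filterlim_tendsto_pos_mult_at_top[OF tendsto_const assms filterlim_ident])
  then show ?thesis
    unfolding linear_ode_sol_alt[OF less_imp_neq[OF assms, symmetric], abs_def] by simp
qed

lemma flow_path_tendsto:
  assumes "coH c \<noteq> 0"
  shows "(flow_path c \<longlongrightarrow> of_coeffs c + (calR c / (4 * (coH c)\<^sup>2) - coA c) *\<^sub>f e3 1 3 5) at_top"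
proof -
  have "0 < 4 * (coH c)\<^sup>2" using assms by simp
  from tendsto_linear_ode_sol[OF this] show ?thesis
    unfolding tendsto_form_iff flow_path_def plus_form scale_form_apply
    by (auto intro!: tendsto_intros)
qed

text \<open>At A = R / (4 H^2) the velocity - 4 A H^2 + R is zero.\<close>

lemma flow_path_limit_stationary:
  assumes "coH c \<noteq> 0"
  shows "stationary (of_coeffs c + (calR c / (4 * (coH c)\<^sup>2) - coA c) *\<^sub>f e3 1 3 5)"
proof -
  have "of_coeffs c + x *\<^sub>f e3 1 3 5 \<in> kforms 3" for x
    by (intro kforms_3_add of_coeffs_kforms kforms_3_scale kforms_3_e3)
  moreover have "0 *\<^sub>f \<alpha> = 0" for \<alpha>
    by (simp add: fun_eq_iff scale_form_apply)
  ultimately show ?thesis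
    using assms
    by (simp add: stationary_def flow_rhs_kforms_3 coeffs_of_shift(1,3) coeffs_of_shift(2)[of coH])
qed

text \<open>For H = 0 the path is its initial form plus R t e^135, and division by R t makes the
  initial form negligible.\<close>

lemma flow_path_rescaled_tendsto:
  assumes "coH c = 0" "calR c \<noteq> 0"
  shows "((\<lambda>t. (1 / (calR c * t)) *\<^sub>f flow_path c t) \<longlongrightarrow> e3 1 3 5) at_top"
  unfolding tendsto_form_iff
proof
  fix vs
  have "((\<lambda>t. of_coeffs c vs / calR c * inverse t + e3 1 3 5 vs) \<longlongrightarrow> of_coeffs c vs / calR c * 0 + e3 1 3 5 vs) at_top"
    by (intro tendsto_intros tendsto_inverse_0_at_top filterlim_ident)
  moreover have "\<forall>\<^sub>F t in at_top. of_coeffs c vs / calR c * inverse t + e3 1 3 5 vs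
      = ((1 / (calR c * t)) *\<^sub>f flow_path c t) vs"
    using eventually_gt_at_top[of 0]
    by eventually_elim
      (use assms in \<open>simp add: flow_path_def plus_form scale_form_apply linear_ode_sol_def field_simps\<close>)
  ultimately show "((\<lambda>t. ((1 / (calR c * t)) *\<^sub>f flow_path c t) vs) \<longlongrightarrow> e3 1 3 5 vs) at_top"
    by (simp add: tendsto_cong[symmetric])
qed

lemma flow_path_converges_iff:
  "(\<exists>\<psi>\<in>kforms 3. (flow_path c \<longlongrightarrow> \<psi>) at_top) \<longleftrightarrow> coH c \<noteq> 0 \<or> calR c = 0"
proof
  assume "\<exists>\<psi>\<in>kforms 3. (flow_path c \<longlongrightarrow> \<psi>) at_top"
  then obtain \<psi> where \<psi>: "(flow_path c \<longlongrightarrow> \<psi>) at_top" by blast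
  show "coH c \<noteq> 0 \<or> calR c = 0"
  proof (rule ccontr)
    assume "\<not> (coH c \<noteq> 0 \<or> calR c = 0)"
    then have *: "coH c = 0" "calR c \<noteq> 0" by auto
    let ?E = "[axis 1 1, axis 3 1, axis 5 1] :: V list"
    have "((\<lambda>t. (1 / (calR c * t)) * flow_path c t ?E) \<longlongrightarrow> 1) at_top"
      using flow_path_rescaled_tendsto[OF *] unfolding tendsto_form_iff scale_form_apply
      by (metis e3_135)
    \<comment> \<open>A limit of the path would make the rescaled value tend to 0, whereas it has
      just been seen to tend to 1.\<close>
    moreover have "((\<lambda>t. inverse (calR c) * inverse t * flow_path c t ?E) \<longlongrightarrow> inverse (calR c) * 0 * \<psi> ?E) at_top"
      using \<psi> unfolding tendsto_form_iff
      by (intro tendsto_intros tendsto_inverse_0_at_top filterlim_ident) auto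
    ultimately show False
      by (auto simp: field_simps dest: tendsto_unique[rotated])
  qed
next
  assume "coH c \<noteq> 0 \<or> calR c = 0"
  then consider "coH c \<noteq> 0" | "coH c = 0" "calR c = 0" by auto
  then show "\<exists>\<psi>\<in>kforms 3. (flow_path c \<longlongrightarrow> \<psi>) at_top"
  proof cases
    case 1
    then show ?thesis
      using flow_path_tendsto by (blast intro: kforms_3_add of_coeffs_kforms kforms_3_scale kforms_3_e3)
  next
    case 2
    then have "flow_path c = (\<lambda>_. of_coeffs c)"
      by (simp add: fun_eq_iff flow_path_def linear_ode_sol_def scale_form_apply)
    then show ?thesis
      using of_coeffs_kforms by auto
  qed
qed

section \<open>Manifolds with locally affine charts\<close>

definition affine_map :: "('a::real_vector \<Rightarrow> 'b::real_vector) \<Rightarrow> bool" where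
  "affine_map g \<longleftrightarrow> (\<exists>l c. linear l \<and> g = (\<lambda>x. l x + c))"

lemma affine_mapI: "linear l \<Longrightarrow> affine_map (\<lambda>x. l x + c)"
  by (auto simp: affine_map_def)

lemma affine_map_linear: "linear l \<Longrightarrow> affine_map l"
  using affine_mapI[of l 0] by simp

lemma affine_map_const: "affine_map (\<lambda>x. c)"
  unfolding affine_map_def by (intro exI[of _ "\<lambda>x. 0"] exI[of _ c]) (simp add: linear_iff)

lemma affine_map_id: "affine_map (\<lambda>x. x)" "affine_map id"
  by (simp_all add: affine_map_linear linear_ident id_def)

lemma affine_map_compose: "affine_map g \<Longrightarrow> affine_map h \<Longrightarrow> affine_map (\<lambda>x. h (g x))"
  unfolding affine_map_def
proof (elim exE conjE)
  fix l c l' c' assume *: "linear l" "g = (\<lambda>x. l x + c)" "linear l'" "h = (\<lambda>x. l' x + c')"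
  have "linear (\<lambda>x. l' (l x))"
    using linear_compose[OF *(1) *(3)] by (simp add: o_def)
  then show "\<exists>l c. linear l \<and> (\<lambda>x. h (g x)) = (\<lambda>x. l x + c)"
    by (intro exI[of _ "\<lambda>x. l' (l x)"] exI[of _ "l' c + c'"]) (simp add: * linear_add[OF *(3)] add.assoc)
qed

lemma affine_map_Pair: "affine_map g \<Longrightarrow> affine_map h \<Longrightarrow> affine_map (\<lambda>x. (g x, h x))"
  unfolding affine_map_def
proof (elim exE conjE)
  fix l c l' c' assume *: "linear l" "g = (\<lambda>x. l x + c)" "linear l'" "h = (\<lambda>x. l' x + c')"
  have "linear (\<lambda>x. (l x, l' x))"
    by (rule linearI) (simp_all add: linear_add[OF *(1)] linear_add[OF *(3)] linear_cmul[OF *(1)] linear_cmul[OF *(3)])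
  then show "\<exists>k d. linear k \<and> (\<lambda>x. (g x, h x)) = (\<lambda>x. k x + d)"
    by (intro exI[of _ "\<lambda>x. (l x, l' x)"] exI[of _ "(c, c')"]) (simp add: *)
qed

lemma affine_map_map_prod:
  assumes "affine_map g" "affine_map h"
  shows "affine_map (map_prod g h)"
proof -
  have "affine_map (\<lambda>x. (g (fst x), h (snd x)))"
    by (intro affine_map_Pair affine_map_compose[OF _ assms(1)] affine_map_compose[OF _ assms(2)]
        affine_map_linear linear_fst linear_snd)
  then show ?thesis
    by (simp add: map_prod_def case_prod_unfold)
qed

lemma affine_map_has_derivative:
  fixes g :: "'a::euclidean_space \<Rightarrow> 'b::real_normed_vector"
  assumes "affine_map g"
  shows "(g has_derivative (\<lambda>v. g v - g 0)) (at x within S)"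
proof -
  obtain l c where l: "linear l" "g = (\<lambda>x. l x + c)"
    using assms by (auto simp: affine_map_def)
  have "(g has_derivative l) (at x within S)"
    unfolding l(2) using linear_imp_has_derivative[OF l(1)] by (auto intro!: derivative_eq_intros)
  then show ?thesis
    by (simp add: l linear_0[OF l(1)])
qed

lemma affine_map_continuous_on:
  fixes g :: "'a::euclidean_space \<Rightarrow> 'b::real_normed_vector"
  shows "affine_map g \<Longrightarrow> continuous_on S g"
  by (meson affine_map_has_derivative has_derivative_continuous_on)

lemma affine_map_open_vimage:
  fixes g :: "'a::euclidean_space \<Rightarrow> 'b::real_normed_vector"
  shows "affine_map g \<Longrightarrow> open T \<Longrightarrow> open (g -` T)"
  by (simp add: affine_map_continuous_on open_vimage)

text \<open>The neighbourhood \<open>N\<close> is not cut down to \<open>S\<close>: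
  \<open>C_on\<close> takes derivatives in the whole space, so \<open>f\<close> has to agree with
  \<open>g\<close> on all points near \<open>x\<close>.\<close>

definition locally_affine_on :: "'a::euclidean_space set \<Rightarrow> ('a \<Rightarrow> 'b::euclidean_space) \<Rightarrow> bool" where
  "locally_affine_on S f \<longleftrightarrow>
     (\<forall>x\<in>S. \<exists>N g. open N \<and> x \<in> N \<and> affine_map g \<and> (\<forall>u\<in>N. f u = g u))"

lemma locally_affine_onE:
  assumes "locally_affine_on S f" "x \<in> S"
  obtains N g where "open N" "x \<in> N" "affine_map g" "\<And>u. u \<in> N \<Longrightarrow> f u = g u"
proof -
  have "\<exists>N g. open N \<and> x \<in> N \<and> affine_map g \<and> (\<forall>u\<in>N. f u = g u)"
    using assms unfolding locally_affine_on_def by (rule bspec)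
  then show ?thesis
    using that by auto
qed

lemma frechet_derivative_affine:
  fixes g :: "'a::euclidean_space \<Rightarrow> 'b::euclidean_space"
  assumes "open N" "x \<in> N" "affine_map g" "\<And>u. u \<in> N \<Longrightarrow> f u = g u"
  shows "f differentiable (at x)" "frechet_derivative f (at x) = (\<lambda>v. g v - g 0)"
proof -
  have "(f has_derivative (\<lambda>v. g v - g 0)) (at x)"
    using has_derivative_transform_within_open[OF affine_map_has_derivative[OF assms(3)] assms(1,2)]
      assms(4) by metis
  then show "f differentiable (at x)" "frechet_derivative f (at x) = (\<lambda>v. g v - g 0)"
    by (auto simp: differentiable_def dest: frechet_derivative_at)
qed

text \<open>The derivative of a locally affine map in a fixed direction is locally constant, hence
  locally affine again, and the induction on the order of differentiability closes.\<close>

lemma locally_affine_on_smooth: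
  assumes "locally_affine_on S f"
  shows "smooth_on S f"
proof -
  have "C_on k S f" for k
    using assms
  proof (induction k arbitrary: f)
    case 0
    then have "f differentiable (at x)" if "x \<in> S" for x
      using that by (rule locally_affine_onE) (rule frechet_derivative_affine(1))
    then show ?case
      by (simp add: continuous_at_imp_continuous_on differentiable_imp_continuous_within)
  next
    case (Suc k)
    have "f differentiable (at x)" if "x \<in> S" for x
      using Suc.prems that by (rule locally_affine_onE) (rule frechet_derivative_affine(1))
    then have "f differentiable_on S"
      by (simp add: differentiable_at_imp_differentiable_on)
    moreover have "locally_affine_on S (\<lambda>x. frechet_derivative f (at x) v)" for v
      unfolding locally_affine_on_def
    proof
      fix x assume "x \<in> S"
      with Suc.prems obtain N g
        where N: "open N" "x \<in> N" "affine_map g" "\<And>u. u \<in> N \<Longrightarrow> f u = g u"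
        by (rule locally_affine_onE) (rule that)
      have "frechet_derivative f (at u) v = g v - g 0" if "u \<in> N" for u
        using frechet_derivative_affine(2)[OF N(1) that N(3,4)] by simp
      then show "\<exists>N h. open N \<and> x \<in> N \<and> affine_map h \<and> (\<forall>u\<in>N. frechet_derivative f (at u) v = h u)"
        using N(1,2) affine_map_const[of "g v - g 0"]
        by (intro exI[of _ N] exI[of _ "\<lambda>_. g v - g 0"]) simp
    qed
    ultimately show ?case
      by (simp add: Suc.IH)
  qed
  then show ?thesis
    by (simp add: smooth_on_def)
qed

text \<open>Presents \<open>M\<close> as the image of an open continuous map \<open>q\<close> from
  an open subset of the model space, with charts that are sections of \<open>q\<close> and become
  locally affine when composed with it. This replaces chart computations on \<open>M\<close> by
  computations on \<open>S\<close>.\<close>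

definition affine_param ::
    "('p, 'e::euclidean_space) mfld \<Rightarrow> 'e set \<Rightarrow> ('e \<Rightarrow> 'p) \<Rightarrow> bool" where
  "affine_param M S q \<longleftrightarrow>
     open S \<and> q ` S = topspace (mtop M) \<and>
     continuous_map (top_of_set S) (mtop M) q \<and> open_map (top_of_set S) (mtop M) q \<and>
     (\<forall>(U, x)\<in>atlas M. openin (mtop M) U \<and> open (x ` U) \<and> x ` U \<subseteq> S \<and> (\<forall>p\<in>U. q (x p) = p) \<and>
        locally_affine_on {u \<in> S. q u \<in> U} (x \<circ> q))"

text \<open>The lift \<open>g\<close> is only local, because lifts over different neighbourhoods may
  differ by a lattice translation. Unlike in \<open>locally_affine_on\<close>, agreement is asked
  for on \<open>N \<inter> S\<close> alone, since outside \<open>S\<close> the values of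
  \<open>q\<close> carry no information.\<close>

definition affine_lift ::
    "'e::euclidean_space set \<Rightarrow> ('e \<Rightarrow> 'p) \<Rightarrow> 'f::euclidean_space set \<Rightarrow> ('f \<Rightarrow> 'q) \<Rightarrow> ('p \<Rightarrow> 'q) \<Rightarrow> bool"
where
  "affine_lift S q S' q' f \<longleftrightarrow>
     (\<forall>u\<in>S. \<exists>N g. open N \<and> u \<in> N \<and> affine_map g \<and> (\<forall>v\<in>N \<inter> S. g v \<in> S' \<and> f (q v) = q' (g v)))"

lemma affine_liftE:
  assumes "affine_lift S q S' q' f" "u \<in> S"
  obtains N g where "open N" "u \<in> N" "affine_map g"
    "\<And>v. v \<in> N \<Longrightarrow> v \<in> S \<Longrightarrow> g v \<in> S'" "\<And>v. v \<in> N \<Longrightarrow> v \<in> S \<Longrightarrow> f (q v) = q' (g v)"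
proof -
  have "\<exists>N g. open N \<and> u \<in> N \<and> affine_map g \<and> (\<forall>v\<in>N \<inter> S. g v \<in> S' \<and> f (q v) = q' (g v))"
    using assms unfolding affine_lift_def by (rule bspec)
  then show ?thesis
    using that by auto
qed

lemma affine_paramI:
  assumes "open S" "q ` S = topspace (mtop M)" "continuous_map (top_of_set S) (mtop M) q"
    "open_map (top_of_set S) (mtop M) q"
    and "\<And>U x. (U, x) \<in> atlas M \<Longrightarrow> openin (mtop M) U"
      "\<And>U x. (U, x) \<in> atlas M \<Longrightarrow> open (x ` U)"
      "\<And>U x. (U, x) \<in> atlas M \<Longrightarrow> x ` U \<subseteq> S"
      "\<And>U x p. (U, x) \<in> atlas M \<Longrightarrow> p \<in> U \<Longrightarrow> q (x p) = p"
      "\<And>U x. (U, x) \<in> atlas M \<Longrightarrow> locally_affine_on {u \<in> S. q u \<in> U} (x \<circ> q)"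
  shows "affine_param M S q"
proof -
  have "case c of (U, x) \<Rightarrow> openin (mtop M) U \<and> open (x ` U) \<and> x ` U \<subseteq> S \<and>
      (\<forall>p\<in>U. q (x p) = p) \<and> locally_affine_on {u \<in> S. q u \<in> U} (x \<circ> q)"
    if c: "c \<in> atlas M" for c
  proof (cases c)
    case (Pair U x)
    then show ?thesis
      using assms(5-9)[of U x] c by simp
  qed
  then show ?thesis
    unfolding affine_param_def using assms(1-4) by (intro conjI ballI)
qed

lemma affine_param_basic:
  assumes "affine_param M S q"
  shows "open S" "q ` S = topspace (mtop M)" "continuous_map (top_of_set S) (mtop M) q"
    "open_map (top_of_set S) (mtop M) q"
  using assms unfolding affine_param_def by simp_all

text \<open>As \<open>q\<close> is open, continuous and onto, \<open>M\<close> carries the quotient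
  topology, and openness can be tested upstairs.\<close>

lemma affine_param_open:
  assumes M: "affine_param M S q"
  shows "openin (mtop M) W \<longleftrightarrow> W \<subseteq> topspace (mtop M) \<and> open {u \<in> S. q u \<in> W}"
proof
  assume W: "openin (mtop M) W"
  have "openin (top_of_set S) {u \<in> S. q u \<in> W}"
    using openin_continuous_map_preimage[OF affine_param_basic(3)[OF M] W] by simp
  then show "W \<subseteq> topspace (mtop M) \<and> open {u \<in> S. q u \<in> W}"
    using affine_param_basic(1)[OF M] openin_subset[OF W] by (simp add: openin_open_eq)
next
  assume W: "W \<subseteq> topspace (mtop M) \<and> open {u \<in> S. q u \<in> W}"
  then have "openin (mtop M) (q ` {u \<in> S. q u \<in> W})"
    using affine_param_basic(1,4)[OF M] by (simp add: open_map_def openin_open_eq)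
  moreover have "q ` {u \<in> S. q u \<in> W} = W"
    using affine_param_basic(2)[OF M] W by auto
  ultimately show "openin (mtop M) W" by simp
qed

lemma affine_paramD:
  assumes "affine_param M S q" "(U, x) \<in> atlas M"
  shows "openin (mtop M) U" "open (x ` U)" "x ` U \<subseteq> S" "\<And>p. p \<in> U \<Longrightarrow> q (x p) = p"
    "locally_affine_on {u \<in> S. q u \<in> U} (x \<circ> q)"
proof -
  have "\<forall>(U, x)\<in>atlas M. openin (mtop M) U \<and> open (x ` U) \<and> x ` U \<subseteq> S \<and> (\<forall>p\<in>U. q (x p) = p) \<and>
      locally_affine_on {u \<in> S. q u \<in> U} (x \<circ> q)"
    using assms(1) unfolding affine_param_def by (elim conjE)
  from bspec[OF this assms(2)] show "openin (mtop M) U" "open (x ` U)" "x ` U \<subseteq> S"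
      "\<And>p. p \<in> U \<Longrightarrow> q (x p) = p" "locally_affine_on {u \<in> S. q u \<in> U} (x \<circ> q)"
    by simp_all
qed

lemma affine_param_inv:
  assumes "affine_param M S q" "(U, x) \<in> atlas M" "e \<in> x ` U"
  shows "inv_into U x e = q e" "q e \<in> U"
  using assms affine_paramD(4)[OF assms(1,2)] by (metis f_inv_into_f inv_into_into)+

lemma locally_affine_open:
  assumes "locally_affine_on S f" "open S" "open T"
  shows "open {u \<in> S. f u \<in> T}"
proof -
  have "continuous_on S f"
    using locally_affine_on_smooth[OF assms(1)] unfolding smooth_on_def by (metis C_on.simps(1))
  then show ?thesis
    using assms(2,3) continuous_open_preimage[of S f T] by (simp add: vimage_def Int_def)
qed

text \<open>On the image of the chart, \<open>inv_into U x\<close> is \<open>q\<close>. So the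
  coordinate expression of \<open>f\<close> is \<open>y\<close> after \<open>q'\<close> after
  \<open>g\<close>, a composition of locally affine maps.\<close>

lemma affine_lift_chart:
  assumes M: "affine_param M S q" and N: "affine_param N S' q'" and f: "affine_lift S q S' q' f"
    and U: "(U, x) \<in> atlas M" and V: "(V, y) \<in> atlas N"
  shows "locally_affine_on (x ` (U \<inter> f -` V)) (y \<circ> f \<circ> inv_into U x)"
  unfolding locally_affine_on_def
proof
  fix e assume "e \<in> x ` (U \<inter> f -` V)"
  then obtain p where p: "p \<in> U" "f p \<in> V" "e = x p" by auto
  then have e: "e \<in> x ` U" "q e = p" "e \<in> S"
    using affine_paramD[OF M U] by auto
  from f e(3) obtain N1 g where N1: "open N1" "e \<in> N1" "affine_map g"
    and g: "\<And>v. v \<in> N1 \<Longrightarrow> v \<in> S \<Longrightarrow> g v \<in> S'" "\<And>v. v \<in> N1 \<Longrightarrow> v \<in> S \<Longrightarrow> f (q v) = q' (g v)"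
    by (rule affine_liftE) (rule that)
  have "g e \<in> {w \<in> S'. q' w \<in> V}"
    using e p N1 g[of e] by simp
  with affine_paramD(5)[OF N V] obtain N2 h
    where N2: "open N2" "g e \<in> N2" "affine_map h" "\<And>w. w \<in> N2 \<Longrightarrow> (y \<circ> q') w = h w"
    by (rule locally_affine_onE) (rule that)
  show "\<exists>N0 k. open N0 \<and> e \<in> N0 \<and> affine_map k \<and> (\<forall>u\<in>N0. (y \<circ> f \<circ> inv_into U x) u = k u)"
  proof (intro exI conjI ballI)
    show "open (x ` U \<inter> N1 \<inter> g -` N2)"
      using N1 N2 affine_paramD(2)[OF M U] by (intro open_Int affine_map_open_vimage)
    show "e \<in> x ` U \<inter> N1 \<inter> g -` N2"
      using e N1 N2 by simp
    show "affine_map (\<lambda>u. h (g u))"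
      by (rule affine_map_compose[OF N1(3) N2(3)])
    fix u assume u: "u \<in> x ` U \<inter> N1 \<inter> g -` N2"
    then have "u \<in> S" using affine_paramD(3)[OF M U] by blast
    then show "(y \<circ> f \<circ> inv_into U x) u = h (g u)"
      using u g[of u] N2(4)[of "g u"] affine_param_inv(1)[OF M U] by simp
  qed
qed

lemma affine_lift_continuous:
  assumes M: "affine_param M S q" and N: "affine_param N S' q'" and f: "affine_lift S q S' q' f"
  shows "continuous_map (mtop M) (mtop N) f"
  unfolding continuous_map
proof (intro conjI allI impI)
  note S = affine_param_basic(1,2)[OF M] affine_param_basic(1,2)[OF N]
  show "f ` topspace (mtop M) \<subseteq> topspace (mtop N)"
  proof -
    have "f (q u) \<in> q' ` S'" if "u \<in> S" for u
      using f that by (rule affine_liftE) (use that in auto)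
    then show ?thesis
      unfolding S(2)[symmetric] S(4)[symmetric] by auto
  qed
  fix W assume W: "openin (mtop N) W"
  show "openin (mtop M) {p \<in> topspace (mtop M). f p \<in> W}"
    unfolding affine_param_open[OF M]
  proof
    show "open {u \<in> S. q u \<in> {p \<in> topspace (mtop M). f p \<in> W}}"
      unfolding open_subopen[of "{u \<in> S. _ u}"]
    proof
      fix u assume "u \<in> {u \<in> S. q u \<in> {p \<in> topspace (mtop M). f p \<in> W}}"
      then have u: "u \<in> S" "f (q u) \<in> W" by auto
      from f this(1) obtain N1 g where N1: "open N1" "u \<in> N1" "affine_map g"
        and g: "\<And>v. v \<in> N1 \<Longrightarrow> v \<in> S \<Longrightarrow> g v \<in> S'"
          "\<And>v. v \<in> N1 \<Longrightarrow> v \<in> S \<Longrightarrow> f (q v) = q' (g v)"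
        by (rule affine_liftE) (rule that)
      have "open (N1 \<inter> S \<inter> g -` {w \<in> S'. q' w \<in> W})"
        using N1 S W affine_param_open[OF N] by (intro open_Int affine_map_open_vimage) auto
      moreover have "u \<in> N1 \<inter> S \<inter> g -` {w \<in> S'. q' w \<in> W}"
        using N1 u g[of u] by auto
      moreover have "N1 \<inter> S \<inter> g -` {w \<in> S'. q' w \<in> W}
          \<subseteq> {u \<in> S. q u \<in> {p \<in> topspace (mtop M). f p \<in> W}}"
        using g S by auto
      ultimately show "\<exists>T. open T \<and> u \<in> T \<and> T \<subseteq> {u \<in> S. q u \<in> {p \<in> topspace (mtop M). f p \<in> W}}"
        by blast
    qed
  qed auto
qed

lemma affine_lift_smooth_map:
  assumes "affine_param M S q" "affine_param N S' q'" "affine_lift S q S' q' f"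
  shows "smooth_map M N f"
  unfolding smooth_map_def
  using affine_lift_continuous[OF assms] affine_lift_chart[OF assms] locally_affine_on_smooth by blast

lemma affine_lift_diffeomorphism:
  assumes M: "affine_param M S q" and N: "affine_param N S' q'"
    and f: "affine_lift S q S' q' f" and g: "affine_lift S' q' S q g"
    and gf: "\<And>p. p \<in> topspace (mtop M) \<Longrightarrow> g (f p) = p"
    and fg: "\<And>p. p \<in> topspace (mtop N) \<Longrightarrow> f (g p) = p"
  shows "diffeomorphism M N f"
  unfolding diffeomorphism_def homeomorphic_maps_def
  using affine_lift_smooth_map[OF M N f] affine_lift_smooth_map[OF N M g]
    affine_lift_continuous[OF M N f] affine_lift_continuous[OF N M g] gf fg by blast

lemma ball_case_prodI: "(\<And>a b. (a, b) \<in> A \<Longrightarrow> P a b) \<Longrightarrow> \<forall>(a, b)\<in>A. P a b"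
  by auto

text \<open>Second countability passes through the open surjection \<open>q\<close>; each chart is a
  homeomorphism with inverse \<open>q\<close>; transition maps are coordinate expressions of the
  identity, which lifts to the identity. The Hausdorff property cannot be obtained this way and is a
  hypothesis.\<close>

lemma affine_param_smooth_manifold:
  assumes M: "affine_param M S q" and H: "Hausdorff_space (mtop M)"
    and cover: "topspace (mtop M) \<subseteq> (\<Union>(U, x)\<in>atlas M. U)"
  shows "smooth_manifold M"
proof -
  note S = affine_param_basic[OF M]
  obtain \<B> :: "'b set set" where \<B>: "countable \<B>" "\<And>C. C \<in> \<B> \<Longrightarrow> open C"
      "\<And>W. open W \<Longrightarrow> \<exists>\<U>. \<U> \<subseteq> \<B> \<and> W = \<Union>\<U>"
    using univ_second_countable by blast
  have "\<exists>V\<in>\<B>. e \<in> V \<and> V \<subseteq> W" if "open W" "e \<in> W" for W e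
    using \<B>(3)[OF that(1)] that(2) by auto
  then have "second_countable (euclidean :: 'b topology)"
    unfolding second_countable_def using \<B>(1,2) by (intro exI[of _ \<B>]) simp
  then have "second_countable (top_of_set S)"
    by (rule second_countable_subtopology)
  then have "second_countable (mtop M)"
    using second_countable_open_map_image[OF S(3,4)] S(2) by simp
  moreover have "homeomorphic_map (subtopology (mtop M) U) (top_of_set (x ` U)) x"
    if U: "(U, x) \<in> atlas M" for U x
  proof -
    note D = affine_paramD[OF M U]
    have "continuous_map (top_of_set (x ` U)) (subtopology (mtop M) U) q"
      using S(3) D(3,4)
      by (auto simp: continuous_map_in_subtopology intro: continuous_map_from_subtopology_mono)
    moreover have "continuous_map (subtopology (mtop M) U) euclidean x"
      unfolding continuous_map
    proof (intro conjI allI impI)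
      fix T :: "'b set" assume T: "openin euclidean T"
      have "openin (mtop M) {p \<in> U. x p \<in> T}"
        unfolding affine_param_open[OF M]
      proof
        show "{p \<in> U. x p \<in> T} \<subseteq> topspace (mtop M)"
          using D(1) openin_subset by blast
        have "{u \<in> S. q u \<in> {p \<in> U. x p \<in> T}} = {u \<in> {u \<in> S. q u \<in> U}. (x \<circ> q) u \<in> T}"
          by auto
        then show "open {u \<in> S. q u \<in> {p \<in> U. x p \<in> T}}"
          using locally_affine_open[OF D(5)] T D(1) affine_param_open[OF M] by auto
      qed
      moreover have "{p \<in> topspace (subtopology (mtop M) U). x p \<in> T} = {p \<in> U. x p \<in> T}"
        using D(1) openin_subset by (auto simp: topspace_subtopology)
      ultimately show "openin (subtopology (mtop M) U) {p \<in> topspace (subtopology (mtop M) U). x p \<in> T}"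
        by (auto simp: openin_subtopology)
    qed auto
    then have "continuous_map (subtopology (mtop M) U) (top_of_set (x ` U)) x"
      by (auto simp: continuous_map_in_subtopology)
    ultimately show ?thesis
      using D(3,4) openin_subset[OF D(1)]
      by (auto intro!: homeomorphic_maps_imp_map[of _ _ _ q] simp: homeomorphic_maps_def)
  qed
  moreover have "smooth_on (x ` (U \<inter> V)) (y \<circ> inv_into U x)"
    if "(U, x) \<in> atlas M" "(V, y) \<in> atlas M" for U x V y
  proof -
    have "affine_lift S q S q (\<lambda>p. p)"
      unfolding affine_lift_def by (metis IntD2 UNIV_I affine_map_id(1) open_UNIV)
    from affine_lift_chart[OF M M this that] show ?thesis
      using locally_affine_on_smooth by (simp add: comp_def)
  qed
  moreover have "(\<Union>(U, x)\<in>atlas M. U) = topspace (mtop M)"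
  proof (rule subset_antisym)
    show "(\<Union>(U, x)\<in>atlas M. U) \<subseteq> topspace (mtop M)"
      using openin_subset[OF affine_paramD(1)[OF M]] by auto
  qed (rule cover)
  moreover have "openin (mtop M) U" "open (x ` U)" if "(U, x) \<in> atlas M" for U x
    using affine_paramD(1,2)[OF M that] by simp_all
  ultimately show ?thesis
    unfolding smooth_manifold_def using H by (intro conjI ball_case_prodI) simp_all
qed

lemma locally_affine_on_subset: "locally_affine_on S f \<Longrightarrow> T \<subseteq> S \<Longrightarrow> locally_affine_on T f"
  unfolding locally_affine_on_def by blast

lemma affine_param_open_part:
  assumes M: "affine_param M S q" and W: "openin (mtop M) W"
  shows "affine_param (open_part M W) {u \<in> S. q u \<in> W} q"
proof -
  let ?S = "{u \<in> S. q u \<in> W}"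
  note S = affine_param_basic[OF M]
  have o: "open ?S" using W affine_param_open[OF M] by blast
  have "?S \<subseteq> S" by auto
  then have sub: "subtopology (top_of_set S) ?S = top_of_set ?S"
    by (simp add: subtopology_subtopology inf_absorb2)
  have "q ` ?S = topspace (mtop (open_part M W))"
    using S(2) by (auto simp: open_part_def)
  moreover have "continuous_map (top_of_set ?S) (mtop (open_part M W)) q"
    using S(3) sub by (auto simp: open_part_def continuous_map_in_subtopology
        intro: continuous_map_from_subtopology_mono)
  moreover have "open_map (top_of_set ?S) (mtop (open_part M W)) q"
    using open_map_restriction[OF S(4), of W ?S] sub by (simp add: open_part_def)
  moreover have "openin (mtop (open_part M W)) U'" "open (x ` U')" "x ` U' \<subseteq> ?S"
      "\<And>p. p \<in> U' \<Longrightarrow> q (x p) = p" "locally_affine_on {u \<in> ?S. q u \<in> U'} (x \<circ> q)"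
    if U': "(U', x) \<in> atlas (open_part M W)" for U' x
  proof -
    obtain U where U: "(U, x) \<in> atlas M" "U' = U \<inter> W"
      using U' by (auto simp: open_part_def)
    note D = affine_paramD[OF M U(1)]
    show "openin (mtop (open_part M W)) U'"
      using D(1) by (auto simp: open_part_def openin_subtopology U(2))
    have "x ` U' = x ` U \<inter> ?S"
    proof
      show "x ` U' \<subseteq> x ` U \<inter> ?S" using D(3,4) U(2) by auto
      show "x ` U \<inter> ?S \<subseteq> x ` U'" using D(4) U(2) by auto
    qed
    then show "open (x ` U')" "x ` U' \<subseteq> ?S"
      using D(2) o by auto
    show "q (x p) = p" if "p \<in> U'" for p
      using D(4) that U(2) by blast
    show "locally_affine_on {u \<in> ?S. q u \<in> U'} (x \<circ> q)"
      using D(5) by (rule locally_affine_on_subset) (auto simp: U(2))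
  qed
  ultimately show ?thesis
    using o by (intro affine_paramI)
qed

lemma affine_param_euclidean: "open S \<Longrightarrow> affine_param (euclidean_mfld S) S id"
  by (rule affine_paramI)
    (auto simp: euclidean_mfld_def locally_affine_on_def open_map_id intro!: affine_map_id exI[of _ id])

lemma affine_param_prod:
  assumes M: "affine_param M S q" and N: "affine_param N S' q'"
  shows "affine_param (prod_mfld M N) (S \<times> S') (map_prod q q')"
proof -
  note S = affine_param_basic[OF M]
  note S' = affine_param_basic[OF N]
  have prod: "prod_topology (top_of_set S) (top_of_set S') = top_of_set (S \<times> S')"
    by (simp add: subtopology_Times[symmetric])
  have image: "map_prod f g ` (A \<times> B) = f ` A \<times> g ` B" for f :: "'x \<Rightarrow> 'y" and g :: "'z \<Rightarrow> 'w" and A B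
    by force
  have "map_prod q q' ` (S \<times> S') = topspace (mtop (prod_mfld M N))"
    by (simp add: image S(2) S'(2) prod_mfld_def)
  moreover have "continuous_map (top_of_set (S \<times> S')) (mtop (prod_mfld M N)) (map_prod q q')"
    unfolding prod[symmetric] using S(3) S'(3)
    by (simp only: prod_mfld_def mfld.select_convs map_prod_def continuous_map_prod_top simp_thms)
  moreover have "open_map (top_of_set (S \<times> S')) (mtop (prod_mfld M N)) (map_prod q q')"
    unfolding open_map_def prod[symmetric]
  proof (intro allI impI)
    fix W assume W: "openin (prod_topology (top_of_set S) (top_of_set S')) W"
    show "openin (mtop (prod_mfld M N)) (map_prod q q' ` W)"
      unfolding prod_mfld_def mfld.select_convs openin_prod_topology_alt
    proof (intro allI impI)
      fix a b assume "(a, b) \<in> map_prod q q' ` W"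
      then obtain u v where uv: "(u, v) \<in> W" "a = q u" "b = q' v" by auto
      then obtain X Y where XY: "openin (top_of_set S) X" "openin (top_of_set S') Y" "u \<in> X" "v \<in> Y" "X \<times> Y \<subseteq> W"
        using W unfolding openin_prod_topology_alt by meson
      have "q ` X \<times> q' ` Y = map_prod q q' ` (X \<times> Y)"
        by (simp only: image)
      then show "\<exists>X Y. openin (mtop M) X \<and> openin (mtop N) Y \<and> a \<in> X \<and> b \<in> Y \<and> X \<times> Y \<subseteq> map_prod q q' ` W"
        using XY S(4) S'(4) uv unfolding open_map_def
        by (intro exI[of _ "q ` X"] exI[of _ "q' ` Y"]) (auto intro: image_mono)
    qed
  qed
  moreover have "openin (mtop (prod_mfld M N)) W" "open (z ` W)" "z ` W \<subseteq> S \<times> S'"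
      "\<And>p. p \<in> W \<Longrightarrow> map_prod q q' (z p) = p"
      "locally_affine_on {u \<in> S \<times> S'. map_prod q q' u \<in> W} (z \<circ> map_prod q q')"
    if "(W, z) \<in> atlas (prod_mfld M N)" for W z
  proof -
    obtain U x V y where U: "(U, x) \<in> atlas M" and V: "(V, y) \<in> atlas N"
        and W: "W = U \<times> V" "z = map_prod x y"
      using \<open>(W, z) \<in> _\<close> by (auto simp: prod_mfld_def)
    note D = affine_paramD[OF M U] and E = affine_paramD[OF N V]
    show "openin (mtop (prod_mfld M N)) W"
      using D(1) E(1) by (simp add: prod_mfld_def openin_prod_Times_iff W)
    have *: "z ` W = x ` U \<times> y ` V"
      by (simp only: image W)
    show "open (z ` W)" "z ` W \<subseteq> S \<times> S'"
      unfolding * using D(2,3) E(2,3) by (auto intro: open_Times)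
    show "map_prod q q' (z p) = p" if "p \<in> W" for p
      using D(4) E(4) that W by auto
    show "locally_affine_on {u \<in> S \<times> S'. map_prod q q' u \<in> W} (z \<circ> map_prod q q')"
      unfolding locally_affine_on_def
    proof
      fix w assume "w \<in> {u \<in> S \<times> S'. map_prod q q' u \<in> W}"
      then obtain u v where w: "w = (u, v)" "u \<in> S" "q u \<in> U" "v \<in> S'" "q' v \<in> V" by (cases w) (auto simp: W)
      have uv: "u \<in> {u \<in> S. q u \<in> U}" "v \<in> {u \<in> S'. q' u \<in> V}"
        using w by auto
      from D(5) uv(1) obtain N1 g
        where 1: "open N1" "u \<in> N1" "affine_map g" "\<And>u. u \<in> N1 \<Longrightarrow> (x \<circ> q) u = g u"
        by (rule locally_affine_onE) (rule that)
      from E(5) uv(2) obtain N2 h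
        where 2: "open N2" "v \<in> N2" "affine_map h" "\<And>u. u \<in> N2 \<Longrightarrow> (y \<circ> q') u = h u"
        by (rule locally_affine_onE) (rule that)
      show "\<exists>N0 k. open N0 \<and> w \<in> N0 \<and> affine_map k \<and> (\<forall>u\<in>N0. (z \<circ> map_prod q q') u = k u)"
        using 1 2 w by (intro exI[of _ "N1 \<times> N2"] exI[of _ "map_prod g h"])
          (auto simp: W intro: open_Times affine_map_map_prod)
    qed
  qed
  ultimately show ?thesis
    using S(1) S'(1) by (intro affine_paramI open_Times)
qed

section \<open>Quotients by discrete groups of affine maps\<close>

text \<open>The construction of \<open>nilmanifold\<close> for an arbitrary quotient map, so that
  the nilmanifold, the base and the fibre are treated at once.\<close>

definition quotient_mfld :: "('e::euclidean_space \<Rightarrow> 'p) \<Rightarrow> ('p, 'e) mfld" where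
  "quotient_mfld q = \<lparr>mtop = topology (\<lambda>W. W \<subseteq> range q \<and> open (q -` W)),
     atlas = {(q ` U, inv_into U q) | U. open U \<and> inj_on q U}\<rparr>"

lemma openin_quotient_mfld:
  "openin (mtop (quotient_mfld q)) W \<longleftrightarrow> W \<subseteq> range q \<and> open (q -` W)"
proof -
  have "istopology (\<lambda>W. W \<subseteq> range q \<and> open (q -` W))"
    by (auto simp: istopology_def vimage_Union)
  then show ?thesis
    by (simp add: quotient_mfld_def)
qed

lemma topspace_quotient_mfld: "topspace (mtop (quotient_mfld q)) = range q"
proof (rule subset_antisym)
  show "topspace (mtop (quotient_mfld q)) \<subseteq> range q"
    using openin_topspace[of "mtop (quotient_mfld q)"] unfolding openin_quotient_mfld by (rule conjunct1)
  have "q -` range q = UNIV" by auto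
  then have "openin (mtop (quotient_mfld q)) (range q)"
    unfolding openin_quotient_mfld by simp
  then show "range q \<subseteq> topspace (mtop (quotient_mfld q))"
    by (rule openin_subset)
qed

lemma atlas_quotient_mfld:
  "(U, x) \<in> atlas (quotient_mfld q) \<longleftrightarrow> (\<exists>W. U = q ` W \<and> x = inv_into W q \<and> open W \<and> inj_on q W)"
  by (auto simp: quotient_mfld_def)

text \<open>\<open>dv y x\<close> plays the role of \<open>y x\<^sup>-\<^sup>1\<close> in a Lie group with unit \<open>0\<close>, \<open>tr d\<close> that of the left
  translation by \<open>d\<close>, and \<open>D\<close> that of a discrete subgroup with quotient map \<open>q\<close>.\<close>

locale discrete_quotient =
  fixes dv :: "'e::euclidean_space \<Rightarrow> 'e \<Rightarrow> 'e" and tr :: "'e \<Rightarrow> 'e \<Rightarrow> 'e"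
    and D :: "'e set" and q :: "'e \<Rightarrow> 'p"
  assumes continuous_dv: "continuous_on UNIV (\<lambda>z. dv (fst z) (snd z))"
    and dv_eq: "dv y x = d \<longleftrightarrow> y = tr d x"
    and dv_self: "dv x x = 0"
    and affine_tr: "affine_map (tr d)"
    and dv_closed: "d \<in> D \<Longrightarrow> d' \<in> D \<Longrightarrow> dv d d' \<in> D"
    and isolated: "\<exists>\<epsilon>>0. \<forall>d\<in>D. norm d < \<epsilon> \<longrightarrow> d = 0"
    and q_eq: "q x = q y \<longleftrightarrow> dv y x \<in> D"
begin

lemma q_tr: "d \<in> D \<Longrightarrow> q (tr d x) = q x"
  by (metis dv_eq q_eq)

lemma q_eqE:
  assumes "q x = q y"
  obtains d where "d \<in> D" "y = tr d x"
  using assms dv_eq q_eq by blast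

lemma dv_zero: "dv y x = 0 \<Longrightarrow> y = x"
  by (metis dv_eq dv_self)

lemma dv_small:
  assumes "\<epsilon> > 0"
  shows "\<exists>\<delta>>0. \<forall>u\<in>ball x \<delta>. \<forall>v\<in>ball x \<delta>. norm (dv u v) < \<epsilon>"
proof -
  have "open ((\<lambda>z. dv (fst z) (snd z)) -` ball 0 \<epsilon>)"
    using continuous_dv by (intro open_vimage) auto
  moreover have "(x, x) \<in> (\<lambda>z. dv (fst z) (snd z)) -` ball 0 \<epsilon>"
    using assms by (simp add: dv_self)
  ultimately obtain A B where AB: "open A" "open B" "(x, x) \<in> A \<times> B"
      "A \<times> B \<subseteq> (\<lambda>z. dv (fst z) (snd z)) -` ball 0 \<epsilon>"
    by (rule open_prod_elim)
  then obtain \<delta> where "\<delta> > 0" "ball x \<delta> \<subseteq> A \<inter> B"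
    by (metis IntI SigmaE2 open_Int open_contains_ball)
  then show ?thesis
    using AB(4) by (intro exI[of _ \<delta>]) (auto simp: subset_iff)
qed

text \<open>Isolation is assumed at 0 only; division carries it to a ball around any point, also
  around points outside \<open>D\<close>, as closedness requires.\<close>

lemma D_separated: "\<exists>\<delta>>0. \<forall>d\<in>D \<inter> ball x \<delta>. \<forall>d'\<in>D \<inter> ball x \<delta>. d = d'"
proof -
  obtain \<epsilon> where \<epsilon>: "\<epsilon> > 0" "\<And>d. d \<in> D \<Longrightarrow> norm d < \<epsilon> \<Longrightarrow> d = 0"
    using isolated by blast
  obtain \<delta> where "\<delta> > 0" "\<And>u v. u \<in> ball x \<delta> \<Longrightarrow> v \<in> ball x \<delta> \<Longrightarrow> norm (dv u v) < \<epsilon>"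
    using dv_small[OF \<epsilon>(1)] by blast
  then show ?thesis
    using dv_closed dv_zero \<epsilon>(2) by (metis IntE)
qed

lemma closed_D: "closed D"
  unfolding closed_limpt
proof (intro allI impI)
  fix x assume x: "x islimpt D"
  obtain \<delta> where \<delta>: "\<delta> > 0" "\<And>d d'. d \<in> D \<inter> ball x \<delta> \<Longrightarrow> d' \<in> D \<inter> ball x \<delta> \<Longrightarrow> d = d'"
    using D_separated by blast
  obtain d where d: "d \<in> D \<inter> ball x \<delta>" "d \<noteq> x"
    using x \<delta>(1) unfolding islimpt_approachable by (metis IntI dist_commute mem_ball)
  \<comment> \<open>A second point of \<open>D\<close>, strictly closer to \<open>x\<close> than
    \<open>d\<close>. Separation forces it to equal \<open>d\<close>, a contradiction:
    \<open>D\<close> has no limit points at all.\<close>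
  obtain d' where d': "d' \<in> D" "d' \<noteq> x" "dist d' x < min \<delta> (dist d x)"
    using x d \<delta>(1) unfolding islimpt_approachable by (metis min_less_iff_conj zero_less_dist_iff)
  then have "d' = d"
    using \<delta>(2)[of d' d] d(1) by (auto simp: dist_commute)
  then show "x \<in> D"
    using d' by simp
qed

lemma local_injective: "\<exists>\<delta>>0. inj_on q (ball x \<delta>)"
proof -
  obtain \<epsilon> where \<epsilon>: "\<epsilon> > 0" "\<And>d. d \<in> D \<Longrightarrow> norm d < \<epsilon> \<Longrightarrow> d = 0"
    using isolated by blast
  obtain \<delta> where "\<delta> > 0" "\<And>u v. u \<in> ball x \<delta> \<Longrightarrow> v \<in> ball x \<delta> \<Longrightarrow> norm (dv u v) < \<epsilon>"
    using dv_small[OF \<epsilon>(1)] by blast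
  then show ?thesis
    unfolding inj_on_def q_eq using dv_zero \<epsilon>(2) by metis
qed

lemma open_saturation:
  assumes "open U"
  shows "open (q -` q ` U)"
proof -
  have "q -` q ` U = (\<Union>d\<in>D. tr d -` U)"
  proof
    show "q -` q ` U \<subseteq> (\<Union>d\<in>D. tr d -` U)"
      by (auto elim!: q_eqE)
    show "(\<Union>d\<in>D. tr d -` U) \<subseteq> q -` q ` U"
      by (auto simp: image_iff) (metis q_tr)
  qed
  then show ?thesis
    using affine_map_open_vimage[OF affine_tr assms] by (simp add: open_UN)
qed

text \<open>The one element \<open>d\<close> that carries \<open>u\<close> into \<open>V\<close>
  also carries all nearby points there, so near \<open>u\<close> the section composed with
  \<open>q\<close> is translation by a fixed \<open>d\<close>. The lattice translations in the
  affine lifts below come from here.\<close>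

lemma local_section:
  assumes "open V" "inj_on q V" "q u \<in> q ` V"
  obtains N d where "open N" "u \<in> N" "d \<in> D" "\<And>v. v \<in> N \<Longrightarrow> tr d v \<in> V"
    "\<And>v. v \<in> N \<Longrightarrow> inv_into V q (q v) = tr d v"
proof -
  obtain w where w: "w \<in> V" "q u = q w"
    using assms(3) by auto
  then obtain d where d: "d \<in> D" "w = tr d u"
    by (blast elim: q_eqE)
  show thesis
  proof (rule that[of "tr d -` V" d])
    show "open (tr d -` V)"
      using assms(1) affine_tr by (rule affine_map_open_vimage[rotated])
    fix v assume v: "v \<in> tr d -` V"
    then show "tr d v \<in> V" by simp
    then show "inv_into V q (q v) = tr d v"
      using inv_into_f_f[OF assms(2), of "tr d v"] q_tr[OF d(1)] by simp
  qed (use w d in auto)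
qed

lemma affine_param_quotient: "affine_param (quotient_mfld q) UNIV q"
proof (rule affine_paramI)
  show "continuous_map (top_of_set UNIV) (mtop (quotient_mfld q)) q"
    unfolding continuous_map by (auto simp: openin_quotient_mfld topspace_quotient_mfld vimage_def)
  have open_q: "openin (mtop (quotient_mfld q)) (q ` U)" if "open U" for U
    using open_saturation[OF that] by (auto simp: openin_quotient_mfld)
  then show "open_map (top_of_set UNIV) (mtop (quotient_mfld q)) q"
    by (simp add: open_map_def)
  fix U x assume "(U, x) \<in> atlas (quotient_mfld q)"
  then obtain W where W: "U = q ` W" "x = inv_into W q" "open W" "inj_on q W"
    unfolding atlas_quotient_mfld by blast
  have xU: "x ` U = W"
    using W(4) by (simp add: W(1,2) image_image)
  show "openin (mtop (quotient_mfld q)) U" "open (x ` U)" "x ` U \<subseteq> UNIV"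
    using open_q W xU by auto
  show "q (x p) = p" if "p \<in> U" for p
    using that by (simp add: W f_inv_into_f)
  show "locally_affine_on {u \<in> UNIV. q u \<in> U} (x \<circ> q)"
    unfolding locally_affine_on_def
  proof
    fix u assume "u \<in> {u \<in> UNIV. q u \<in> U}"
    then have "q u \<in> q ` W" by (simp add: W)
    with W(3,4) obtain N d where "open N" "u \<in> N" "\<And>v. v \<in> N \<Longrightarrow> inv_into W q (q v) = tr d v"
      by (rule local_section) (rule that)
    then show "\<exists>N g. open N \<and> u \<in> N \<and> affine_map g \<and> (\<forall>u\<in>N. (x \<circ> q) u = g u)"
      using affine_tr W(2) by (intro exI[of _ N] exI[of _ "tr d"]) simp
  qed
qed (auto simp: topspace_quotient_mfld)

text \<open>Since \<open>D\<close> is closed, inequivalence is an open condition on pairs; a product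
  neighbourhood inside it separates the two points.\<close>

lemma Hausdorff_quotient: "Hausdorff_space (mtop (quotient_mfld q))"
  unfolding Hausdorff_space_def topspace_quotient_mfld
proof (intro allI impI)
  fix p p' assume "p \<in> range q \<and> p' \<in> range q \<and> p \<noteq> p'"
  then obtain x y where xy: "p = q x" "p' = q y" "q x \<noteq> q y" by auto
  have "open ((\<lambda>z. dv (fst z) (snd z)) -` (- D))"
    using continuous_dv closed_D by (intro open_vimage) auto
  moreover have "(y, x) \<in> (\<lambda>z. dv (fst z) (snd z)) -` (- D)"
    using xy(3) by (simp add: q_eq)
  ultimately obtain A B where AB: "open A" "open B" "(y, x) \<in> A \<times> B"
      "A \<times> B \<subseteq> (\<lambda>z. dv (fst z) (snd z)) -` (- D)"
    by (rule open_prod_elim)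
  have "q u \<noteq> q v" if "u \<in> B" "v \<in> A" for u v
    using AB(4) that by (auto simp: q_eq)
  then have "disjnt (q ` B) (q ` A)"
    by (auto simp: disjnt_iff)
  then show "\<exists>U V. openin (mtop (quotient_mfld q)) U \<and> openin (mtop (quotient_mfld q)) V \<and>
      p \<in> U \<and> p' \<in> V \<and> disjnt U V"
    using AB open_saturation xy
    by (intro exI[of _ "q ` B"] exI[of _ "q ` A"]) (auto simp: openin_quotient_mfld)
qed

lemma smooth_manifold_quotient: "smooth_manifold (quotient_mfld q)"
proof (rule affine_param_smooth_manifold[OF affine_param_quotient Hausdorff_quotient])
  show "topspace (mtop (quotient_mfld q)) \<subseteq> (\<Union>(U, x)\<in>atlas (quotient_mfld q). U)"
  proof
    fix p assume "p \<in> topspace (mtop (quotient_mfld q))"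
    then obtain u where u: "p = q u"
      by (auto simp: topspace_quotient_mfld)
    obtain \<delta> where "\<delta> > 0" "inj_on q (ball u \<delta>)"
      using local_injective by blast
    then have "(q ` ball u \<delta>, inv_into (ball u \<delta>) q) \<in> atlas (quotient_mfld q)" "p \<in> q ` ball u \<delta>"
      by (auto simp: atlas_quotient_mfld u)
    then show "p \<in> (\<Union>(U, x)\<in>atlas (quotient_mfld q). U)"
      by blast
  qed
qed

end

lemma discrete_quotient_additive:
  fixes D :: "'e::euclidean_space set"
  assumes "\<And>d d'. d \<in> D \<Longrightarrow> d' \<in> D \<Longrightarrow> d - d' \<in> D" "\<exists>\<epsilon>>0. \<forall>d\<in>D. norm d < \<epsilon> \<longrightarrow> d = 0"
    and "\<And>x y. q x = q y \<longleftrightarrow> y - x \<in> D"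
  shows "discrete_quotient (-) (\<lambda>d x. x + d) D q"
proof
  show "affine_map (\<lambda>x. x + d)" for d :: 'e
    by (rule affine_mapI[OF linear_ident])
qed (use assms in \<open>auto intro!: continuous_intros simp: algebra_simps\<close>)

section \<open>The lattice and its projections\<close>

definition base_coord :: "V \<Rightarrow> real^3" where
  "base_coord x = vector [x$1, x$3, x$5]"

definition fibre_coord :: "V \<Rightarrow> real^3" where
  "fibre_coord x = vector [x$2, x$4, x$6]"

definition from_coords :: "real^3 \<Rightarrow> real^3 \<Rightarrow> V" where
  "from_coords b z = b$1 *\<^sub>R axis 1 1 + z$1 *\<^sub>R axis 2 1 + b$2 *\<^sub>R axis 3 1
     + z$2 *\<^sub>R axis 4 1 + b$3 *\<^sub>R axis 5 1 + z$3 *\<^sub>R axis 6 1"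

lemma base_coord_nth: "base_coord x $ 1 = x$1" "base_coord x $ 2 = x$3" "base_coord x $ 3 = x$5"
  by (simp_all add: base_coord_def)

lemma fibre_coord_nth: "fibre_coord x $ 1 = x$2" "fibre_coord x $ 2 = x$4" "fibre_coord x $ 3 = x$6"
  by (simp_all add: fibre_coord_def)

text \<open>The index 6 is 0 in the type \<open>6\<close>; the last equation is the one before it in
  the form to which numerals simplify.\<close>

lemma from_coords_nth:
  "from_coords b z $ 1 = b$1" "from_coords b z $ 2 = z$1" "from_coords b z $ 3 = b$2"
  "from_coords b z $ 4 = z$2" "from_coords b z $ 5 = b$3" "from_coords b z $ 6 = z$3"
  "from_coords b z $ 0 = z$3"
  by (simp_all add: from_coords_def axis_def)

lemma base_coord_eq_iff: "base_coord x = b \<longleftrightarrow> x$1 = b$1 \<and> x$3 = b$2 \<and> x$5 = b$3"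
  by (simp add: vec_eq_iff forall_3 base_coord_nth)

lemma coords_simps [simp]:
  "base_coord (from_coords b z) = b" "fibre_coord (from_coords b z) = z"
  "from_coords (base_coord x) (fibre_coord x) = x"
  by (simp_all add: vec_eq_iff forall_3 forall_6 base_coord_nth fibre_coord_nth from_coords_nth)

lemma linear_base_coord: "linear base_coord"
  by (rule linearI) (simp_all add: vec_eq_iff forall_3 base_coord_nth)

lemma linear_fibre_coord: "linear fibre_coord"
  by (rule linearI) (simp_all add: vec_eq_iff forall_3 fibre_coord_nth)

lemma linear_from_coords: "linear (\<lambda>p. from_coords (fst p) (snd p))"
  by (rule linearI) (simp_all add: vec_eq_iff forall_6 from_coords_nth)

lemma norm_base_coord: "norm (base_coord x) \<le> norm x"
  unfolding norm_vec_def L2_set_def sum_6 sum_3 base_coord_nth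
  by (intro real_sqrt_le_mono) simp

abbreviation gmult (infixl "\<star>" 70) where "x \<star> y \<equiv> x \<otimes>\<^bsub>G\<^esub> y"

lemma gmult_eq: "x \<star> y = x + y + (1/2) *\<^sub>R lie_bracket x y"
  by (simp add: G_def)

lemma gmult_nth:
  "(x \<star> y) $ 1 = x$1 + y$1" "(x \<star> y) $ 2 = x$2 + y$2" "(x \<star> y) $ 3 = x$3 + y$3"
  "(x \<star> y) $ 4 = x$4 + y$4 - (x$1 * y$5 - x$5 * y$1) / 2" "(x \<star> y) $ 5 = x$5 + y$5"
  "(x \<star> y) $ 6 = x$6 + y$6 - (x$1 * y$3 - x$3 * y$1) / 2"
  "(x \<star> y) $ 0 = x$0 + y$0 - (x$1 * y$3 - x$3 * y$1) / 2"
  by (simp_all add: gmult_eq lie_bracket_nth field_simps)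

lemma base_coord_gmult: "base_coord (x \<star> y) = base_coord x + base_coord y"
  by (simp add: vec_eq_iff forall_3 base_coord_nth gmult_nth)

lemma carrier_G [simp]: "x \<in> carrier G"
  by (simp add: G_def)

lemma one_G: "\<one>\<^bsub>G\<^esub> = 0"
  by (simp add: G_def)

lemma gmult_minus_eq: "y \<star> (- x) = d \<longleftrightarrow> y = d \<star> x"
proof -
  have "(y \<star> (- x)) \<star> x = y" "(y \<star> x) \<star> (- x) = y" for y
    by (simp_all add: vec_eq_iff forall_6 gmult_nth field_simps)
  then show ?thesis by metis
qed

lemma affine_map_gmult: "affine_map (\<lambda>x. d \<star> x)"
proof -
  have "linear (\<lambda>x. x + (1/2) *\<^sub>R lie_bracket d x)"
    by (rule linearI) (simp_all add: vec_eq_iff forall_6 lie_bracket_nth algebra_simps)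
  from affine_mapI[OF this, of d] show ?thesis
    by (simp add: gmult_eq add_ac)
qed

locale nil_lattice =
  fixes \<Gamma> :: "V set"
  assumes lattice: "cocompact_discrete_subgroup \<Gamma>"
begin

lemma subgroup_\<Gamma>: "subgroup \<Gamma> G"
  using lattice by (simp add: cocompact_discrete_subgroup_def)

lemma \<Gamma>_mult: "x \<in> \<Gamma> \<Longrightarrow> y \<in> \<Gamma> \<Longrightarrow> x \<star> y \<in> \<Gamma>"
  using subgroup_\<Gamma> by (rule subgroup.m_closed)

lemma \<Gamma>_minus: "x \<in> \<Gamma> \<Longrightarrow> - x \<in> \<Gamma>"
  using subgroup.m_inv_closed[OF subgroup_\<Gamma>] by (simp add: inv_G)

lemma \<Gamma>_zero: "0 \<in> \<Gamma>"
  using subgroup.one_closed[OF subgroup_\<Gamma>] by (simp add: one_G)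

abbreviation proj :: "V \<Rightarrow> V set" where "proj x \<equiv> \<Gamma> #>\<^bsub>G\<^esub> x"

lemma \<Gamma>_isolated: "\<exists>\<epsilon>>0. \<forall>d\<in>\<Gamma>. norm d < \<epsilon> \<longrightarrow> d = 0"
proof -
  have "0 isolated_in \<Gamma>"
    using lattice \<Gamma>_zero by (simp add: cocompact_discrete_subgroup_def discrete_def)
  then show ?thesis
    by (auto simp: isolated_in_dist_Ex_iff)
qed

lemma proj_eq: "proj x = proj y \<longleftrightarrow> y \<star> (- x) \<in> \<Gamma>"
proof
  assume "proj x = proj y"
  then have "y \<in> proj x"
    using group.rcos_self[OF group_G _ subgroup_\<Gamma>, of y] by simp
  then show "y \<star> (- x) \<in> \<Gamma>"
    by (auto simp: r_coset_def gmult_minus_eq[THEN iffD2])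
next
  assume "y \<star> (- x) \<in> \<Gamma>"
  moreover have "y = (y \<star> (- x)) \<star> x"
    using gmult_minus_eq by blast
  ultimately have "y \<in> proj x"
    unfolding r_coset_def by blast
  then show "proj x = proj y"
    by (intro group.repr_independence[OF group_G] subgroup_\<Gamma>) simp_all
qed

sublocale nil: discrete_quotient "\<lambda>y x. y \<star> (- x)" "\<lambda>d x. d \<star> x" \<Gamma> proj
proof
  show "continuous_on UNIV (\<lambda>z::V \<times> V. fst z \<star> (- snd z))"
    unfolding gmult_eq lie_bracket_def by (intro continuous_intros)
  show "x \<star> (- x) = 0" for x
    by (simp add: vec_eq_iff forall_6 gmult_nth)
qed (use gmult_minus_eq affine_map_gmult \<Gamma>_mult \<Gamma>_minus \<Gamma>_isolated proj_eq in auto)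

lemma nilmanifold_eq: "nilmanifold \<Gamma> = quotient_mfld proj"
proof -
  have "rcosets\<^bsub>G\<^esub> \<Gamma> = range proj"
    by (auto simp: RCOSETS_def G_def)
  then show ?thesis
    by (simp add: nilmanifold_def quotient_mfld_def nil_topology_def vimage_def)
qed

lemma topspace_nilmanifold: "topspace (mtop (nilmanifold \<Gamma>)) = range proj"
  by (simp add: nilmanifold_eq topspace_quotient_mfld)

definition base_lattice :: "(real^3) set" where
  "base_lattice = base_coord ` \<Gamma>"

lemma base_lattice_diff: "b \<in> base_lattice \<Longrightarrow> b' \<in> base_lattice \<Longrightarrow> b - b' \<in> base_lattice"
proof -
  assume "b \<in> base_lattice" "b' \<in> base_lattice"
  then obtain x y where xy: "x \<in> \<Gamma>" "y \<in> \<Gamma>" "b = base_coord x" "b' = base_coord y"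
    by (auto simp: base_lattice_def)
  have "b - b' = base_coord (x \<star> (- y))"
    by (simp add: xy base_coord_gmult linear_neg[OF linear_base_coord])
  then show "b - b' \<in> base_lattice"
    using xy \<Gamma>_mult \<Gamma>_minus by (auto simp: base_lattice_def)
qed

text \<open>Otherwise a linear functional vanishing on the projected lattice would descend to an unbounded
  continuous function on the compact quotient.\<close>

lemma span_base_lattice: "span base_lattice = UNIV"
proof (rule ccontr)
  assume "span base_lattice \<noteq> UNIV"
  then obtain a where a: "a \<noteq> 0" "\<And>b. b \<in> span base_lattice \<Longrightarrow> a \<bullet> b = 0"
    using span_not_UNIV_orthogonal by blast
  define f where "f p = a \<bullet> base_coord (SOME x. p = proj x)" for p
  \<comment> \<open>Independent of the chosen representative: changing it adds an element of the
    projected lattice to \<open>base_coord\<close>, and \<open>a\<close> is orthogonal to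
    these.\<close>
  have f: "f (proj x) = a \<bullet> base_coord x" for x
  proof -
    have "proj x = proj (SOME y. proj x = proj y)"
      by (rule someI) (rule refl)
    then obtain d where "d \<in> \<Gamma>" "(SOME y. proj x = proj y) = d \<star> x"
      by (rule nil.q_eqE)
    then show ?thesis
      using a(2)[of "base_coord d"]
      by (simp add: f_def base_coord_gmult inner_add_right base_lattice_def span_base)
  qed
  have "continuous_map (mtop (nilmanifold \<Gamma>)) euclideanreal f"
    unfolding continuous_map
  proof (intro conjI allI impI)
    fix T :: "real set" assume "openin euclidean T"
    then have "open ((\<lambda>x. a \<bullet> base_coord x) -` T)"
      using linear_continuous_on[OF linear_conv_bounded_linear[THEN iffD1, OF linear_base_coord]]
      by (intro open_vimage continuous_intros) auto
    moreover have "proj -` {p \<in> topspace (mtop (nilmanifold \<Gamma>)). f p \<in> T} = (\<lambda>x. a \<bullet> base_coord x) -` T"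
      by (auto simp: topspace_nilmanifold f)
    ultimately show "openin (mtop (nilmanifold \<Gamma>)) {p \<in> topspace (mtop (nilmanifold \<Gamma>)). f p \<in> T}"
      unfolding nilmanifold_eq openin_quotient_mfld
      by (auto simp: topspace_quotient_mfld)
  qed auto
  moreover have "compact_space (mtop (nilmanifold \<Gamma>))"
    using lattice by (simp add: cocompact_discrete_subgroup_def nilmanifold_def)
  ultimately have "compactin euclideanreal (f ` topspace (mtop (nilmanifold \<Gamma>)))"
    unfolding compact_space_def by (intro image_compactin)
  then have "bounded (f ` range proj)"
    by (simp add: topspace_nilmanifold compact_imp_bounded)
  then obtain B where B: "\<And>x. \<bar>f (proj x)\<bar> \<le> B"
    unfolding bounded_iff by auto
  \<comment> \<open>Chosen so that the functional takes the value \<open>B + 1\<close> at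
    \<open>t *\<^sub>R a\<close>.\<close>
  define t where "t = (B + 1) / (a \<bullet> a)"
  have "f (proj (from_coords (t *\<^sub>R a) 0)) = B + 1"
    using a(1) by (simp add: f t_def)
  then show False
    using B[of "from_coords (t *\<^sub>R a) 0"] by simp
qed

text \<open>A small element of the projected lattice is the projection of some \<open>d\<close> in \<open>\<Gamma>\<close> having small,
  hence trivial, commutators with finitely many elements of \<open>\<Gamma>\<close> whose projections span.\<close>

lemma base_lattice_isolated: "\<exists>\<epsilon>>0. \<forall>b\<in>base_lattice. norm b < \<epsilon> \<longrightarrow> b = 0"
proof -
  obtain \<epsilon> where \<epsilon>: "\<epsilon> > 0" "\<And>d. d \<in> \<Gamma> \<Longrightarrow> norm d < \<epsilon> \<Longrightarrow> d = 0"
    using \<Gamma>_isolated by blast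
  obtain B where B: "B \<subseteq> base_lattice" "independent B" "base_lattice \<subseteq> span B"
    using maximal_independent_subset by blast
  have "finite B"
    using B(2) by (rule independent_imp_finite)
  have span_B: "span B = UNIV"
    using span_mono[OF B(3)] span_base_lattice by (simp add: span_span top.extremum_unique)
  define lift where "lift b = (SOME x. x \<in> \<Gamma> \<and> base_coord x = b)" for b
  have lift: "lift b \<in> \<Gamma>" "base_coord (lift b) = b" if "b \<in> base_lattice" for b
  proof -
    have "\<exists>x. x \<in> \<Gamma> \<and> base_coord x = b"
      using that by (auto simp: base_lattice_def)
    then have "lift b \<in> \<Gamma> \<and> base_coord (lift b) = b"
      unfolding lift_def by (rule someI_ex)
    then show "lift b \<in> \<Gamma>" "base_coord (lift b) = b" by auto
  qed
  \<comment> \<open>The bracket depends on base coordinates alone. Hence it is small for small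
    \<open>b\<close>, even though \<open>lift b\<close> may be far from 0 in the central
    directions.\<close>
  define br where "br b c = lie_bracket (from_coords b 0) (from_coords c 0)" for b c
  have br: "lie_bracket x y = br (base_coord x) (base_coord y)" for x y
    by (simp add: br_def lie_bracket_def from_coords_nth base_coord_nth)
  have lin: "linear (\<lambda>b. br b c)" "linear (br b)" for b c
    by (rule linearI; simp add: br_def vec_eq_iff forall_6 lie_bracket_nth from_coords_nth algebra_simps)+
  have "\<forall>\<^sub>F b in nhds 0. norm (br b c) < \<epsilon>" for c
  proof -
    have "open ((\<lambda>b. br b c) -` ball 0 \<epsilon>)"
      by (rule affine_map_open_vimage[OF affine_map_linear[OF lin(1)]]) simp
    moreover have "0 \<in> (\<lambda>b. br b c) -` ball 0 \<epsilon>"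
      using \<epsilon>(1) by (simp add: linear_0[OF lin(1)])
    ultimately show ?thesis
      unfolding eventually_nhds by (intro exI[of _ "(\<lambda>b. br b c) -` ball 0 \<epsilon>"]) auto
  qed
  \<comment> \<open>Finiteness of \<open>B\<close> allows one neighbourhood, hence one
    \<open>\<delta>\<close>, for all \<open>c\<close>.\<close>
  then have "\<forall>\<^sub>F b in nhds 0. \<forall>c\<in>B. norm (br b c) < \<epsilon>"
    using \<open>finite B\<close> by (simp add: eventually_ball_finite)
  then obtain \<delta> where \<delta>: "\<delta> > 0" "\<And>b c. norm b < \<delta> \<Longrightarrow> c \<in> B \<Longrightarrow> norm (br b c) < \<epsilon>"
    unfolding eventually_nhds_metric by (auto simp: dist_norm)
  have "b = 0" if b: "b \<in> base_lattice" "norm b < \<delta>" for b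
  proof -
    have "br b c = 0" if c: "c \<in> B" for c
    proof -
      have cl: "c \<in> base_lattice" using B(1) c by blast
      \<comment> \<open>In a 2-step nilpotent group the commutator is exactly the bracket, so
        brackets of lattice elements lie in \<open>\<Gamma>\<close>.\<close>
      have "lie_bracket (lift b) (lift c) = ((lift b \<star> lift c) \<star> (- lift b)) \<star> (- lift c)"
        by (simp add: vec_eq_iff forall_6 gmult_nth lie_bracket_nth algebra_simps)
      then have "lie_bracket (lift b) (lift c) \<in> \<Gamma>"
        using lift(1)[OF b(1)] lift(1)[OF cl] \<Gamma>_mult \<Gamma>_minus by simp
      then have "br b c \<in> \<Gamma>"
        by (simp add: br lift(2)[OF b(1)] lift(2)[OF cl])
      then show ?thesis
        using \<epsilon>(2) \<delta>(2)[OF b(2) c] by blast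
    qed
    then have "br b c = 0" for c
      using linear_eq_on_span[OF lin(2) linear_zero, of B b c] span_B by auto
    \<comment> \<open>These are e_1 and e_3 in base coordinates: the bracket with e_1 recovers x_3
      and x_5, the bracket with e_3 recovers x_1.\<close>
    from this[of "axis 1 1"] this[of "axis 2 1"] show "b = 0"
      by (simp add: br_def vec_eq_iff forall_6 forall_3 lie_bracket_nth from_coords_nth axis_def)
  qed
  then show ?thesis
    using \<delta>(1) by blast
qed

text \<open>A coset of the projected lattice is encoded by the set of points of the nilmanifold
  above it; this gives the point type \<open>V set set\<close> that the theorem uses for the
  base.\<close>

definition base_proj :: "real^3 \<Rightarrow> V set set" where
  "base_proj b = proj ` {x. base_coord x - b \<in> base_lattice}"

lemma base_lattice_zero: "0 \<in> base_lattice"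
  using \<Gamma>_zero linear_0[OF linear_base_coord] by (force simp: base_lattice_def)

lemma base_lattice_coset:
  assumes "b' - b \<in> base_lattice"
  shows "c - b \<in> base_lattice \<longleftrightarrow> c - b' \<in> base_lattice"
  using base_lattice_diff[OF _ assms, of "c - b"] base_lattice_diff[of "c - b'" "b - b'"]
    base_lattice_diff[OF base_lattice_zero assms] by auto

lemma base_proj_eq: "base_proj b = base_proj b' \<longleftrightarrow> b' - b \<in> base_lattice"
proof
  assume eq: "base_proj b = base_proj b'"
  have "proj (from_coords b 0) \<in> base_proj b"
    unfolding base_proj_def by (rule imageI) (simp add: base_lattice_zero)
  then have "proj (from_coords b 0) \<in> base_proj b'"
    by (simp only: eq)
  then obtain x where x: "proj (from_coords b 0) = proj x" "base_coord x - b' \<in> base_lattice"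
    unfolding base_proj_def by (elim imageE) simp
  from x(1) obtain d where "d \<in> \<Gamma>" "x = d \<star> from_coords b 0"
    by (rule nil.q_eqE)
  then have "base_coord d \<in> base_lattice" "base_coord d + b - b' \<in> base_lattice"
    using x(2) by (auto simp: base_coord_gmult base_lattice_def)
  then have "base_coord d - (base_coord d + b - b') \<in> base_lattice"
    by (rule base_lattice_diff)
  then show "b' - b \<in> base_lattice" by simp
next
  assume "b' - b \<in> base_lattice"
  from base_lattice_coset[OF this] show "base_proj b = base_proj b'"
    by (simp add: base_proj_def)
qed

sublocale base: discrete_quotient "(-)" "\<lambda>d x. x + d" base_lattice base_proj
  by (rule discrete_quotient_additive)
    (simp_all add: base_lattice_diff base_lattice_isolated base_proj_eq)

definition fibre_lattice :: "(real^3) set" where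
  "fibre_lattice = {z. from_coords 0 z \<in> \<Gamma>}"

text \<open>Cosets of the central part of \<open>\<Gamma>\<close>, embedded in \<open>V\<close>
  because \<open>fibre_bundle\<close> wants fibre points of the same type as points of the total
  space.\<close>

definition fibre_proj :: "real^3 \<Rightarrow> V set" where
  "fibre_proj z = from_coords 0 ` {w. w - z \<in> fibre_lattice}"

lemma fibre_lattice_diff: "z \<in> fibre_lattice \<Longrightarrow> z' \<in> fibre_lattice \<Longrightarrow> z - z' \<in> fibre_lattice"
proof -
  assume z: "z \<in> fibre_lattice" "z' \<in> fibre_lattice"
  have "from_coords 0 (z - z') = from_coords 0 z \<star> (- from_coords 0 z')"
    by (simp add: vec_eq_iff forall_6 gmult_nth from_coords_nth)
  then show "z - z' \<in> fibre_lattice"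
    using z \<Gamma>_mult \<Gamma>_minus by (simp add: fibre_lattice_def)
qed

lemma fibre_lattice_isolated: "\<exists>\<epsilon>>0. \<forall>z\<in>fibre_lattice. norm z < \<epsilon> \<longrightarrow> z = 0"
proof -
  obtain \<epsilon> where \<epsilon>: "\<epsilon> > 0" "\<And>d. d \<in> \<Gamma> \<Longrightarrow> norm d < \<epsilon> \<Longrightarrow> d = 0"
    using \<Gamma>_isolated by blast
  have norm: "norm (from_coords 0 z) = norm z" for z
    by (simp add: norm_vec_def L2_set_def sum_6 sum_3 from_coords_nth)
  have "z = 0" if "z \<in> fibre_lattice" "norm z < \<epsilon>" for z
    using \<epsilon>(2)[of "from_coords 0 z"] that norm by (simp add: fibre_lattice_def)
      (metis norm norm_eq_zero)
  then show ?thesis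
    using \<epsilon>(1) by blast
qed

lemma fibre_proj_eq: "fibre_proj z = fibre_proj z' \<longleftrightarrow> z' - z \<in> fibre_lattice"
proof
  have 0: "0 \<in> fibre_lattice"
    using fibre_lattice_diff \<Gamma>_zero by (simp add: fibre_lattice_def from_coords_def)
  have inj: "inj (from_coords 0)"
    by (metis coords_simps(2) injI)
  {
    assume "fibre_proj z = fibre_proj z'"
    then have eq: "{w. w - z \<in> fibre_lattice} = {w. w - z' \<in> fibre_lattice}"
      unfolding fibre_proj_def inj_image_eq_iff[OF inj] .
    have "z' \<in> {w. w - z' \<in> fibre_lattice}"
      by (simp add: 0)
    then have "z' \<in> {w. w - z \<in> fibre_lattice}"
      by (simp only: eq)
    then show "z' - z \<in> fibre_lattice" by simp
  next
    assume "z' - z \<in> fibre_lattice"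
    then have "w - z \<in> fibre_lattice \<longleftrightarrow> w - z' \<in> fibre_lattice" for w
      using fibre_lattice_diff[of "w - z" "z' - z"] fibre_lattice_diff[of "w - z'" "z - z'"]
        fibre_lattice_diff[OF 0, of "z' - z"] by auto
    then show "fibre_proj z = fibre_proj z'"
      by (simp add: fibre_proj_def)
  }
qed

sublocale fibre: discrete_quotient "(-)" "\<lambda>d x. x + d" fibre_lattice fibre_proj
  by (rule discrete_quotient_additive)
    (simp_all add: fibre_lattice_diff fibre_lattice_isolated fibre_proj_eq)

end

section \<open>The Lagrangian fibration\<close>

definition vertical :: "V set" where
  "vertical = {v. base_coord v = 0}"

lemma vertical_iff: "v \<in> vertical \<longleftrightarrow> v$1 = 0 \<and> v$3 = 0 \<and> v$5 = 0"
  by (simp add: vertical_def base_coord_eq_iff)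

lemma subspace_vertical: "subspace vertical"
  unfolding vertical_def by (rule linear_subspace_kernel[OF linear_base_coord])

lemma vertical_eq_span: "vertical = span {axis 2 1, axis 4 1, axis 6 1}"
proof
  show "span {axis 2 1, axis 4 1, axis 6 1} \<subseteq> vertical"
    by (rule span_minimal[OF _ subspace_vertical]) (auto simp: vertical_iff axis_one_nth)
  show "vertical \<subseteq> span {axis 2 1, axis 4 1, axis 6 1}"
  proof
    fix v assume "v \<in> vertical"
    then have "v = v$2 *\<^sub>R axis 2 1 + v$4 *\<^sub>R axis 4 1 + v$6 *\<^sub>R axis 6 1"
      by (simp add: vertical_iff vec_eq_iff forall_6 axis_one_nth)
    also have "\<dots> \<in> span {axis 2 1, axis 4 1, axis 6 1}"
      by (intro span_add span_scale span_base) auto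
    finally show "v \<in> span {axis 2 1, axis 4 1, axis 6 1}" .
  qed
qed

lemma dim_vertical: "dim vertical = 3"
proof -
  have "{axis 2 1, axis 4 1, axis 6 1} \<subseteq> (Basis :: V set)"
    by (auto simp: axis_in_Basis_iff)
  then have "independent {axis 2 1, axis 4 1, axis 6 1 :: V}"
    using independent_Basis by (rule independent_mono[rotated])
  then have "dim vertical = card {axis 2 1, axis 4 1, axis 6 1 :: V}"
    unfolding vertical_eq_span dim_span by (rule dim_eq_card_independent)
  then show ?thesis
    by (simp add: axis_eq_axis)
qed

lemma vertical_central: "u \<in> vertical \<Longrightarrow> lie_bracket x u = 0" "u \<in> vertical \<Longrightarrow> lie_bracket u x = 0"
  by (simp_all add: vertical_iff vec_eq_iff forall_6 lie_bracket_nth)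

lemma lie_ideal_vertical: "lie_ideal vertical"
  unfolding lie_ideal_def using subspace_vertical by (simp add: vertical_central subspace_0)

text \<open>Covers omega and its left-invariant extension at every point: pairing with a vertical
  vector sees only the coordinates 1, 3, 5 of the other one, and these are untouched by the
  differential of a left translation.\<close>

lemma lagrangian_vertical_aux:
  assumes "\<And>u v. u \<in> vertical \<Longrightarrow> w u v = - (u$2 * v$1 + u$4 * v$3 + u$6 * v$5)"
  shows "lagrangian_subspace w vertical"
  unfolding lagrangian_subspace_def
proof (intro conjI subspace_vertical Set.set_eqI iffI)
  fix v assume "v \<in> vertical"
  then show "v \<in> {v. \<forall>u\<in>vertical. w u v = 0}"
    by (simp add: assms vertical_iff)
next
  fix v assume v: "v \<in> {v. \<forall>u\<in>vertical. w u v = 0}"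
  have "axis 2 1 \<in> vertical" "axis 4 1 \<in> vertical" "axis 6 1 \<in> vertical"
    by (simp_all add: vertical_iff axis_one_nth)
  then show "v \<in> vertical"
    using v assms[of "axis 2 1" v] assms[of "axis 4 1" v] assms[of "axis 6 1" v]
    by (simp add: vertical_iff axis_one_nth)
qed

lemma lagrangian_vertical: "lagrangian_subspace (\<lambda>u v. omega [u, v]) vertical"
  by (rule lagrangian_vertical_aux) (simp add: omega_apply vertical_iff)

lemma lagrangian_vertical_left: "lagrangian_subspace (\<lambda>u v. left_form omega x [u, v]) vertical"
proof (rule lagrangian_vertical_aux)
  fix u v assume "u \<in> vertical"
  then show "left_form omega x [u, v] = - (u$2 * v$1 + u$4 * v$3 + u$6 * v$5)"
    by (simp add: left_form_def inv_G translation_derivative vertical_central omega_apply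
        lie_bracket_nth) (simp add: vertical_iff)
qed

text \<open>Left-invariant fields of central vectors are constant in exponential
  coordinates.\<close>

lemma induced_distrib_vertical: "induced_distrib vertical c p = vertical"
proof -
  have "left_field u x = u" if "u \<in> vertical" for u x
    using that by (simp add: left_field_eq vertical_central)
  then show ?thesis
    by (cases c) (simp add: induced_distrib_def)
qed

lemma fibre_coord_gmult:
  "base_coord d = 0 \<Longrightarrow> fibre_coord (d \<star> x) = fibre_coord x + fibre_coord d"
  by (simp add: vec_eq_iff forall_3 base_coord_nth fibre_coord_nth gmult_nth)

context nil_lattice
begin

section \<open>The projection to the base torus and its local triviality\<close>

definition leaf_proj :: "V set \<Rightarrow> V set set" where
  "leaf_proj p = base_proj (base_coord (SOME x. p = proj x))"

lemma base_proj_gmult: "d \<in> \<Gamma> \<Longrightarrow> base_proj (base_coord (d \<star> x)) = base_proj (base_coord x)"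
  using base.q_tr[of "base_coord d" "base_coord x"]
  by (simp add: base_coord_gmult base_lattice_def add.commute)

lemma leaf_proj_proj: "leaf_proj (proj x) = base_proj (base_coord x)"
proof -
  have "proj x = proj (SOME y. proj x = proj y)"
    by (rule someI) (rule refl)
  then obtain d where "d \<in> \<Gamma>" "(SOME y. proj x = proj y) = d \<star> x"
    by (rule nil.q_eqE)
  then show ?thesis
    by (simp add: leaf_proj_def base_proj_gmult)
qed

lemma nil_param: "affine_param (nilmanifold \<Gamma>) UNIV proj"
  unfolding nilmanifold_eq by (rule nil.affine_param_quotient)

lemma smooth_manifold_nil: "smooth_manifold (nilmanifold \<Gamma>)"
  unfolding nilmanifold_eq by (rule nil.smooth_manifold_quotient)

lemma affine_lift_leaf_proj: "affine_lift UNIV proj UNIV base_proj leaf_proj"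
  unfolding affine_lift_def
  by (intro ballI exI[of _ UNIV] exI[of _ base_coord])
    (simp add: leaf_proj_proj affine_map_linear linear_base_coord)

lemma openin_base_image: "open W \<Longrightarrow> openin (mtop (quotient_mfld base_proj)) (base_proj ` W)"
  unfolding openin_quotient_mfld using base.open_saturation by auto

lemma openin_nil_image: "open W \<Longrightarrow> openin (mtop (nilmanifold \<Gamma>)) (proj ` W)"
  unfolding nilmanifold_eq openin_quotient_mfld using nil.open_saturation by auto

text \<open>Where \<open>base_proj\<close> is injective, a representative with base coordinates in
  \<open>W\<close> is unique up to elements of \<open>\<Gamma>\<close> with zero base coordinates.
  These are central and act on fibre coordinates by addition, so base class and fibre class together
  give a product decomposition over \<open>W'\<close>.\<close>

lemma local_trivialization:
  assumes inj: "inj_on base_proj W" and W: "open W"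
  defines "W' \<equiv> base_proj ` W"
  shows "\<exists>h. diffeomorphism
      (open_part (nilmanifold \<Gamma>) {p \<in> topspace (mtop (nilmanifold \<Gamma>)). leaf_proj p \<in> W'})
      (prod_mfld (open_part (quotient_mfld base_proj) W') (quotient_mfld fibre_proj)) h \<and>
    (\<forall>p\<in>topspace (mtop (nilmanifold \<Gamma>)). leaf_proj p \<in> W' \<longrightarrow> fst (h p) = leaf_proj p)"
proof -
  let ?P = "{p \<in> topspace (mtop (nilmanifold \<Gamma>)). leaf_proj p \<in> W'}"
  let ?S = "{u \<in> UNIV. proj u \<in> ?P}" and ?T = "{b \<in> UNIV. base_proj b \<in> W'} \<times> (UNIV :: (real^3) set)"
  define h where
    "h p = (leaf_proj p, fibre_proj (fibre_coord (SOME x. p = proj x \<and> base_coord x \<in> W)))" for p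
  define k where
    "k cf = proj (from_coords (inv_into W base_proj (fst cf)) (SOME z. snd cf = fibre_proj z))" for cf
  have openW': "openin (mtop (quotient_mfld base_proj)) W'"
    unfolding W'_def by (rule openin_base_image[OF W])
  have "openin (mtop (nilmanifold \<Gamma>)) ?P"
    by (rule openin_continuous_map_preimage[OF affine_lift_continuous[OF nil_param base.affine_param_quotient
          affine_lift_leaf_proj] openW'])
  then have M: "affine_param (open_part (nilmanifold \<Gamma>) ?P) ?S proj"
    by (rule affine_param_open_part[OF nil_param])
  have N: "affine_param (prod_mfld (open_part (quotient_mfld base_proj) W') (quotient_mfld fibre_proj))
      ?T (map_prod base_proj fibre_proj)"
    by (rule affine_param_prod[OF affine_param_open_part[OF base.affine_param_quotient openW']
          fibre.affine_param_quotient])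
  have S_iff: "u \<in> ?S \<longleftrightarrow> base_proj (base_coord u) \<in> W'" for u
    by (simp add: topspace_nilmanifold leaf_proj_proj)
  have hp: "h (proj x) = (base_proj (base_coord x), fibre_proj (fibre_coord x))" if x: "base_coord x \<in> W" for x
  proof -
    define y where "y = (SOME y. proj x = proj y \<and> base_coord y \<in> W)"
    have y: "proj x = proj y" "base_coord y \<in> W"
      using someI[of "\<lambda>y. proj x = proj y \<and> base_coord y \<in> W" x] x by (auto simp: y_def)
    from y(1) obtain d where d: "d \<in> \<Gamma>" "y = d \<star> x"
      by (rule nil.q_eqE)
    \<comment> \<open>Both lie in \<open>W\<close> and have the same class in the base, so
      injectivity applies; the element \<open>d\<close> relating \<open>x\<close> and
      \<open>y\<close> is then central.\<close>
    have "base_coord y = base_coord x"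
      using inj_onD[OF inj _ y(2) x] base_proj_gmult[OF d(1)] by (simp add: d(2))
    then have d0: "base_coord d = 0"
      by (simp add: d(2) base_coord_gmult)
    then have "from_coords 0 (fibre_coord d) = d"
      using coords_simps(3)[of d] by simp
    then have "fibre_coord d \<in> fibre_lattice"
      using d(1) by (simp add: fibre_lattice_def)
    then have "fibre_proj (fibre_coord y) = fibre_proj (fibre_coord x)"
      using fibre.q_tr by (simp add: d(2) fibre_coord_gmult[OF d0])
    then show ?thesis
      by (simp add: h_def leaf_proj_proj y_def)
  qed
  have kp: "k (base_proj b, fibre_proj z) = proj (from_coords b z)" if b: "b \<in> W" for b z
  proof -
    define z' where "z' = (SOME z'. fibre_proj z = fibre_proj z')"
    have "fibre_proj z = fibre_proj z'"
      unfolding z'_def by (rule someI) (rule refl)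
    then have z': "from_coords 0 (z' - z) \<in> \<Gamma>"
      by (simp add: fibre_proj_eq fibre_lattice_def)
    have "from_coords b z' = from_coords 0 (z' - z) \<star> from_coords b z"
      by (simp add: vec_eq_iff forall_6 gmult_nth from_coords_nth)
    then have "proj (from_coords b z') = proj (from_coords b z)"
      using nil.q_tr[OF z'] by simp
    then show ?thesis
      by (simp add: k_def z'_def inv_into_f_f[OF inj b])
  qed
  \<comment> \<open>A single lattice element moves a whole neighbourhood over \<open>W\<close>; the
    affine lifts of both \<open>h\<close> and \<open>k\<close> are built from it.\<close>
  have move: "\<exists>N d. open N \<and> b \<in> N \<and> d \<in> \<Gamma> \<and> (\<forall>c\<in>N. base_coord d + c \<in> W)" if b: "base_proj b \<in> W'" for b
  proof -
    from W inj b[unfolded W'_def] obtain N c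
      where N: "open N" "b \<in> N" "c \<in> base_lattice" "\<And>v. v \<in> N \<Longrightarrow> v + c \<in> W"
      by (rule base.local_section) (rule that)
    from N(3) obtain d where "d \<in> \<Gamma>" "c = base_coord d"
      by (auto simp: base_lattice_def)
    then show ?thesis
      using N by (intro exI[of _ N] exI[of _ d]) (simp add: add.commute)
  qed
  have rep: "\<exists>y. proj x = proj y \<and> base_coord y \<in> W" if x: "x \<in> ?S" for x
  proof -
    obtain N d where "base_coord x \<in> N" "d \<in> \<Gamma>" "\<forall>c\<in>N. base_coord d + c \<in> W"
      using move x unfolding S_iff by blast
    then show ?thesis
      using nil.q_tr[of d x] by (intro exI[of _ "d \<star> x"]) (simp add: base_coord_gmult)
  qed
  have lift_h: "affine_lift ?S proj ?T (map_prod base_proj fibre_proj) h"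
    unfolding affine_lift_def
  proof
    fix u assume "u \<in> ?S"
    then obtain N d where N: "open N" "base_coord u \<in> N" "d \<in> \<Gamma>" "\<forall>c\<in>N. base_coord d + c \<in> W"
      using move unfolding S_iff by blast
    show "\<exists>N g. open N \<and> u \<in> N \<and> affine_map g \<and>
        (\<forall>v\<in>N \<inter> ?S. g v \<in> ?T \<and> h (proj v) = map_prod base_proj fibre_proj (g v))"
    proof (intro exI conjI ballI)
      show "open (base_coord -` N)"
        by (rule affine_map_open_vimage[OF affine_map_linear[OF linear_base_coord] N(1)])
      show "u \<in> base_coord -` N" using N(2) by simp
      show "affine_map (\<lambda>v. (base_coord (d \<star> v), fibre_coord (d \<star> v)))"
        by (intro affine_map_Pair affine_map_compose[OF affine_map_gmult] affine_map_linear
            linear_base_coord linear_fibre_coord)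
      fix v assume "v \<in> base_coord -` N \<inter> ?S"
      then have v: "base_coord (d \<star> v) \<in> W"
        using N(4) by (simp add: base_coord_gmult)
      then show "(base_coord (d \<star> v), fibre_coord (d \<star> v)) \<in> ?T"
        by (simp add: W'_def)
      show "h (proj v) = map_prod base_proj fibre_proj (base_coord (d \<star> v), fibre_coord (d \<star> v))"
        using hp[OF v] nil.q_tr[OF N(3), of v] by simp
    qed
  qed
  have lift_k: "affine_lift ?T (map_prod base_proj fibre_proj) ?S proj k"
    unfolding affine_lift_def
  proof
    fix bz assume "bz \<in> ?T"
    then have "base_proj (fst bz) \<in> W'" by auto
    then obtain N d where N: "open N" "fst bz \<in> N" "d \<in> \<Gamma>" "\<forall>c\<in>N. base_coord d + c \<in> W"
      using move by blast
    show "\<exists>N g. open N \<and> bz \<in> N \<and> affine_map g \<and>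
        (\<forall>v\<in>N \<inter> ?T. g v \<in> ?S \<and> k (map_prod base_proj fibre_proj v) = proj (g v))"
    proof (intro exI conjI ballI)
      show "open (N \<times> (UNIV :: (real^3) set))"
        using N(1) by (simp add: open_Times)
      show "bz \<in> N \<times> UNIV" using N(2) by (cases bz) simp
      have "affine_map (\<lambda>v::(real^3) \<times> (real^3). (base_coord d + fst v, snd v))"
        using affine_map_Pair[OF affine_mapI[OF linear_fst] affine_map_linear[OF linear_snd], of "base_coord d"]
        by (simp add: add.commute)
      from affine_map_compose[OF this affine_map_linear[OF linear_from_coords]]
      show "affine_map (\<lambda>v::(real^3) \<times> (real^3). from_coords (base_coord d + fst v) (snd v))"
        by simp
      fix v assume "v \<in> N \<times> UNIV \<inter> ?T"
      then have v: "base_coord d + fst v \<in> W"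
        using N(4) by auto
      then show "from_coords (base_coord d + fst v) (snd v) \<in> ?S"
        unfolding S_iff by (simp add: W'_def)
      have "base_proj (fst v) = base_proj (base_coord d + fst v)"
        using base.q_tr[of "base_coord d" "fst v"] N(3) by (simp add: base_lattice_def add.commute)
      then show "k (map_prod base_proj fibre_proj v) = proj (from_coords (base_coord d + fst v) (snd v))"
        using kp[OF v] by (cases v) simp
    qed
  qed
  have "diffeomorphism (open_part (nilmanifold \<Gamma>) ?P)
      (prod_mfld (open_part (quotient_mfld base_proj) W') (quotient_mfld fibre_proj)) h"
  proof (rule affine_lift_diffeomorphism[OF M N lift_h lift_k])
    fix p assume "p \<in> topspace (mtop (open_part (nilmanifold \<Gamma>) ?P))"
    then obtain x where "x \<in> ?S" "p = proj x"
      unfolding affine_param_basic(2)[OF M, symmetric] by blast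
    then obtain y where y: "p = proj y" "base_coord y \<in> W"
      using rep by blast
    then show "k (h p) = p"
      by (simp add: hp kp)
  next
    fix p assume "p \<in> topspace (mtop (prod_mfld (open_part (quotient_mfld base_proj) W') (quotient_mfld fibre_proj)))"
    then obtain b z where "base_proj b \<in> W'" "p = (base_proj b, fibre_proj z)"
      unfolding affine_param_basic(2)[OF N, symmetric] by auto
    then obtain c where "c \<in> W" "p = (base_proj c, fibre_proj z)"
      by (auto simp: W'_def)
    then show "h (k p) = p"
      by (simp add: hp kp)
  qed
  then show ?thesis
    by (intro exI[of _ h]) (simp add: h_def)
qed

lemma fibre_bundle_leaf_proj:
  "fibre_bundle (nilmanifold \<Gamma>) (quotient_mfld base_proj) (quotient_mfld fibre_proj) leaf_proj"
  unfolding fibre_bundle_def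
proof (intro conjI ballI)
  show "smooth_map (nilmanifold \<Gamma>) (quotient_mfld base_proj) leaf_proj"
    by (rule affine_lift_smooth_map[OF nil_param base.affine_param_quotient affine_lift_leaf_proj])
  show "leaf_proj ` topspace (mtop (nilmanifold \<Gamma>)) = topspace (mtop (quotient_mfld base_proj))"
    unfolding topspace_nilmanifold topspace_quotient_mfld
  proof
    show "range base_proj \<subseteq> leaf_proj ` range proj"
    proof
      fix p assume "p \<in> range base_proj"
      then obtain b where "p = base_proj b" by blast
      then have "p = leaf_proj (proj (from_coords b 0))"
        by (simp add: leaf_proj_proj)
      then show "p \<in> leaf_proj ` range proj" by blast
    qed
  qed (auto simp: leaf_proj_proj)
  fix b assume "b \<in> topspace (mtop (quotient_mfld base_proj))"
  then obtain x where x: "b = base_proj x"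
    by (auto simp: topspace_quotient_mfld)
  obtain \<delta> where \<delta>: "\<delta> > 0" "inj_on base_proj (ball x \<delta>)"
    using base.local_injective by blast
  have "openin (mtop (quotient_mfld base_proj)) (base_proj ` ball x \<delta>)"
    by (rule openin_base_image) simp
  moreover have "b \<in> base_proj ` ball x \<delta>"
    using \<delta>(1) by (simp add: x)
  ultimately show "\<exists>W h. openin (mtop (quotient_mfld base_proj)) W \<and> b \<in> W \<and>
      diffeomorphism (open_part (nilmanifold \<Gamma>) {p \<in> topspace (mtop (nilmanifold \<Gamma>)). leaf_proj p \<in> W})
        (prod_mfld (open_part (quotient_mfld base_proj) W) (quotient_mfld fibre_proj)) h \<and>
      (\<forall>p\<in>topspace (mtop (nilmanifold \<Gamma>)). leaf_proj p \<in> W \<longrightarrow> fst (h p) = leaf_proj p)"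
    using local_trivialization[OF \<delta>(2) open_ball] by blast
qed (intro smooth_manifold_nil base.smooth_manifold_quotient fibre.smooth_manifold_quotient)+

text \<open>In any pair of charts \<open>leaf_proj\<close> is locally \<open>base_coord\<close> plus
  a constant, so the kernel of its derivative is \<open>vertical\<close>.\<close>

lemma lagrangian_fibration_leaf_proj:
  "lagrangian_fibration (nilmanifold \<Gamma>) (induced_two_form omega)
     (quotient_mfld base_proj) (quotient_mfld fibre_proj) leaf_proj"
  unfolding lagrangian_fibration_def
proof (intro conjI fibre_bundle_leaf_proj ball_case_prodI ballI impI)
  fix U x V y p
  assume U: "(U, x) \<in> atlas (nilmanifold \<Gamma>)" and V: "(V, y) \<in> atlas (quotient_mfld base_proj)"
    and p: "p \<in> U" "leaf_proj p \<in> V"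
  note D = affine_paramD[OF nil_param U]
  obtain W where W: "V = base_proj ` W" "y = inv_into W base_proj" "open W" "inj_on base_proj W"
    using V unfolding atlas_quotient_mfld by blast
  have "base_proj (base_coord (x p)) \<in> base_proj ` W"
    using p D(4)[OF p(1)] W(1) leaf_proj_proj[of "x p"] by simp
  with W(3,4) obtain N d where N: "open N" "base_coord (x p) \<in> N"
      "\<And>v. v \<in> N \<Longrightarrow> inv_into W base_proj (base_proj v) = v + d"
    by (rule base.local_section) (rule that)
  have "frechet_derivative (y \<circ> leaf_proj \<circ> inv_into U x) (at (x p))
      = (\<lambda>v. (base_coord v + d) - (base_coord 0 + d))"
  proof (rule frechet_derivative_affine(2))
    show "open (x ` U \<inter> base_coord -` N)"
      by (intro open_Int D(2) affine_map_open_vimage[OF affine_map_linear[OF linear_base_coord] N(1)])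
    show "x p \<in> x ` U \<inter> base_coord -` N"
      using p N(2) by simp
    show "affine_map (\<lambda>v. base_coord v + d)"
      by (rule affine_mapI[OF linear_base_coord])
    fix v assume v: "v \<in> x ` U \<inter> base_coord -` N"
    then show "(y \<circ> leaf_proj \<circ> inv_into U x) v = base_coord v + d"
      using affine_param_inv(1)[OF nil_param U, of v] N(3) by (simp add: W(2) leaf_proj_proj)
  qed
  then have "{v. frechet_derivative (y \<circ> leaf_proj \<circ> inv_into U x) (at (x p)) v = 0} = vertical"
    by (simp add: vertical_def linear_0[OF linear_base_coord])
  then show "lagrangian_subspace (induced_two_form omega (U, x) p)
      {v. frechet_derivative (y \<circ> leaf_proj \<circ> inv_into U x) (at (x p)) v = 0}"
    using lagrangian_vertical_left by (simp add: induced_two_form_def)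
qed

section \<open>The leaves, their connectedness and foliated charts\<close>

definition leaves :: "V set set set" where
  "leaves = (\<lambda>b. {p \<in> topspace (mtop (nilmanifold \<Gamma>)). leaf_proj p = b})
     ` topspace (mtop (quotient_mfld base_proj))"

lemma leaves_eq: "leaves = range (\<lambda>b. {p \<in> range proj. leaf_proj p = base_proj b})"
  by (auto simp: leaves_def topspace_nilmanifold topspace_quotient_mfld)

lemma connectedin_proj_image: "convex A \<Longrightarrow> connectedin (mtop (nilmanifold \<Gamma>)) (proj ` A)"
  using affine_param_basic(3)[OF nil_param]
  by (intro connectedin_continuous_map_image[of "top_of_set UNIV"]) (auto simp: convex_connected)

text \<open>Upstairs the leaf may consist of many parallel affine subspaces, but each is carried by
  a lattice element onto the one over \<open>b\<close>, whose image is therefore the whole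
  leaf.\<close>

lemma connectedin_leaf: "connectedin (mtop (nilmanifold \<Gamma>)) {p \<in> range proj. leaf_proj p = base_proj b}"
proof -
  have "{p \<in> range proj. leaf_proj p = base_proj b} = proj ` {x. base_coord x = b}"
  proof
    show "proj ` {x. base_coord x = b} \<subseteq> {p \<in> range proj. leaf_proj p = base_proj b}"
      by (auto simp: leaf_proj_proj)
    show "{p \<in> range proj. leaf_proj p = base_proj b} \<subseteq> proj ` {x. base_coord x = b}"
    proof clarify
      fix x assume "leaf_proj (proj x) = base_proj b"
      then have "base_proj (base_coord x) = base_proj b"
        by (simp only: leaf_proj_proj)
      then obtain c where c: "c \<in> base_lattice" "b = base_coord x + c"
        by (rule base.q_eqE)
      then obtain d where d: "d \<in> \<Gamma>" "b = base_coord x + base_coord d"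
        unfolding base_lattice_def by blast
      have "proj x = proj (d \<star> x)"
        using nil.q_tr[OF d(1)] by simp
      moreover have "base_coord (d \<star> x) = b"
        by (simp add: base_coord_gmult d(2) add.commute)
      ultimately show "proj x \<in> proj ` {x. base_coord x = b}" by blast
    qed
  qed
  moreover have "convex {x. base_coord x = b}"
    using convex_linear_vimage[OF linear_base_coord, of "{b}"] by (simp add: vimage_def)
  ultimately show ?thesis
    using connectedin_proj_image by simp
qed

text \<open>The chart is a section over a ball so small that a leaf meets it in at most one slice.
  This slice is convex, hence its image is connected, so the intersection with the leaf is a single
  plaque.\<close>

lemma foliated_chart_leaves:
  obtains U y where "proj x0 \<in> U" "foliated_chart 3 (nilmanifold \<Gamma>) leaves U y vertical"
    "\<And>V x q. (V, x) \<in> atlas (nilmanifold \<Gamma>) \<Longrightarrow> q \<in> U \<Longrightarrow> q \<in> V \<Longrightarrow>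
       {v. frechet_derivative (y \<circ> inv_into V x) (at (x q)) v \<in> vertical} = vertical"
proof -
  obtain \<delta>1 where \<delta>1: "\<delta>1 > 0" "inj_on proj (ball x0 \<delta>1)"
    using nil.local_injective by blast
  obtain \<epsilon> where \<epsilon>: "\<epsilon> > 0" "\<And>b. b \<in> base_lattice \<Longrightarrow> norm b < \<epsilon> \<Longrightarrow> b = 0"
    using base_lattice_isolated by blast
  \<comment> \<open>The bound \<open>\<delta>1\<close> makes \<open>proj\<close> injective. The
    bound \<open>\<epsilon> / 2\<close> keeps base coordinates of two points of \<open>W\<close>
    less than \<open>\<epsilon>\<close> apart, so they coincide as soon as they agree modulo the
    projected lattice.\<close>
  define W where "W = ball x0 (min \<delta>1 (\<epsilon> / 2))"
  define y where "y = inv_into W proj"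
  have W: "x0 \<in> W" "open W" "convex W" "inj_on proj W"
    using \<delta>1 \<epsilon>(1) by (auto simp: W_def intro: inj_on_subset)
  have small: "base_coord u = base_coord v"
    if "u \<in> W" "v \<in> W" "base_proj (base_coord u) = base_proj (base_coord v)" for u v
  proof -
    have "norm (base_coord v - base_coord u) \<le> norm (v - u)"
      using norm_base_coord[of "v - u"] by (simp add: linear_diff[OF linear_base_coord])
    also have "\<dots> < \<epsilon>"
      using that(1,2) dist_triangle_less_add[of v x0 "\<epsilon>/2" u "\<epsilon>/2"]
      by (simp add: W_def dist_norm norm_minus_commute)
    finally show ?thesis
      using \<epsilon>(2)[of "base_coord v - base_coord u"] that(3) by (simp add: base_proj_eq)
  qed
  have yp: "y (proj u) = u" if "u \<in> W" for u
    using W(4) that by (simp add: y_def)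
  have yU: "y ` proj ` W = W"
    by (simp add: image_image yp)
  have openU: "openin (mtop (nilmanifold \<Gamma>)) (proj ` W)"
    by (rule openin_nil_image[OF W(2)])
  note M = affine_param_open_part[OF nil_param openU]
  have lift_y: "affine_lift {u \<in> UNIV. proj u \<in> proj ` W} proj W id y"
    unfolding affine_lift_def
  proof
    fix u assume "u \<in> {u \<in> UNIV. proj u \<in> proj ` W}"
    then have "proj u \<in> proj ` W" by simp
    with W(2,4) obtain N d where N: "open N" "u \<in> N" "\<And>v. v \<in> N \<Longrightarrow> d \<star> v \<in> W"
        "\<And>v. v \<in> N \<Longrightarrow> inv_into W proj (proj v) = d \<star> v"
      by (rule nil.local_section) (rule that)
    then show "\<exists>N g. open N \<and> u \<in> N \<and> affine_map g \<and>
        (\<forall>v\<in>N \<inter> {u \<in> UNIV. proj u \<in> proj ` W}. g v \<in> W \<and> y (proj v) = id (g v))"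
      using affine_map_gmult[of d] by (intro exI[of _ N] exI[of _ "\<lambda>v. d \<star> v"]) (simp add: y_def)
  qed
  have lift_p: "affine_lift W id {u \<in> UNIV. proj u \<in> proj ` W} proj proj"
    unfolding affine_lift_def
    by (intro ballI exI[of _ W] exI[of _ id]) (simp add: W(2) affine_map_id)
  have diffeo: "diffeomorphism (open_part (nilmanifold \<Gamma>) (proj ` W)) (euclidean_mfld W) y"
  proof (rule affine_lift_diffeomorphism[OF M affine_param_euclidean[OF W(2)] lift_y lift_p])
    fix p assume "p \<in> topspace (mtop (open_part (nilmanifold \<Gamma>) (proj ` W)))"
    then show "proj (y p) = p"
      by (auto simp: open_part_def yp)
  qed (simp add: euclidean_mfld_def yp)
  have "\<exists>a. C = {q \<in> proj ` W. y q - a \<in> vertical}"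
    if L: "L \<in> leaves" and C: "C \<in> connected_components_of (subtopology (mtop (nilmanifold \<Gamma>)) (proj ` W \<inter> L))" for L C
  proof -
    let ?X = "subtopology (mtop (nilmanifold \<Gamma>)) (proj ` W \<inter> L)"
    obtain b where b: "L = {p \<in> range proj. leaf_proj p = base_proj b}"
      using L unfolding leaves_eq by blast
    have top: "topspace ?X = proj ` W \<inter> L"
      by (auto simp: topspace_nilmanifold topspace_subtopology)
    obtain p where p: "p \<in> proj ` W \<inter> L" "C = connected_component_of_set ?X p"
      using C unfolding connected_components_of_def top by blast
    obtain a where a: "a \<in> W" "p = proj a"
      using p(1) by blast
    then have ab: "base_proj (base_coord a) = base_proj b"
      using p(1) b leaf_proj_proj by simp
    have "proj u \<in> L \<longleftrightarrow> u - a \<in> vertical" if u: "u \<in> W" for u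
    proof -
      have "proj u \<in> L \<longleftrightarrow> base_proj (base_coord u) = base_proj (base_coord a)"
        unfolding b ab by (simp add: leaf_proj_proj)
      also have "\<dots> \<longleftrightarrow> base_coord u = base_coord a"
        using small[OF u a(1)] by metis
      finally show ?thesis
        by (simp add: vertical_def linear_diff[OF linear_base_coord])
    qed
    then have slice: "proj ` W \<inter> L = proj ` (W \<inter> {u. u - a \<in> vertical})"
      by auto
    have "convex {u. base_coord (u - a) = 0}"
    proof -
      have "{u. base_coord (u - a) = 0} = base_coord -` {base_coord a}"
        by (auto simp: linear_diff[OF linear_base_coord])
      then show ?thesis
        using convex_linear_vimage[OF linear_base_coord, of "{base_coord a}"] by simp
    qed
    then have "connectedin (mtop (nilmanifold \<Gamma>)) (proj ` W \<inter> L)"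
      unfolding slice vertical_def mem_Collect_eq by (intro connectedin_proj_image convex_Int W(3))
    then have "connected_space ?X"
      by (simp add: connectedin_def)
    then have "C = proj ` W \<inter> L"
      using p by (simp add: connected_space_connected_component_set top del: topspace_subtopology)
    also have "\<dots> = {q \<in> proj ` W. y q - a \<in> vertical}"
      unfolding slice by (auto simp: yp)
    finally show ?thesis by blast
  qed
  then have "foliated_chart 3 (nilmanifold \<Gamma>) leaves (proj ` W) y vertical"
    unfolding foliated_chart_def yU
    using openU W diffeo subspace_vertical dim_vertical by blast
  moreover have "{v. frechet_derivative (y \<circ> inv_into V x) (at (x q)) v \<in> vertical} = vertical"
    if V: "(V, x) \<in> atlas (nilmanifold \<Gamma>)" and q: "q \<in> proj ` W" "q \<in> V" for V x q
  proof -
    note D = affine_paramD[OF nil_param V]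
    have "proj (x q) \<in> proj ` W"
      using D(4) q by simp
    with W(2,4) obtain N d where N: "open N" "x q \<in> N"
        "\<And>v. v \<in> N \<Longrightarrow> inv_into W proj (proj v) = d \<star> v"
      by (rule nil.local_section) (rule that)
    \<comment> \<open>The two charts differ by a left translation, whose linear part alters central
      coordinates only and thus preserves \<open>vertical\<close>.\<close>
    have "frechet_derivative (y \<circ> inv_into V x) (at (x q)) = (\<lambda>v. d \<star> v - d \<star> 0)"
    proof (rule frechet_derivative_affine(2))
      show "open (x ` V \<inter> N)" "x q \<in> x ` V \<inter> N"
        using D(2) N q by auto
      show "affine_map (\<lambda>v. d \<star> v)" by (rule affine_map_gmult)
      show "(y \<circ> inv_into V x) v = d \<star> v" if "v \<in> x ` V \<inter> N" for v
        using that affine_param_inv(1)[OF nil_param V, of v] N(3) by (simp add: y_def)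
    qed
    then show ?thesis
      by (simp add: vertical_def linear_diff[OF linear_base_coord] base_coord_gmult
          linear_0[OF linear_base_coord])
  qed
  ultimately show thesis
    using that[of "proj ` W" y] W(1) by blast
qed

lemma lagrangian_foliation_leaves:
  "lagrangian_foliation (nilmanifold \<Gamma>) (induced_two_form omega) leaves (induced_distrib vertical)"
proof -
  have "partition_on (topspace (mtop (nilmanifold \<Gamma>))) leaves"
  proof (rule partition_onI)
    show "\<Union>leaves = topspace (mtop (nilmanifold \<Gamma>))"
      by (auto simp: leaves_eq topspace_nilmanifold leaf_proj_proj)
    show "disjnt L L'" if "L \<in> leaves" "L' \<in> leaves" "L \<noteq> L'" for L L'
      using that by (auto simp: leaves_eq disjnt_iff)
    show "{} \<notin> leaves"
    proof
      assume "{} \<in> leaves"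
      then obtain b where b: "{} = {p \<in> range proj. leaf_proj p = base_proj b}"
        unfolding leaves_eq by blast
      have "proj (from_coords b 0) \<in> {p \<in> range proj. leaf_proj p = base_proj b}"
        by (simp add: leaf_proj_proj)
      then show False
        using b by blast
    qed
  qed
  moreover have "\<exists>U y P. p \<in> U \<and> foliated_chart 3 (nilmanifold \<Gamma>) leaves U y P \<and>
      (\<forall>(V, x)\<in>atlas (nilmanifold \<Gamma>). \<forall>q\<in>U \<inter> V. induced_distrib vertical (V, x) q
         = {v. frechet_derivative (y \<circ> inv_into V x) (at (x q)) v \<in> P})"
    if p: "p \<in> topspace (mtop (nilmanifold \<Gamma>))" for p
  proof -
    obtain x0 where x0: "p = proj x0"
      using p by (auto simp: topspace_nilmanifold)
    obtain U y where U: "proj x0 \<in> U" "foliated_chart 3 (nilmanifold \<Gamma>) leaves U y vertical"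
      and d: "\<And>V x q. (V, x) \<in> atlas (nilmanifold \<Gamma>) \<Longrightarrow> q \<in> U \<Longrightarrow> q \<in> V \<Longrightarrow>
         {v. frechet_derivative (y \<circ> inv_into V x) (at (x q)) v \<in> vertical} = vertical"
      by (rule foliated_chart_leaves[of x0]) (rule that)
    show ?thesis
    proof (intro exI conjI ball_case_prodI ballI)
      fix V x q assume "(V, x) \<in> atlas (nilmanifold \<Gamma>)" "q \<in> U \<inter> V"
      then show "induced_distrib vertical (V, x) q
         = {v. frechet_derivative (y \<circ> inv_into V x) (at (x q)) v \<in> vertical}"
        using d by (simp add: induced_distrib_vertical)
    qed (use U x0 in simp_all)
  qed
  moreover have "\<forall>L\<in>leaves. connectedin (mtop (nilmanifold \<Gamma>)) L"
    using connectedin_leaf by (auto simp: leaves_eq)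
  moreover have "lagrangian_distrib (nilmanifold \<Gamma>) (induced_two_form omega) (induced_distrib vertical)"
    unfolding lagrangian_distrib_def induced_distrib_vertical
    using lagrangian_vertical_left by (auto simp: induced_two_form_def)
  ultimately show ?thesis
    unfolding lagrangian_foliation_def foliation_def using smooth_manifold_nil by simp
qed

end

section \<open>The theorem\<close>

lemma form_kernel_e135: "form_kernel (e3 1 3 5) = vertical"
proof (rule Set.set_eqI)
  fix v
  show "v \<in> form_kernel (e3 1 3 5) \<longleftrightarrow> v \<in> vertical"
  proof
    assume "v \<in> form_kernel (e3 1 3 5)"
    then have "contract v (e3 1 3 5) vs = 0" for vs
      by (simp add: form_kernel_def)
    from this[of "[axis 3 1, axis 5 1]"] this[of "[axis 1 1, axis 5 1]"] this[of "[axis 1 1, axis 3 1]"]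
    show "v \<in> vertical"
      by (simp add: contract_apply e3_apply axis_one_nth vertical_iff)
  next
    assume v: "v \<in> vertical"
    have "contract v (e3 1 3 5) vs = 0" for vs
      using v by (cases vs rule: list_cases_2)
        (simp_all add: contract_apply e3_apply e3_degree vertical_iff)
    then show "v \<in> form_kernel (e3 1 3 5)"
      by (simp add: form_kernel_def fun_eq_iff)
  qed
qed

theorem mainTheorem1:
  fixes \<phi>0 :: form
  assumes "\<phi>0 \<in> kforms 3"
  shows
    "let H = coH (coeffs_of \<phi>0);
         \<R> = calR (coeffs_of \<phi>0);
         A = (\<lambda>\<psi>. coA (coeffs_of \<psi>));
         \<phi>inf = e3 1 3 5
     in
     \<comment> \<open>every 3-form has unique coefficients\<close>
     (\<forall>\<psi>\<in>kforms 3. \<exists>!c. \<psi> = of_coeffs c) \<and>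
     \<comment> \<open>(i)\<close>
     (\<forall>J \<phi>. is_interval J \<and> 0 \<in> J \<and> flow_solution J \<phi> \<and> \<phi> 0 = \<phi>0 \<longrightarrow>
        (\<forall>t\<in>J.
          (\<forall>f\<in>{coB, coC, coD, coE, coF, coG, coH, coI, coJ, coK, coL, coM, coN,
                coO, coP, coQ, coR, coS, coT}.
             f (coeffs_of (\<phi> t)) = f (coeffs_of \<phi>0)) \<and>
          calR (coeffs_of (\<phi> t)) = \<R> \<and>
          ((\<lambda>s. A (\<phi> s)) has_real_derivative - 4 * A (\<phi> t) * H\<^sup>2 + \<R>) (at t within J) \<and>
          (H \<noteq> 0 \<longrightarrow> A (\<phi> t) =
             exp (- 4 * H\<^sup>2 * t) * (\<R> * (exp (4 * H\<^sup>2 * t) - 1) / (4 * H\<^sup>2) + A \<phi>0)) \<and>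
          (H = 0 \<longrightarrow> A (\<phi> t) = A \<phi>0 + \<R> * t))) \<and>
     (\<exists>\<phi>. flow_solution {0..} \<phi> \<and> \<phi> 0 = \<phi>0) \<and>
     (\<forall>\<phi>. flow_solution {0..} \<phi> \<and> \<phi> 0 = \<phi>0 \<longrightarrow>
       \<comment> \<open>(ii)\<close>
       ((\<exists>\<psi>\<in>kforms 3. (\<phi> \<longlongrightarrow> \<psi>) at_top) \<longleftrightarrow> H \<noteq> 0 \<or> (H = 0 \<and> \<R> = 0)) \<and>
       \<comment> \<open>(iii)\<close>
       (H = 0 \<and> \<R> \<noteq> 0 \<longrightarrow>
         ((\<lambda>t. (1 / (\<R> * t)) *\<^sub>f \<phi> t) \<longlongrightarrow> \<phi>inf) at_top \<and>
         form_kernel \<phi>inf = span {axis 2 1, axis 4 1, axis 6 1} \<and>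
         lagrangian_subspace (\<lambda>u v. omega [u, v]) (form_kernel \<phi>inf) \<and>
         lie_ideal (form_kernel \<phi>inf) \<and>
         (\<forall>\<Gamma>. cocompact_discrete_subgroup \<Gamma> \<longrightarrow>
           (\<exists>\<L>. lagrangian_foliation (nilmanifold \<Gamma>) (induced_two_form omega) \<L>
                  (induced_distrib (form_kernel \<phi>inf)) \<and>
             (\<exists>(B :: (V set set, real^3) mfld) (F :: (V set, real^3) mfld) \<pi>.
                lagrangian_fibration (nilmanifold \<Gamma>) (induced_two_form omega) B F \<pi> \<and>
                \<L> = (\<lambda>b. {p \<in> topspace (mtop (nilmanifold \<Gamma>)). \<pi> p = b}) ` topspace (mtop B))))) \<and>
       \<comment> \<open>(iv)\<close>
       (H \<noteq> 0 \<longrightarrow>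
         ((\<lambda>t. A (\<phi> t)) \<longlongrightarrow> \<R> / (4 * H\<^sup>2)) at_top \<and>
         (\<exists>\<psi>\<in>kforms 3. (\<phi> \<longlongrightarrow> \<psi>) at_top \<and> stationary \<psi>)))"
proof -
  define c where "c = coeffs_of \<phi>0"
  have c: "of_coeffs c = \<phi>0"
    by (simp add: c_def of_coeffs_coeffs_of assms)
  have path: "\<phi> t = flow_path c t"
    if "is_interval J" "0 \<in> J" "flow_solution J \<phi>" "\<phi> 0 = \<phi>0" "t \<in> J" for J \<phi> t
    using flow_solution_eq_path[OF that(1,2,3,5)] that(4) by (simp add: c_def)
  have path0: "flow_path c 0 = \<phi>0"
    by (simp add: flow_path_def linear_ode_sol_0 c fun_eq_iff scale_form_apply)
  have i: "(\<forall>f\<in>{coB, coC, coD, coE, coF, coG, coH, coI, coJ, coK, coL, coM, coN,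
              coO, coP, coQ, coR, coS, coT}. f (coeffs_of (\<phi> t)) = f c) \<and>
        calR (coeffs_of (\<phi> t)) = calR c \<and>
        ((\<lambda>s. coA (coeffs_of (\<phi> s))) has_real_derivative
           - 4 * coA (coeffs_of (\<phi> t)) * (coH c)\<^sup>2 + calR c) (at t within J) \<and>
        (coH c \<noteq> 0 \<longrightarrow> coA (coeffs_of (\<phi> t)) =
           exp (- 4 * (coH c)\<^sup>2 * t) *
             (calR c * (exp (4 * (coH c)\<^sup>2 * t) - 1) / (4 * (coH c)\<^sup>2) + coA c)) \<and>
        (coH c = 0 \<longrightarrow> coA (coeffs_of (\<phi> t)) = coA c + calR c * t)"
    if sol: "is_interval J" "0 \<in> J" "flow_solution J \<phi>" "\<phi> 0 = \<phi>0" and t: "t \<in> J" for J \<phi> t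
  proof -
    note p = path[OF sol]
    have "((\<lambda>s. coA (coeffs_of (\<phi> s))) has_real_derivative
        - (4 * (coH c)\<^sup>2) * linear_ode_sol (4 * (coH c)\<^sup>2) (calR c) (coA c) t + calR c) (at t within J)"
      \<comment> \<open>The radius 1 is arbitrary, since the two functions agree on all of
        \<open>J\<close>.\<close>
      by (rule has_field_derivative_transform_within[OF linear_ode_sol_deriv zero_less_one t])
        (simp add: p flow_path_coeffs(1))
    then have "((\<lambda>s. coA (coeffs_of (\<phi> s))) has_real_derivative
        - 4 * coA (coeffs_of (\<phi> t)) * (coH c)\<^sup>2 + calR c) (at t within J)"
      by (simp add: p[OF t] flow_path_coeffs(1) mult_ac)
    moreover have "\<forall>f\<in>{coB, coC, coD, coE, coF, coG, coH, coI, coJ, coK, coL, coM, coN,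
              coO, coP, coQ, coR, coS, coT}. f (coeffs_of (\<phi> t)) = f c"
      unfolding p[OF t] using flow_path_coeffs(2) by blast
    ultimately show ?thesis
      unfolding p[OF t] flow_path_coeffs(1,3) by (simp add: linear_ode_sol_def)
  qed
  have lim: "(\<phi> \<longlongrightarrow> \<psi>) at_top \<longleftrightarrow> (flow_path c \<longlongrightarrow> \<psi>) at_top"
      "((\<lambda>t. (1 / (r * t)) *\<^sub>f \<phi> t) \<longlongrightarrow> \<psi>) at_top \<longleftrightarrow>
       ((\<lambda>t. (1 / (r * t)) *\<^sub>f flow_path c t) \<longlongrightarrow> \<psi>) at_top"
      "((\<lambda>t. coA (coeffs_of (\<phi> t))) \<longlongrightarrow> a) at_top \<longleftrightarrow>
       (linear_ode_sol (4 * (coH c)\<^sup>2) (calR c) (coA c) \<longlongrightarrow> a) at_top"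
    if "flow_solution {0..} \<phi> \<and> \<phi> 0 = \<phi>0" for \<phi> \<psi> r a
  proof -
    \<comment> \<open>The solution is controlled for nonnegative t only, which is enough for limits
      at infinity.\<close>
    have ev: "\<forall>\<^sub>F t in at_top. \<phi> t = flow_path c t"
      using eventually_ge_at_top[of 0]
      by eventually_elim (rule path[of "{0..}"], use that in \<open>simp_all add: is_interval_ci\<close>)
    show "(\<phi> \<longlongrightarrow> \<psi>) at_top \<longleftrightarrow> (flow_path c \<longlongrightarrow> \<psi>) at_top"
      by (rule tendsto_cong[OF ev])
    show "((\<lambda>t. (1 / (r * t)) *\<^sub>f \<phi> t) \<longlongrightarrow> \<psi>) at_top \<longleftrightarrow>
       ((\<lambda>t. (1 / (r * t)) *\<^sub>f flow_path c t) \<longlongrightarrow> \<psi>) at_top"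
      by (rule tendsto_cong) (use ev in eventually_elim, simp)
    show "((\<lambda>t. coA (coeffs_of (\<phi> t))) \<longlongrightarrow> a) at_top \<longleftrightarrow>
       (linear_ode_sol (4 * (coH c)\<^sup>2) (calR c) (coA c) \<longlongrightarrow> a) at_top"
      by (rule tendsto_cong) (use ev in eventually_elim, simp add: flow_path_coeffs(1))
  qed
  have geometry: "\<exists>\<L>. lagrangian_foliation (nilmanifold \<Gamma>) (induced_two_form omega) \<L>
          (induced_distrib (form_kernel (e3 1 3 5))) \<and>
        (\<exists>(B :: (V set set, real^3) mfld) (F :: (V set, real^3) mfld) \<pi>.
           lagrangian_fibration (nilmanifold \<Gamma>) (induced_two_form omega) B F \<pi> \<and>
           \<L> = (\<lambda>b. {p \<in> topspace (mtop (nilmanifold \<Gamma>)). \<pi> p = b}) ` topspace (mtop B))"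
    if "cocompact_discrete_subgroup \<Gamma>" for \<Gamma>
  proof -
    interpret nil_lattice \<Gamma> by unfold_locales (rule that)
    show ?thesis
      unfolding form_kernel_e135
      using lagrangian_foliation_leaves lagrangian_fibration_leaf_proj leaves_def by blast
  qed
  have iv: "((\<lambda>t. coA (coeffs_of (\<phi> t))) \<longlongrightarrow> calR c / (4 * (coH c)\<^sup>2)) at_top \<and>
      (\<exists>\<psi>\<in>kforms 3. (\<phi> \<longlongrightarrow> \<psi>) at_top \<and> stationary \<psi>)"
    if \<phi>: "flow_solution {0..} \<phi> \<and> \<phi> 0 = \<phi>0" and H: "coH c \<noteq> 0" for \<phi>
  proof
    show "((\<lambda>t. coA (coeffs_of (\<phi> t))) \<longlongrightarrow> calR c / (4 * (coH c)\<^sup>2)) at_top"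
      unfolding lim(3)[OF \<phi>] by (rule tendsto_linear_ode_sol) (use H in simp)
    show "\<exists>\<psi>\<in>kforms 3. (\<phi> \<longlongrightarrow> \<psi>) at_top \<and> stationary \<psi>"
      unfolding lim(1)[OF \<phi>]
      using flow_path_tendsto[OF H] flow_path_limit_stationary[OF H]
      by (blast intro: kforms_3_add of_coeffs_kforms kforms_3_scale kforms_3_e3)
  qed
  have ex: "\<exists>\<phi>. flow_solution {0..} \<phi> \<and> \<phi> 0 = \<phi>0"
    using flow_path_solution path0 by blast
  show ?thesis
    unfolding Let_def c_def[symmetric]
  proof (intro conjI allI impI ballI ex)
    show "\<exists>!c. \<psi> = of_coeffs c" if "\<psi> \<in> kforms 3" for \<psi>
      using that by (rule ex1_of_coeffs)
  next
    fix J \<phi> t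
    assume "is_interval J \<and> 0 \<in> J \<and> flow_solution J \<phi> \<and> \<phi> 0 = \<phi>0" and t: "t \<in> J"
    then have sol: "is_interval J" "0 \<in> J" "flow_solution J \<phi>" "\<phi> 0 = \<phi>0" by auto
    note * = i[OF sol t]
    show "calR (coeffs_of (\<phi> t)) = calR c"
      "((\<lambda>s. coA (coeffs_of (\<phi> s))) has_real_derivative
         - 4 * coA (coeffs_of (\<phi> t)) * (coH c)\<^sup>2 + calR c) (at t within J)"
      using * by simp_all
    show "f (coeffs_of (\<phi> t)) = f c"
      if "f \<in> {coB, coC, coD, coE, coF, coG, coH, coI, coJ, coK, coL, coM, coN,
              coO, coP, coQ, coR, coS, coT}" for f
      using * that by blast
    show "coA (coeffs_of (\<phi> t)) = exp (- 4 * (coH c)\<^sup>2 * t) *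
        (calR c * (exp (4 * (coH c)\<^sup>2 * t) - 1) / (4 * (coH c)\<^sup>2) + coA c)" if "coH c \<noteq> 0"
      using * that by blast
    show "coA (coeffs_of (\<phi> t)) = coA c + calR c * t" if "coH c = 0"
      using * that by blast
  next
    fix \<phi> assume \<phi>: "flow_solution {0..} \<phi> \<and> \<phi> 0 = \<phi>0"
    show "(\<exists>\<psi>\<in>kforms 3. (\<phi> \<longlongrightarrow> \<psi>) at_top) \<longleftrightarrow> coH c \<noteq> 0 \<or> (coH c = 0 \<and> calR c = 0)"
      unfolding lim(1)[OF \<phi>] flow_path_converges_iff by blast
    show "((\<lambda>t. coA (coeffs_of (\<phi> t))) \<longlongrightarrow> calR c / (4 * (coH c)\<^sup>2)) at_top"
      "\<exists>\<psi>\<in>kforms 3. (\<phi> \<longlongrightarrow> \<psi>) at_top \<and> stationary \<psi>" if "coH c \<noteq> 0"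
      using iv[OF \<phi> that] by simp_all
    show "((\<lambda>t. (1 / (calR c * t)) *\<^sub>f \<phi> t) \<longlongrightarrow> e3 1 3 5) at_top" if "coH c = 0 \<and> calR c \<noteq> 0"
      unfolding lim(2)[OF \<phi>] using that by (intro flow_path_rescaled_tendsto) simp_all
    show "form_kernel (e3 1 3 5) = span {axis 2 1, axis 4 1, axis 6 1}"
      by (simp only: form_kernel_e135 vertical_eq_span)
    show "lagrangian_subspace (\<lambda>u v. omega [u, v]) (form_kernel (e3 1 3 5))"
      by (simp only: form_kernel_e135 lagrangian_vertical)
    show "lie_ideal (form_kernel (e3 1 3 5))"
      by (simp only: form_kernel_e135 lie_ideal_vertical)
  qed (rule geometry)
qed

end
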